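(* In the adjacency-list model augmented with the $\texttt{IN-SORTED}$ and $\texttt{ADJ}$ queries, for any constants $p_f,\varepsilon\in(0,1)$, there is an algorithm that, given a directed graph $G=(V,E)$, nodes $s,t\in V$ and $\delta\in(0,1]$, computes an estimate $\hat\pi(s,t)$ such that with probability at least $1-p_f$, $|\hat\pi(s,t)-\pi(s,t)|\le\varepsilon\max\{\delta,\pi(s,t)\}$, and whose expected running time, averaged over all targets $t\in V$ (for any graph and any source $s$), is $\tilde O\big((1/\delta)^{2/3}\big)$.
   Context: Let $G=(V,E)$ be a directed graph with $n=|V|$ nodes and $m=|E|$ edges. Fix a constant $\alpha\in(0,1)$. An $\alpha$-discounted random walk from a node $s$: at each step, with probability $\alpha$ it terminates at the current node, and otherwise it moves to a uniformly random out-neighbor of the current node. $\pi(s,t)$ is the probability that such a walk from $s$ terminates at $t$. Adjacency-list model: the algorithm accesses $G$ only through constant-time queries $\texttt{DEG-IN}(u)$, $\texttt{DEG-OUT}(u)$ (in-/out-degree of $u$) and $\texttt{IN}(u,i)$, $\texttt{OUT}(u,i)$ ($i$-th in-/out-neighbor of $u$). Additional queries: $\texttt{ADJ}(u,v)$ returns whether $(u,v)\in E$; $\texttt{IN-SORTED}(u,i)$ returns the $i$-th in-neighbor of $u$ when the in-neighbors of $u$ are sorted by out-degree. $\tilde O$ suppresses polylogarithmic factors in $n$ and $1/\delta$. *)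

theory Defs
  imports "HOL-Probability.Probability" "Graph_Theory.Graph_Theory"
begin

section \<open>Personalized PageRank\<close>

text \<open>
  A \<^typ>\<open>'a pair_pre_digraph\<close> is \<open>G = (V, E)\<close> with \<open>E \<subseteq> V \<times> V\<close>; self-loops are allowed.
  The walk moves to a uniformly random out-neighbour, which is meaningless at a node without
  out-neighbours; there the walk terminates. On graphs whose out-degrees are all positive this
  convention has no effect.
\<close>

definition out_nbs :: "'a pair_pre_digraph \<Rightarrow> 'a \<Rightarrow> 'a set" where
  "out_nbs G u = {v. (u, v) \<in> parcs G}"

definition in_nbs :: "'a pair_pre_digraph \<Rightarrow> 'a \<Rightarrow> 'a set" where
  "in_nbs G u = {v. (v, u) \<in> parcs G}"

partial_function (spmf) disc_walk :: "real \<Rightarrow> 'a pair_pre_digraph \<Rightarrow> 'a \<Rightarrow> 'a spmf" where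
  "disc_walk \<alpha> G u =
     bind_spmf (spmf_of_pmf (bernoulli_pmf \<alpha>)) (\<lambda>stop.
       if stop \<or> out_nbs G u = {} then return_spmf u
       else bind_spmf (spmf_of_set (out_nbs G u)) (disc_walk \<alpha> G))"

definition ppr :: "real \<Rightarrow> 'a pair_pre_digraph \<Rightarrow> 'a \<Rightarrow> 'a \<Rightarrow> real" where
  "ppr \<alpha> G s t = spmf (disc_walk \<alpha> G s) t"

section \<open>Adjacency lists\<close>

text \<open>
  The order of the adjacency lists, and the order among in-neighbours of equal out-degree in the
  sorted lists, is arbitrary; an algorithm has to cope with every choice.
\<close>

record adj_lists =
  in_list :: "nat \<Rightarrow> nat list"
  out_list :: "nat \<Rightarrow> nat list"
  in_sorted_list :: "nat \<Rightarrow> nat list"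

definition represents :: "adj_lists \<Rightarrow> nat pair_pre_digraph \<Rightarrow> bool" where
  "represents L G \<longleftrightarrow>
     (\<forall>u. distinct (in_list L u) \<and> set (in_list L u) = in_nbs G u
        \<and> distinct (out_list L u) \<and> set (out_list L u) = out_nbs G u
        \<and> distinct (in_sorted_list L u) \<and> set (in_sorted_list L u) = in_nbs G u
        \<and> sorted (map (out_degree G) (in_sorted_list L u)))"

section \<open>Machine model\<close>

text \<open>
  Algorithms are programs of a randomized random access machine with one memory for natural numbers
  (node names, degrees, counters) and one for exact reals, each consisting of arrays
  addressed by a number fixed in the program text and an index computed at run time.
  The instruction set is kept small, so that unit cost is uncontroversial:
  on naturals there are only successor, predecessor and comparison, so naturals other than node
  names and degrees grow by at most a constant per step and cannot be used to pack data; on reals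
  there are the field operations and comparison but no rounding; and a program
  contains no real literals. The graph is reachable only through \<open>query\<close>. Since a program is
  a fixed finite text, its expressions have bounded size, and evaluating one takes constant time.
\<close>

datatype nexp =
    NLit nat
  | NCell nat nexp
  | NSuc nexp
  | NPred nexp

datatype rexp =
    RNat nexp
  | RCell nat nexp
  | RAdd rexp rexp
  | RSub rexp rexp
  | RMul rexp rexp
  | RDiv rexp rexp

datatype bexp =
    NLess nexp nexp
  | RLess rexp rexp
  | BNot bexp
  | BAnd bexp bexp

text \<open>Positions in adjacency lists are counted from 0.\<close>

datatype query =
    DegIn nexp
  | DegOut nexp
  | InNb nexp nexp
  | OutNb nexp nexp
  | InSorted nexp nexp
  | Adj nexp nexp

text \<open>
  The first two arguments of the assignment-like commands are the array and the index of the cell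
  that receives the result. \<open>RandNat a i k\<close> draws uniformly from \<open>{..<k}\<close>, and \<open>Coin a i p\<close> yields 1
  with probability \<open>p\<close> and 0 otherwise.
\<close>

datatype com =
    Skip
  | NSet nat nexp nexp
  | RSet nat nexp rexp
  | Ask nat nexp query
  | RandNat nat nexp nexp
  | Coin nat nexp rexp
  | Seq com com
  | Cond bexp com com
  | While bexp com

text \<open>The \<open>clock\<close> counts executed instructions and guard evaluations; programs cannot read it.\<close>

record state =
  nmem :: "nat \<Rightarrow> nat \<Rightarrow> nat"
  rmem :: "nat \<Rightarrow> nat \<Rightarrow> real"
  clock :: nat

primrec nval :: "nexp \<Rightarrow> state \<Rightarrow> nat" where
  "nval (NLit c) \<sigma> = c"
| "nval (NCell a e) \<sigma> = nmem \<sigma> a (nval e \<sigma>)"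
| "nval (NSuc e) \<sigma> = nval e \<sigma> + 1"
| "nval (NPred e) \<sigma> = nval e \<sigma> - 1"

primrec rval :: "rexp \<Rightarrow> state \<Rightarrow> real" where
  "rval (RNat e) \<sigma> = real (nval e \<sigma>)"
| "rval (RCell a e) \<sigma> = rmem \<sigma> a (nval e \<sigma>)"
| "rval (RAdd x y) \<sigma> = rval x \<sigma> + rval y \<sigma>"
| "rval (RSub x y) \<sigma> = rval x \<sigma> - rval y \<sigma>"
| "rval (RMul x y) \<sigma> = rval x \<sigma> * rval y \<sigma>"
| "rval (RDiv x y) \<sigma> = rval x \<sigma> / rval y \<sigma>"

primrec bval :: "bexp \<Rightarrow> state \<Rightarrow> bool" where
  "bval (NLess x y) \<sigma> \<longleftrightarrow> nval x \<sigma> < nval y \<sigma>"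
| "bval (RLess x y) \<sigma> \<longleftrightarrow> rval x \<sigma> < rval y \<sigma>"
| "bval (BNot b) \<sigma> \<longleftrightarrow> \<not> bval b \<sigma>"
| "bval (BAnd b c) \<sigma> \<longleftrightarrow> bval b \<sigma> \<and> bval c \<sigma>"

primrec answer :: "adj_lists \<Rightarrow> query \<Rightarrow> state \<Rightarrow> nat" where
  "answer L (DegIn u) \<sigma> = length (in_list L (nval u \<sigma>))"
| "answer L (DegOut u) \<sigma> = length (out_list L (nval u \<sigma>))"
| "answer L (InNb u i) \<sigma> = in_list L (nval u \<sigma>) ! nval i \<sigma>"
| "answer L (OutNb u i) \<sigma> = out_list L (nval u \<sigma>) ! nval i \<sigma>"
| "answer L (InSorted u i) \<sigma> = in_sorted_list L (nval u \<sigma>) ! nval i \<sigma>"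
| "answer L (Adj u v) \<sigma> = of_bool (nval v \<sigma> \<in> set (out_list L (nval u \<sigma>)))"

definition tick :: "state \<Rightarrow> state" where
  "tick \<sigma> = \<sigma>\<lparr>clock := clock \<sigma> + 1\<rparr>"

definition nstore :: "nat \<Rightarrow> nat \<Rightarrow> nat \<Rightarrow> state \<Rightarrow> state" where
  "nstore a i x \<sigma> = \<sigma>\<lparr>nmem := (nmem \<sigma>)(a := (nmem \<sigma> a)(i := x))\<rparr>"

definition rstore :: "nat \<Rightarrow> nat \<Rightarrow> real \<Rightarrow> state \<Rightarrow> state" where
  "rstore a i x \<sigma> = \<sigma>\<lparr>rmem := (rmem \<sigma>)(a := (rmem \<sigma> a)(i := x))\<rparr>"

partial_function (spmf) while_spmf :: "('s \<Rightarrow> bool) \<Rightarrow> ('s \<Rightarrow> 's spmf) \<Rightarrow> 's \<Rightarrow> 's spmf" where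
  "while_spmf b c \<sigma> = (if b \<sigma> then bind_spmf (c \<sigma>) (while_spmf b c) else return_spmf \<sigma>)"

text \<open>The mass missing from \<open>exec L c \<sigma>\<close> is the probability of divergence.\<close>

primrec exec :: "adj_lists \<Rightarrow> com \<Rightarrow> state \<Rightarrow> state spmf" where
  "exec L Skip \<sigma> = return_spmf (tick \<sigma>)"
| "exec L (NSet a i e) \<sigma> = return_spmf (tick (nstore a (nval i \<sigma>) (nval e \<sigma>) \<sigma>))"
| "exec L (RSet a i e) \<sigma> = return_spmf (tick (rstore a (nval i \<sigma>) (rval e \<sigma>) \<sigma>))"
| "exec L (Ask a i q) \<sigma> = return_spmf (tick (nstore a (nval i \<sigma>) (answer L q \<sigma>) \<sigma>))"
| "exec L (RandNat a i k) \<sigma> =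
     map_spmf (\<lambda>x. tick (nstore a (nval i \<sigma>) x \<sigma>)) (spmf_of_set {..<nval k \<sigma>})"
| "exec L (Coin a i p) \<sigma> =
     map_spmf (\<lambda>x. tick (nstore a (nval i \<sigma>) (of_bool x) \<sigma>))
       (spmf_of_pmf (bernoulli_pmf (rval p \<sigma>)))"
| "exec L (Seq c d) \<sigma> = bind_spmf (exec L c \<sigma>) (exec L d)"
| "exec L (Cond b c d) \<sigma> = (if bval b \<sigma> then exec L c (tick \<sigma>) else exec L d (tick \<sigma>))"
| "exec L (While b c) \<sigma> = while_spmf (bval b) (\<lambda>\<tau>. map_spmf tick (exec L c \<tau>)) (tick \<sigma>)"

text \<open>
  Initially array 0 of the natural memory holds \<open>s, t\<close>, array 0 of the real memory holds
  \<open>\<delta>, \<alpha>, \<epsilon>, p\<^sub>f\<close>, and all other cells hold 0. The number of nodes is not supplied.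
  The estimate is read from cell 0 of array 0 of the real memory.
\<close>

definition init_state :: "real \<Rightarrow> real \<Rightarrow> real \<Rightarrow> nat \<Rightarrow> nat \<Rightarrow> real \<Rightarrow> state" where
  "init_state \<alpha> \<epsilon> p\<^sub>f s t \<delta> =
     \<lparr>nmem = (\<lambda>_ _. 0)(0 := (\<lambda>_. 0)(0 := s, 1 := t)),
      rmem = (\<lambda>_ _. 0)(0 := (\<lambda>_. 0)(0 := \<delta>, 1 := \<alpha>, 2 := \<epsilon>, 3 := p\<^sub>f)),
      clock = 0\<rparr>"

definition estimate :: "state \<Rightarrow> real" where
  "estimate \<sigma> = rmem \<sigma> 0 0"

definition expected_time :: "state spmf \<Rightarrow> ennreal" where
  "expected_time p =
     (\<integral>\<^sup>+ r. (case r of None \<Rightarrow> \<infinity> | Some \<sigma> \<Rightarrow> of_nat (clock \<sigma>)) \<partial>measure_pmf p)"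

end

theory Submission
  imports Defs
begin

text \<open>
  Fix integers \<open>K \<approx> \<delta> powr (-1/3)\<close> and \<open>l \<approx> log (1 / \<delta>)\<close>. The endpoints of \<open>O(K l)\<close> walks from \<open>s\<close> form a set \<open>H\<close> that
  contains most nodes which are likely to be visited from \<open>s\<close>. Starting from \<open>t\<close>, residues are pushed backwards as long as
  some residue is at least \<open>1 / K\<close>: the share of an in-neighbour in \<open>H\<close> is computed exactly with \<open>Adj\<close>,
  the other shares are sampled in quanta of at most \<open>1 / K\<^sup>2\<close>. Finally \<open>O(K\<^sup>2)\<close> walks from \<open>s\<close> estimate
  the contribution of the remaining residues, which are below \<open>1 / K\<close>.

  With \<open>g u\<close> the expected number of visits to \<open>u\<close> from \<open>s\<close>, the quantity \<open>acc + (\<Sum>u. g u * res u)\<close> starts at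
  \<open>ppr s t\<close> and is a martingale; a sampled quantum at \<open>u\<close> contributes variance proportional to
  \<open>(g u)\<^sup>2 / K\<^sup>2\<close>, and \<open>(g u)\<^sup>2 P(u \<notin> H) = O(g u / (K l))\<close>, so the total variance is \<open>O(\<delta> max {\<delta>, ppr s t})\<close>.
  In time, averaging over \<open>t\<close> uses only \<open>(\<Sum>t. ppr w t) \<le> 1\<close>.

  Sampling in-neighbours must avoid arithmetic on indices. A uniform index \<open>p\<close> below \<open>b\<close> serves as pivot; since
  the shares decrease along the sorted list, \<open>\<lceil>b w\<^sub>p K\<^sup>2\<rceil>\<close> uniform draws below \<open>b\<close>, of which those below \<open>p\<close> are
  discarded, treat the indices from \<open>p\<close> to \<open>b\<close> with quanta of at most \<open>1 / K\<^sup>2\<close>, and then \<open>p\<close> replaces \<open>b\<close>. The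
  mean of \<open>b w\<^sub>p\<close> is the total share, and the expected number of pivots is a harmonic number.

  Time and variance are handled by a single potential, the sum of \<open>A\<close> times the clock, a linear
  form in the residues and \<open>B\<close> times the squared error of the martingale. The time bound is the case
  \<open>A = 1\<close>, \<open>B = 0\<close>; the error bound is the limit \<open>A \<rightarrow> 0\<close> for \<open>B = 1\<close>.
\<close>

section \<open>Expected costs of programs\<close>

text \<open>Divergence is charged \<open>\<infinity>\<close>, so a finite bound on
  \<open>ewp\<close> also shows termination with probability one.\<close>

definition ewp :: "'a spmf \<Rightarrow> ('a \<Rightarrow> ennreal) \<Rightarrow> ennreal" where
  "ewp p f = (\<integral>\<^sup>+ r. (case r of None \<Rightarrow> \<infinity> | Some x \<Rightarrow> f x) \<partial>measure_pmf p)"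

text \<open>With the value \<open>\<infinity>\<close> outside \<open>I\<close>, one finite bound on
  an expectation says both that \<open>I\<close> holds with probability one and that the mean of
  \<open>J\<close> is bounded.\<close>

definition post :: "('a \<Rightarrow> bool) \<Rightarrow> ('a \<Rightarrow> real) \<Rightarrow> 'a \<Rightarrow> ennreal" where
  "post I J x = (if I x then ennreal (J x) else \<infinity>)"

lemma ewp_return [simp]: "ewp (return_spmf x) f = f x"
  by (simp add: ewp_def)

lemma ewp_bind: "ewp (bind_spmf p q) f = ewp p (\<lambda>x. ewp (q x) f)"
  unfolding ewp_def bind_spmf_def nn_integral_bind_pmf
  by (intro nn_integral_cong) (auto split: option.split)

lemma ewp_map: "ewp (map_spmf g p) f = ewp p (\<lambda>x. f (g x))"
  unfolding ewp_def nn_integral_map_pmf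
  by (intro nn_integral_cong) (auto split: option.split)

lemma ewp_uniform: "0 < k \<Longrightarrow> ewp (spmf_of_set {..<k::nat}) f = (\<Sum>i<k. f i) / of_nat k"
  unfolding ewp_def spmf_of_set_def
  by (subst if_P) (auto simp: nn_integral_pmf_of_set spmf_of_pmf_def lessThan_empty_iff
      simp del: spmf_of_pmf_pmf_of_set)

lemma ewp_bernoulli:
  "0 \<le> p \<Longrightarrow> p \<le> 1 \<Longrightarrow>
    ewp (spmf_of_pmf (bernoulli_pmf p)) f = ennreal p * f True + ennreal (1 - p) * f False"
  unfolding ewp_def spmf_of_pmf_def by (simp add: mult.commute)

text \<open>The claim restricts only the support, so it is admissible and trivially true of the
  empty subdistribution from which the loop is approximated.\<close>

lemma clock_while_mono:
  assumes "\<And>\<sigma> \<tau>. \<tau> \<in> set_spmf (c \<sigma>) \<Longrightarrow> clock \<sigma> \<le> clock \<tau>"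
  shows "\<tau> \<in> set_spmf (while_spmf b c \<sigma>) \<Longrightarrow> clock \<sigma> \<le> clock \<tau>"
proof -
  have "\<forall>\<sigma>. \<forall>\<tau>\<in>set_spmf (while_spmf b c \<sigma>). clock \<sigma> \<le> clock \<tau>"
  proof (induction rule: while_spmf.fixp_induct)
    case 1
    show ?case by simp
  next
    case 2
    show ?case by simp
  next
    case (3 w)
    then show ?case
      using assms by (force split: if_splits simp: set_bind_spmf)
  qed
  then show "\<tau> \<in> set_spmf (while_spmf b c \<sigma>) \<Longrightarrow> clock \<sigma> \<le> clock \<tau>" by blast
qed

lemma clock_exec_mono: "\<tau> \<in> set_spmf (exec L c \<sigma>) \<Longrightarrow> clock \<sigma> \<le> clock \<tau>"
proof (induction c arbitrary: \<sigma> \<tau>)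
  case (Seq c d)
  then show ?case by (force simp: set_bind_spmf)
next
  case (Cond b c d)
  show ?case
    using Cond.prems Cond.IH(1)[of \<tau> "tick \<sigma>"] Cond.IH(2)[of \<tau> "tick \<sigma>"]
    by (auto simp: tick_def split: if_splits)
next
  case (While b c)
  have "clock (tick \<sigma>) \<le> clock \<tau>"
    by (rule clock_while_mono[where b = "bval b" and c = "\<lambda>\<tau>. map_spmf tick (exec L c \<tau>)"])
      (use While in \<open>force simp: tick_def\<close>)+
  then show ?case by (simp add: tick_def)
qed (auto simp: tick_def nstore_def rstore_def)

text \<open>
  A loop that would diverge with positive probability has infinite cost, because every iteration
  advances the clock: \<open>R n\<close> below, the probability that more than \<open>n\<close> iterations happen, is
  \<open>O(1 / n)\<close>. Truncating the postexpectation at \<open>m\<close> makes the part beyond \<open>n\<close> iterations negligible.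
\<close>

lemma ewp_while:
  assumes "0 < A" "I (tick \<sigma>)"
    and body: "\<And>\<sigma>. I \<sigma> \<Longrightarrow> bval b \<sigma> \<Longrightarrow> ewp (exec L c \<sigma>) (\<lambda>\<tau>. post I J (tick \<tau>)) \<le> ennreal (J \<sigma>)"
    and clk: "\<And>\<sigma>. I \<sigma> \<Longrightarrow> A * real (clock \<sigma>) \<le> J \<sigma>"
    and exit: "\<And>\<sigma>. I \<sigma> \<Longrightarrow> \<not> bval b \<sigma> \<Longrightarrow> f \<sigma> \<le> ennreal (J \<sigma>)"
  shows "ewp (exec L (While b c) \<sigma>) f \<le> ennreal (J (tick \<sigma>))"
proof -
  define c' where "c' = (\<lambda>\<tau>. map_spmf tick (exec L c \<tau>))"
  define W where "W = while_spmf (bval b) c'"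
  define R where "R = rec_nat (\<lambda>_. 1::ennreal)
    (\<lambda>_ R \<sigma>. if bval b \<sigma> then (\<integral>\<^sup>+ r. (case r of None \<Rightarrow> 0 | Some \<tau> \<Rightarrow> R \<tau>) \<partial>measure_pmf (c' \<sigma>)) else 0)"
  have R0: "R 0 \<sigma> = 1" for \<sigma> by (simp add: R_def)
  have RS: "R (Suc n) \<sigma> = (if bval b \<sigma> then
      (\<integral>\<^sup>+ r. (case r of None \<Rightarrow> 0 | Some \<tau> \<Rightarrow> R n \<tau>) \<partial>measure_pmf (c' \<sigma>)) else 0)" for n \<sigma>
    unfolding R_def by simp
  have W: "W \<sigma> = (if bval b \<sigma> then bind_spmf (c' \<sigma>) W else return_spmf \<sigma>)" for \<sigma>
    unfolding W_def by (subst while_spmf.simps) simp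
  have body': "ewp (c' \<sigma>) (post I J) \<le> ennreal (J \<sigma>)" if "I \<sigma>" "bval b \<sigma>" for \<sigma>
    using body[OF that] by (simp add: c'_def ewp_map)
  have clk': "clock \<sigma> + 1 \<le> clock \<tau>" if "\<tau> \<in> set_spmf (c' \<sigma>)" for \<sigma> \<tau>
    using that clock_exec_mono[of _ L c \<sigma>] by (auto simp: c'_def tick_def)
  have J0: "0 \<le> J \<sigma>" if "I \<sigma>" for \<sigma>
    using clk[OF that] \<open>0 < A\<close> by (meson of_nat_0_le_iff mult_nonneg_nonneg less_imp_le order_trans)
  \<comment> \<open>The clock in the factor carries the induction: an iteration lowers
    \<open>n\<close> by one and raises the clock by at least one, so the factor does not
    shrink.\<close>
  have R: "ennreal (A * real (n + clock \<sigma>)) * R n \<sigma> \<le> ennreal (J \<sigma>)" if "I \<sigma>" for n \<sigma>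
    using that
  proof (induction n arbitrary: \<sigma>)
    case 0
    then show ?case using clk by (simp add: R0 ennreal_leI)
  next
    case (Suc n)
    show ?case
    proof (cases "bval b \<sigma>")
      case True
      have "ennreal (A * real (Suc n + clock \<sigma>)) * R (Suc n) \<sigma> =
        (\<integral>\<^sup>+ r. ennreal (A * real (Suc n + clock \<sigma>)) * (case r of None \<Rightarrow> 0 | Some \<tau> \<Rightarrow> R n \<tau>) \<partial>measure_pmf (c' \<sigma>))"
        using True by (simp add: RS nn_integral_cmult)
      also have "\<dots> \<le> ewp (c' \<sigma>) (post I J)"
        unfolding ewp_def
      proof (intro nn_integral_mono_AE, unfold AE_measure_pmf_iff, intro ballI)
        fix r assume r: "r \<in> set_pmf (c' \<sigma>)"
        show "ennreal (A * real (Suc n + clock \<sigma>)) * (case r of None \<Rightarrow> 0 | Some \<tau> \<Rightarrow> R n \<tau>)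
          \<le> (case r of None \<Rightarrow> \<infinity> | Some x \<Rightarrow> post I J x)"
        proof (cases r)
          case (Some \<tau>)
          have "clock \<sigma> + 1 \<le> clock \<tau>" using clk' r Some by (simp add: in_set_spmf)
          then have "ennreal (A * real (Suc n + clock \<sigma>)) * R n \<tau> \<le> ennreal (A * real (n + clock \<tau>)) * R n \<tau>"
            using \<open>0 < A\<close> by (intro mult_right_mono ennreal_leI mult_left_mono) auto
          also have "\<dots> \<le> ennreal (J \<tau>)" if "I \<tau>" using Suc.IH[OF that] .
          finally show ?thesis by (auto simp: Some post_def)
        qed auto
      qed
      also have "\<dots> \<le> ennreal (J \<sigma>)" using body' Suc.prems True by blast
      finally show ?thesis .
    qed (simp add: RS)
  qed
  define h where "h = (\<lambda>(m::nat) r. min (of_nat m) (case r of None \<Rightarrow> \<infinity> | Some x \<Rightarrow> f x))"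
  define X where "X = (\<lambda>m \<sigma>. \<integral>\<^sup>+ r. h m r \<partial>measure_pmf (W \<sigma>))"
  \<comment> \<open>Runs that leave the loop after fewer than \<open>n\<close> iterations are paid
    by \<open>J\<close>; all others contribute at most the truncation level
    \<open>m\<close>.\<close>
  have X: "X m \<sigma> \<le> ennreal (J \<sigma>) + of_nat m * R n \<sigma>" if "I \<sigma>" for m n \<sigma>
    using that
  proof (induction n arbitrary: \<sigma>)
    case 0
    have "X m \<sigma> \<le> (\<integral>\<^sup>+ r. of_nat m \<partial>measure_pmf (W \<sigma>))"
      unfolding X_def h_def by (intro nn_integral_mono) simp
    then show ?case by (simp add: R0 add_increasing)
  next
    case (Suc n)
    show ?case
    proof (cases "bval b \<sigma>")
      case True
      have "X m \<sigma> = (\<integral>\<^sup>+ r. (case r of None \<Rightarrow> of_nat m | Some \<tau> \<Rightarrow> X m \<tau>) \<partial>measure_pmf (c' \<sigma>))"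
        unfolding X_def using True
        by (subst W) (auto simp: bind_spmf_def h_def intro!: nn_integral_cong split: option.split)
      also have "\<dots> \<le> (\<integral>\<^sup>+ r. (case r of None \<Rightarrow> \<infinity> | Some x \<Rightarrow> post I J x)
          + of_nat m * (case r of None \<Rightarrow> 0 | Some \<tau> \<Rightarrow> R n \<tau>) \<partial>measure_pmf (c' \<sigma>))"
        using Suc.IH by (intro nn_integral_mono) (auto simp: post_def split: option.split)
      also have "\<dots> = ewp (c' \<sigma>) (post I J) + of_nat m * R (Suc n) \<sigma>"
        using True by (simp add: ewp_def RS nn_integral_add nn_integral_cmult)
      also have "\<dots> \<le> ennreal (J \<sigma>) + of_nat m * R (Suc n) \<sigma>"
        using body' Suc.prems True by (intro add_right_mono) blast
      finally show ?thesis .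
    next
      case False
      have "X m \<sigma> = h m (Some \<sigma>)" unfolding X_def using False by (subst W) simp
      also have "\<dots> \<le> ennreal (J \<sigma>)" using exit[OF Suc.prems False] by (simp add: h_def min.coboundedI2)
      finally show ?thesis by (simp add: add_increasing2)
    qed
  qed
  have Xlim: "X m \<sigma> \<le> ennreal (J \<sigma>)" if I: "I \<sigma>" for m \<sigma>
  proof -
    have Rn: "R (Suc n) \<sigma> \<le> ennreal (J \<sigma> / (A * real (Suc n)))" for n
    proof -
      have "ennreal (A * real (Suc n)) * R (Suc n) \<sigma> \<le> ennreal (A * real (Suc n + clock \<sigma>)) * R (Suc n) \<sigma>"
        using \<open>0 < A\<close> by (intro mult_right_mono ennreal_leI mult_left_mono) auto
      also have "\<dots> \<le> ennreal (J \<sigma>)" by (rule R[OF I])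
      finally have "ennreal (A * real (Suc n)) * R (Suc n) \<sigma> \<le> ennreal (J \<sigma>)" .
      then have le: "ennreal (1 / (A * real (Suc n))) * (ennreal (A * real (Suc n)) * R (Suc n) \<sigma>)
          \<le> ennreal (1 / (A * real (Suc n))) * ennreal (J \<sigma>)"
        by (intro mult_left_mono) auto
      have "ennreal (1 / (A * real (Suc n))) * (ennreal (A * real (Suc n)) * R (Suc n) \<sigma>) = R (Suc n) \<sigma>"
        using \<open>0 < A\<close> by (simp add: mult.assoc[symmetric] ennreal_mult[symmetric] del: of_nat_Suc)
      moreover have "ennreal (1 / (A * real (Suc n))) * ennreal (J \<sigma>) = ennreal (J \<sigma> / (A * real (Suc n)))"
        using \<open>0 < A\<close> J0[OF I] by (simp add: ennreal_mult[symmetric] del: of_nat_Suc)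
      ultimately show ?thesis using le by simp
    qed
    have "X m \<sigma> \<le> ennreal (J \<sigma> + real m * (J \<sigma> / (A * real (Suc n))))" for n
    proof -
      have "X m \<sigma> \<le> ennreal (J \<sigma>) + of_nat m * R (Suc n) \<sigma>" by (rule X[OF I])
      also have "\<dots> \<le> ennreal (J \<sigma>) + of_nat m * ennreal (J \<sigma> / (A * real (Suc n)))"
        by (intro add_left_mono mult_left_mono Rn) simp
      also have "\<dots> = ennreal (J \<sigma> + real m * (J \<sigma> / (A * real (Suc n))))"
        using J0[OF I] \<open>0 < A\<close>
        by (simp add: ennreal_plus ennreal_mult[symmetric] ennreal_of_nat_eq_real_of_nat del: of_nat_Suc)
      finally show ?thesis .
    qed
    moreover have "(\<lambda>n. ennreal (J \<sigma> + real m * (J \<sigma> / (A * real (Suc n))))) \<longlonglongrightarrow> ennreal (J \<sigma>)"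
    proof (rule tendsto_ennrealI)
      have "(\<lambda>n. J \<sigma> + real m * (J \<sigma> / A) * inverse (real (Suc n))) \<longlonglongrightarrow> J \<sigma> + real m * (J \<sigma> / A) * 0"
        by (intro tendsto_intros LIMSEQ_inverse_real_of_nat)
      then show "(\<lambda>n. J \<sigma> + real m * (J \<sigma> / (A * real (Suc n)))) \<longlonglongrightarrow> J \<sigma>"
        by (simp add: divide_simps)
    qed
    ultimately show ?thesis by (intro LIMSEQ_le_const) auto
  qed
  \<comment> \<open>As the truncation level grows, monotone convergence recovers \<open>f\<close>,
    and also the value \<open>\<infinity>\<close> of divergence.\<close>
  have "ewp (W (tick \<sigma>)) f = (\<integral>\<^sup>+ r. (SUP m. h m r) \<partial>measure_pmf (W (tick \<sigma>)))"
    unfolding ewp_def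
  proof (intro nn_integral_cong)
    fix r
    show "(case r of None \<Rightarrow> \<infinity> | Some x \<Rightarrow> f x) = (SUP m. h m r)"
    proof -
      have "(SUP m::nat. min (of_nat m) y) = y" for y :: ennreal
      proof -
        have "(SUP m::nat. inf y (of_nat m)) = inf y (SUP m::nat. of_nat m)"
          by (rule inf_SUP[symmetric])
        then show ?thesis by (simp add: ennreal_SUP_of_nat_eq_top inf_min min.commute)
      qed
      then show ?thesis by (simp add: h_def)
    qed
  qed
  also have "\<dots> = (SUP m. X m (tick \<sigma>))"
    unfolding X_def
    by (rule nn_integral_monotone_convergence_SUP)
      (auto simp: incseq_def le_fun_def h_def intro: min.coboundedI1 of_nat_mono)
  also have "\<dots> \<le> ennreal (J (tick \<sigma>))"
    using Xlim assms(2) by (intro SUP_least) auto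
  finally show ?thesis by (simp add: W_def c'_def)
qed

section \<open>Expected visits and personalized PageRank\<close>

locale ppr_graph =
  fixes G :: "nat pair_pre_digraph" and \<alpha> :: real
  assumes fin_digraph: "pair_fin_digraph G" and alpha_pos: "0 < \<alpha>" and alpha_less: "\<alpha> < 1"
begin

abbreviation V :: "nat set" where "V \<equiv> pverts G"

text \<open>The factor \<open>1 - \<alpha>\<close> makes this the kernel of the surviving walk: a
  row sums to at most \<open>1 - \<alpha>\<close>, and to 0 at a node without out-neighbours, where
  \<open>stop_prob\<close> is 1.\<close>

definition step_prob :: "nat \<Rightarrow> nat \<Rightarrow> real" where
  "step_prob u v = (if v \<in> out_nbs G u then (1 - \<alpha>) / card (out_nbs G u) else 0)"

definition stop_prob :: "nat \<Rightarrow> real" where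
  "stop_prob u = (if out_nbs G u = {} then 1 else \<alpha>)"

text \<open>The probability that the walk from \<open>u\<close> makes at least \<open>k\<close>
  moves and stands at \<open>v\<close> after \<open>k\<close> of them; \<open>visits\<close> is then
  the Green function of the killed walk.\<close>

primrec alive :: "nat \<Rightarrow> nat \<Rightarrow> nat \<Rightarrow> real" where
  "alive 0 u v = of_bool (u = v)"
| "alive (Suc k) u v = (\<Sum>w\<in>V. alive k u w * step_prob w v)"

definition visits :: "nat \<Rightarrow> nat \<Rightarrow> real" where
  "visits u v = (\<Sum>k. alive k u v)"

section \<open>The transition kernel and its powers\<close>

lemma finite_V [simp]: "finite V"
  using fin_digraph by (simp add: pair_fin_digraph_def pair_fin_digraph_axioms_def)

lemma arc_in_V:
  assumes "(u, v) \<in> parcs G" shows "u \<in> V" "v \<in> V"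
proof -
  interpret pair_fin_digraph G by (rule fin_digraph)
  show "u \<in> V" "v \<in> V" using in_arcsD1 in_arcsD2 assms by auto
qed

lemma out_nbs_subset: "out_nbs G u \<subseteq> V"
  using arc_in_V by (auto simp: out_nbs_def)

lemma in_nbs_subset: "in_nbs G u \<subseteq> V"
  using arc_in_V by (auto simp: in_nbs_def)

lemma finite_out_nbs [simp]: "finite (out_nbs G u)"
  using out_nbs_subset finite_V by (rule finite_subset)

lemma finite_in_nbs [simp]: "finite (in_nbs G u)"
  using in_nbs_subset finite_V by (rule finite_subset)

lemma in_nbs_iff: "u \<in> in_nbs G v \<longleftrightarrow> v \<in> out_nbs G u"
  by (auto simp: in_nbs_def out_nbs_def)

lemma card_in_nbs_le: "card (in_nbs G v) \<le> card V"
  by (intro card_mono in_nbs_subset) simp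

lemma card_out_nbs_pos: "v \<in> out_nbs G u \<Longrightarrow> 0 < card (out_nbs G u)"
  by (auto simp: card_gt_0_iff)

lemma step_prob_nonneg: "0 \<le> step_prob u v"
  using alpha_less by (simp add: step_prob_def)

lemma sum_step_prob:
  "(\<Sum>v\<in>V. step_prob u v * f v) = (1 - \<alpha>) / card (out_nbs G u) * (\<Sum>v\<in>out_nbs G u. f v)"
proof -
  have "(\<Sum>v\<in>V. step_prob u v * f v) = (\<Sum>v\<in>out_nbs G u. step_prob u v * f v)"
    using out_nbs_subset by (intro sum.mono_neutral_right) (auto simp: step_prob_def)
  then show ?thesis by (simp add: sum_distrib_left step_prob_def)
qed

lemma sum_step_prob_le: "(\<Sum>v\<in>V. step_prob u v) \<le> 1 - \<alpha>"
  using sum_step_prob[of u "\<lambda>_. 1"] alpha_less by (cases "out_nbs G u = {}") auto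

lemma stop_prob_bounds: "0 < stop_prob u" "stop_prob u \<le> 1" "\<alpha> \<le> stop_prob u"
  using alpha_pos alpha_less by (auto simp: stop_prob_def)

lemma alive_nonneg: "0 \<le> alive k u v"
  by (induction k arbitrary: v) (auto intro!: sum_nonneg simp: step_prob_nonneg)

lemma alive_Suc_left:
  "u \<in> V \<Longrightarrow> v \<in> V \<Longrightarrow> alive (Suc k) u v = (\<Sum>w\<in>V. step_prob u w * alive k w v)"
proof (induction k arbitrary: v)
  case 0
  then show ?case by (simp add: if_distrib if_distribR of_bool_def sum.delta sum.delta' cong: if_cong)
next
  case (Suc k)
  have "alive (Suc (Suc k)) u v = (\<Sum>w\<in>V. \<Sum>x\<in>V. step_prob u x * alive k x w * step_prob w v)"
    using Suc by (simp only: alive.simps(2)[of "Suc k"]) (simp add: sum_distrib_right)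
  also have "\<dots> = (\<Sum>x\<in>V. step_prob u x * alive (Suc k) x v)"
    by (subst sum.swap) (simp add: sum_distrib_left mult.assoc)
  finally show ?case .
qed

lemma sum_alive_le: "u \<in> V \<Longrightarrow> (\<Sum>v\<in>V. alive k u v) \<le> (1 - \<alpha>) ^ k"
proof (induction k)
  case 0
  then show ?case by (simp add: of_bool_def)
next
  case (Suc k)
  have "(\<Sum>v\<in>V. alive (Suc k) u v) = (\<Sum>w\<in>V. alive k u w * (\<Sum>v\<in>V. step_prob w v))"
    by (simp add: sum_distrib_left) (rule sum.swap)
  also have "\<dots> \<le> (\<Sum>w\<in>V. alive k u w * (1 - \<alpha>))"
    by (intro sum_mono mult_left_mono sum_step_prob_le alive_nonneg)
  also have "\<dots> \<le> (1 - \<alpha>) ^ Suc k"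
    using Suc alpha_less by (simp add: sum_distrib_left[symmetric] mult.commute mult_left_mono)
  finally show ?case .
qed

lemma alive_le: "u \<in> V \<Longrightarrow> v \<in> V \<Longrightarrow> alive k u v \<le> (1 - \<alpha>) ^ k"
  using sum_alive_le[of u k] member_le_sum[of v V "alive k u"] alive_nonneg by force

lemma summable_power_alpha: "summable (\<lambda>k. (1 - \<alpha>) ^ k)"
  using alpha_pos alpha_less by (intro summable_geometric) auto

lemma summable_alive: "u \<in> V \<Longrightarrow> v \<in> V \<Longrightarrow> summable (\<lambda>k. alive k u v)"
  by (rule summable_comparison_test'[OF summable_power_alpha, of 0])
    (auto simp: alive_nonneg alive_le)

section \<open>The Green function and its recursions\<close>

lemma visits_nonneg: "u \<in> V \<Longrightarrow> v \<in> V \<Longrightarrow> 0 \<le> visits u v"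
  unfolding visits_def by (intro suminf_nonneg summable_alive alive_nonneg)

lemma visits_split: "u \<in> V \<Longrightarrow> v \<in> V \<Longrightarrow> visits u v = of_bool (u = v) + (\<Sum>k. alive (Suc k) u v)"
  unfolding visits_def using suminf_split_head[OF summable_alive, of u v] by simp

lemma visits_last_step:
  assumes "u \<in> V" "v \<in> V"
  shows "visits u v = of_bool (u = v) + (\<Sum>w\<in>V. visits u w * step_prob w v)"
proof -
  have "(\<Sum>k. alive (Suc k) u v) = (\<Sum>w\<in>V. \<Sum>k. alive k u w * step_prob w v)"
    using assms by (simp add: suminf_sum summable_mult2 summable_alive)
  also have "\<dots> = (\<Sum>w\<in>V. visits u w * step_prob w v)"
    using assms by (simp add: visits_def suminf_mult2 summable_alive)
  finally show ?thesis by (simp only: visits_split[OF assms])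
qed

lemma visits_first_step:
  assumes "u \<in> V" "v \<in> V"
  shows "visits u v = of_bool (u = v) + (\<Sum>w\<in>V. step_prob u w * visits w v)"
proof -
  have "(\<Sum>k. alive (Suc k) u v) = (\<Sum>w\<in>V. \<Sum>k. step_prob u w * alive k w v)"
    using assms by (simp add: alive_Suc_left suminf_sum summable_mult summable_alive del: alive.simps)
  also have "\<dots> = (\<Sum>w\<in>V. step_prob u w * visits w v)"
    using assms by (simp add: visits_def suminf_mult summable_alive)
  finally show ?thesis by (simp only: visits_split[OF assms])
qed

lemma visits_diag_ge: "v \<in> V \<Longrightarrow> 1 \<le> visits v v"
  using visits_last_step[of v v] by (simp add: sum_nonneg visits_nonneg step_prob_nonneg)

section \<open>Endpoint probabilities and their relation to expected visits\<close>

lemma ppr_nonneg: "0 \<le> ppr \<alpha> G u v"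
  by (simp add: ppr_def)

lemma ppr_le_1: "ppr \<alpha> G u v \<le> 1"
  by (simp add: ppr_def pmf_le_1)

lemma sum_ppr_le_1: "(\<Sum>v\<in>V. ppr \<alpha> G u v) \<le> 1"
proof -
  have "(\<Sum>v\<in>V. ppr \<alpha> G u v) = measure (measure_pmf (disc_walk \<alpha> G u)) (Some ` V)"
    by (subst measure_measure_pmf_finite) (auto simp: ppr_def sum.reindex)
  then show ?thesis by simp
qed

lemma ppr_first_step:
  "ppr \<alpha> G u v = stop_prob u * of_bool (u = v) + (\<Sum>w\<in>V. step_prob u w * ppr \<alpha> G w v)"
proof (cases "out_nbs G u = {}")
  case True
  then show ?thesis
    unfolding ppr_def
    by (subst disc_walk.simps) (simp add: stop_prob_def step_prob_def bind_spmf_const weight_spmf_of_pmf)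
next
  case False
  have "spmf (disc_walk \<alpha> G u) v = \<alpha> * of_bool (u = v) +
      (1 - \<alpha>) * spmf (bind_spmf (spmf_of_set (out_nbs G u)) (disc_walk \<alpha> G)) v"
    using False alpha_pos alpha_less
    by (subst disc_walk.simps) (simp add: pmf_bind indicator_def of_bool_def)
  also have "spmf (bind_spmf (spmf_of_set (out_nbs G u)) (disc_walk \<alpha> G)) v =
      (\<Sum>w\<in>out_nbs G u. ppr \<alpha> G w v) / card (out_nbs G u)"
    by (simp add: spmf_bind integral_spmf_of_set ppr_def)
  finally show ?thesis using False by (simp add: sum_step_prob ppr_def stop_prob_def)
qed

text \<open>As functions of the start, both sides satisfy the same first-step recursion. Their
  difference is fixed by a kernel with row sums at most \<open>1 - \<alpha>\<close>, so the maximum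
  of its absolute value vanishes.\<close>

lemma ppr_eq_visits:
  assumes "u \<in> V" "v \<in> V"
  shows "ppr \<alpha> G u v = stop_prob v * visits u v"
proof -
  define D where "D w = ppr \<alpha> G w v - stop_prob v * visits w v" for w
  have D: "D w = (\<Sum>x\<in>V. step_prob w x * D x)" if "w \<in> V" for w
    unfolding D_def ppr_first_step[of w v] using visits_first_step[of w v] that assms
    by (auto simp: algebra_simps sum_subtractf sum_distrib_left)
  define m where "m = Max ((\<lambda>w. \<bar>D w\<bar>) ` V)"
  have m: "\<bar>D w\<bar> \<le> m" if "w \<in> V" for w unfolding m_def using that by (intro Max_ge) auto
  have "m \<in> (\<lambda>w. \<bar>D w\<bar>) ` V" unfolding m_def using assms by (intro Max_in) auto
  then obtain w where w: "w \<in> V" "m = \<bar>D w\<bar>" by auto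
  have "m \<le> (\<Sum>x\<in>V. \<bar>step_prob w x * D x\<bar>)" using D[OF w(1)] w(2) by (metis sum_abs)
  also have "\<dots> \<le> (\<Sum>x\<in>V. step_prob w x * m)"
    by (intro sum_mono) (auto simp: abs_mult step_prob_nonneg intro!: mult_left_mono m)
  also have "\<dots> \<le> (1 - \<alpha>) * m"
    unfolding sum_distrib_right[symmetric] using w
    by (intro mult_right_mono sum_step_prob_le) auto
  finally have "\<alpha> * m \<le> 0" by (simp add: algebra_simps)
  then have "m \<le> 0" using alpha_pos by (simp add: mult_le_0_iff)
  with m[OF assms(1)] show ?thesis by (simp add: D_def)
qed

lemma visits_le: "u \<in> V \<Longrightarrow> v \<in> V \<Longrightarrow> visits u v \<le> ppr \<alpha> G u v / \<alpha>"
  using ppr_eq_visits[of u v] stop_prob_bounds(3)[of v] visits_nonneg[of u v] alpha_pos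
  by (simp add: pos_le_divide_eq mult.commute mult_right_mono)

text \<open>
  The left-hand side counts each path from \<open>s\<close> to \<open>t\<close> once per vertex, hence is at most the
  length bound times \<open>ppr s t\<close> once the paths longer than \<open>l\<close> have been cut off.
\<close>

lemma sum_visits_ppr_le:
  assumes "s \<in> V" "t \<in> V" "(1 - \<alpha>) ^ l \<le> \<delta>"
  shows "(\<Sum>w\<in>V. visits s w * ppr \<alpha> G w t) \<le> real l * ppr \<alpha> G s t + \<delta> / \<alpha>"
proof -
  \<comment> \<open>\<open>F k\<close> is the probability that the walk survives \<open>k\<close>
    moves and ends at \<open>t\<close>. The bound \<open>ppr \<alpha> G s t\<close> serves for the
    first \<open>l\<close> terms, the bound \<open>(1 - \<alpha>) ^ k\<close> for the tail.\<close>
  define F where "F k = (\<Sum>w\<in>V. alive k s w * ppr \<alpha> G w t)" for k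
  have F0: "F 0 = ppr \<alpha> G s t"
    using assms by (simp add: F_def of_bool_def if_distribR if_distrib[of "\<lambda>x. x * _"] cong: if_cong)
  have F_Suc: "F (Suc k) \<le> F k" for k
  proof -
    have "F (Suc k) = (\<Sum>x\<in>V. alive k s x * (\<Sum>w\<in>V. step_prob x w * ppr \<alpha> G w t))"
      unfolding F_def by (simp add: sum_distrib_left sum_distrib_right mult.assoc) (rule sum.swap)
    also have "\<dots> \<le> F k"
      unfolding F_def
      by (intro sum_mono mult_left_mono alive_nonneg) (subst (2) ppr_first_step, simp add: stop_prob_bounds less_imp_le)
    finally show ?thesis .
  qed
  have F_le: "F k \<le> ppr \<alpha> G s t" for k
    by (induction k) (auto simp: F0 intro: order_trans[OF F_Suc])
  have F_geo: "F k \<le> (1 - \<alpha>) ^ k" for k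
  proof -
    have "F k \<le> (\<Sum>w\<in>V. alive k s w)"
      unfolding F_def by (intro sum_mono mult_left_le ppr_le_1 alive_nonneg)
    then show ?thesis using sum_alive_le[OF assms(1), of k] by simp
  qed
  have F_nonneg: "0 \<le> F k" for k
    unfolding F_def by (intro sum_nonneg mult_nonneg_nonneg alive_nonneg ppr_nonneg)
  have sF: "summable F"
    by (rule summable_comparison_test'[OF summable_power_alpha, of 0]) (auto simp: F_nonneg F_geo)
  have "(\<Sum>w\<in>V. visits s w * ppr \<alpha> G w t) = (\<Sum>w\<in>V. \<Sum>k. alive k s w * ppr \<alpha> G w t)"
    using assms by (simp add: visits_def suminf_mult2 summable_alive)
  also have "\<dots> = suminf F"
    unfolding F_def using assms by (subst suminf_sum) (auto intro: summable_mult2 summable_alive)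
  also have "\<dots> = (\<Sum>k<l. F k) + (\<Sum>k. F (k + l))"
    using suminf_split_initial_segment[OF sF, of l] by simp
  also have "(\<Sum>k<l. F k) \<le> real l * ppr \<alpha> G s t"
    using sum_bounded_above[of "{..<l}" F "ppr \<alpha> G s t"] F_le by simp
  also have "(\<Sum>k. F (k + l)) \<le> (\<Sum>k. (1 - \<alpha>) ^ (k + l))"
    using F_geo by (intro suminf_le summable_ignore_initial_segment sF summable_power_alpha) auto
  also have "\<dots> = (1 - \<alpha>) ^ l / \<alpha>"
    using alpha_pos alpha_less
    by (simp add: power_add suminf_mult2[symmetric] summable_power_alpha suminf_geometric)
  also have "\<dots> \<le> \<delta> / \<alpha>" using assms alpha_pos by (simp add: divide_right_mono)
  finally show ?thesis by simp
qed

end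

section \<open>Random walks on the machine\<close>

lemma ewp_Skip: "ewp (exec L Skip \<sigma>) f = f (tick \<sigma>)"
  and ewp_NSet: "ewp (exec L (NSet a i e) \<sigma>) f = f (tick (nstore a (nval i \<sigma>) (nval e \<sigma>) \<sigma>))"
  and ewp_RSet: "ewp (exec L (RSet a i r) \<sigma>) f = f (tick (rstore a (nval i \<sigma>) (rval r \<sigma>) \<sigma>))"
  and ewp_Ask: "ewp (exec L (Ask a i q) \<sigma>) f = f (tick (nstore a (nval i \<sigma>) (answer L q \<sigma>) \<sigma>))"
  and ewp_Seq: "ewp (exec L (Seq c d) \<sigma>) f = ewp (exec L c \<sigma>) (\<lambda>\<tau>. ewp (exec L d \<tau>) f)"
  and ewp_Cond: "ewp (exec L (Cond b c d) \<sigma>) f =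
    (if bval b \<sigma> then ewp (exec L c (tick \<sigma>)) f else ewp (exec L d (tick \<sigma>)) f)"
  by (simp_all add: ewp_bind)

declare exec.simps [simp del]

lemmas ewp_simps = ewp_Skip ewp_NSet ewp_RSet ewp_Ask ewp_Seq ewp_Cond

lemmas state_simps = tick_def nstore_def rstore_def

text \<open>The real bound \<open>h\<close> per outcome and the multiplied-out sum condition keep
  later goals free of \<open>ennreal\<close> arithmetic and of division.\<close>

lemma ewp_RandNat:
  assumes "0 < nval k \<sigma>"
    and "\<And>x. x < nval k \<sigma> \<Longrightarrow> f (tick (nstore a (nval i \<sigma>) x \<sigma>)) \<le> ennreal (h x)"
    and "\<And>x. x < nval k \<sigma> \<Longrightarrow> 0 \<le> h x"
    and "(\<Sum>x<nval k \<sigma>. h x) \<le> real (nval k \<sigma>) * r"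
  shows "ewp (exec L (RandNat a i k) \<sigma>) f \<le> ennreal r"
proof -
  have "(\<Sum>x<nval k \<sigma>. f (tick (nstore a (nval i \<sigma>) x \<sigma>))) \<le> ennreal (\<Sum>x<nval k \<sigma>. h x)"
    using assms(2,3) by (subst sum_ennreal[symmetric]) (auto intro!: sum_mono)
  then have "ewp (exec L (RandNat a i k) \<sigma>) f \<le> ennreal (\<Sum>x<nval k \<sigma>. h x) / of_nat (nval k \<sigma>)"
    using assms(1) by (simp add: exec.simps ewp_map ewp_uniform divide_right_mono_ennreal)
  also have "\<dots> = ennreal ((\<Sum>x<nval k \<sigma>. h x) / real (nval k \<sigma>))"
    unfolding ennreal_of_nat_eq_real_of_nat
    using assms(1,3) by (intro divide_ennreal sum_nonneg) auto
  also have "\<dots> \<le> ennreal r"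
    using assms(1,4) by (intro ennreal_leI) (simp add: pos_divide_le_eq mult.commute)
  finally show ?thesis .
qed

lemma ewp_Coin:
  assumes "0 \<le> rval p \<sigma>" "rval p \<sigma> \<le> 1"
    and "f (tick (nstore a (nval i \<sigma>) 1 \<sigma>)) \<le> ennreal x"
    and "f (tick (nstore a (nval i \<sigma>) 0 \<sigma>)) \<le> ennreal y"
    and "0 \<le> x" "0 \<le> y" "rval p \<sigma> * x + (1 - rval p \<sigma>) * y \<le> r"
  shows "ewp (exec L (Coin a i p) \<sigma>) f \<le> ennreal r"
proof -
  have "ewp (exec L (Coin a i p) \<sigma>) f \<le> ennreal (rval p \<sigma>) * ennreal x + ennreal (1 - rval p \<sigma>) * ennreal y"
    using assms by (simp only: exec.simps ewp_map ewp_bernoulli) (auto intro!: add_mono mult_left_mono)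
  also have "\<dots> = ennreal (rval p \<sigma> * x + (1 - rval p \<sigma>) * y)"
    using assms by (simp add: ennreal_mult ennreal_plus)
  also have "\<dots> \<le> ennreal r" using assms by (intro ennreal_leI)
  finally show ?thesis .
qed

lemma sum_nth_distinct:
  "distinct xs \<Longrightarrow> (\<Sum>i<length xs. h (xs ! i)) = (\<Sum>x\<in>set xs. h x)"
  by (rule sum.reindex_bij_betw[OF bij_betw_nth]) auto

text \<open>
  Register allocation in array 0 of the natural memory: 0 source, 1 target, 2 scale \<open>K\<close>, 3 path length bound,
  4 loop counter, 5 position of the walk, 6 walk running, 7 coin or answer of \<open>Adj\<close>, 8 degree,
  9 random index, 10 number of heavy nodes, 11 stack height, 12 node being pushed, 13 prefix length,
  14 pivot, 15 number of draws, 16 draw counter, 17 in-neighbour. Arrays 1, 2, 3 hold the list of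
  heavy nodes, their marks, and the stack.
  In the real memory, cell 0 of array 0 becomes the accumulator, cells 4, 5, 6 are scratch,
  and array 1 holds the residues.
\<close>

abbreviation nreg :: "nat \<Rightarrow> nexp" where "nreg k \<equiv> NCell 0 (NLit k)"
abbreviation rreg :: "nat \<Rightarrow> rexp" where "rreg k \<equiv> RCell 0 (NLit k)"
abbreviation set_nreg :: "nat \<Rightarrow> nexp \<Rightarrow> com" where "set_nreg k \<equiv> NSet 0 (NLit k)"
abbreviation set_rreg :: "nat \<Rightarrow> rexp \<Rightarrow> com" where "set_rreg k \<equiv> RSet 0 (NLit k)"
abbreviation incr :: "nat \<Rightarrow> com" where "incr k \<equiv> set_nreg k (NSuc (nreg k))"
abbreviation ask :: "nat \<Rightarrow> query \<Rightarrow> com" where "ask k \<equiv> Ask 0 (NLit k)"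

notation Seq (infixr ";;" 60)

section \<open>The walk as a program and its mean cost\<close>

definition walk_step :: com where
  "walk_step =
    Coin 0 (NLit 7) (rreg 1) ;;
    ask 8 (DegOut (nreg 5)) ;;
    Cond (BAnd (NLess (nreg 7) (NLit 1)) (NLess (NLit 0) (nreg 8)))
      (RandNat 0 (NLit 9) (nreg 8) ;; ask 5 (OutNb (nreg 5) (nreg 9)))
      (set_nreg 6 (NLit 0))"

definition walk :: com where
  "walk = set_nreg 5 (nreg 0) ;; set_nreg 6 (NLit 1) ;; While (NLess (NLit 0) (nreg 6)) walk_step"

definition agree_but :: "nat set \<Rightarrow> state \<Rightarrow> state \<Rightarrow> bool" where
  "agree_but X \<sigma> \<tau> \<longleftrightarrow> rmem \<tau> = rmem \<sigma> \<and> (\<forall>a. a \<noteq> 0 \<longrightarrow> nmem \<tau> a = nmem \<sigma> a)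
    \<and> (\<forall>k. k \<notin> X \<longrightarrow> nmem \<tau> 0 k = nmem \<sigma> 0 k)"

locale ppr_algo = ppr_graph +
  fixes L :: adj_lists and A :: real
  assumes represents: "represents L G" and A_pos: "0 < A"
begin

lemma out_list: "distinct (out_list L u)" "set (out_list L u) = out_nbs G u"
  "length (out_list L u) = card (out_nbs G u)"
  using represents distinct_card[of "out_list L u"] by (auto simp: represents_def)

lemma in_sorted_list: "distinct (in_sorted_list L u)" "set (in_sorted_list L u) = in_nbs G u"
  "length (in_sorted_list L u) = card (in_nbs G u)" "length (in_list L u) = card (in_nbs G u)"
  using represents distinct_card[of "in_sorted_list L u"] distinct_card[of "in_list L u"]
  by (auto simp: represents_def)

text \<open>A running walk carries a credit of \<open>A * (6 / \<alpha>)\<close> and the mean of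
  \<open>F\<close> at its endpoint. A continuing round takes 6 ticks, loop guard included, a
  stopping one 5. As the walk continues with probability at most \<open>1 - \<alpha>\<close>, the
  old credit pays for the ticks and for the credit that is kept.\<close>

lemma ewp_walk_step:
  assumes \<sigma>: "agree_but {5,6,7,8,9} \<sigma>0 \<sigma>" "nmem \<sigma> 0 5 \<in> V" "0 < nmem \<sigma> 0 6" "rmem \<sigma> 0 1 = \<alpha>"
    and F: "\<And>u. u \<in> V \<Longrightarrow> 0 \<le> F u"
    and I_def: "I = (\<lambda>\<tau>. agree_but {5,6,7,8,9} \<sigma>0 \<tau> \<and> nmem \<tau> 0 5 \<in> V)"
    and J_def: "J = (\<lambda>\<tau>::state. A * real (clock \<tau>) + (if 0 < nmem \<tau> 0 6
      then A * (6 / \<alpha>) + (\<Sum>u\<in>V. ppr \<alpha> G (nmem \<tau> 0 5) u * F u) else F (nmem \<tau> 0 5)))"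
  shows "ewp (exec L walk_step \<sigma>) (\<lambda>\<tau>. post I J (tick \<tau>)) \<le> ennreal (J \<sigma>)"
proof -
  define w where "w = nmem \<sigma> 0 5"
  have wV: "w \<in> V" using \<sigma> by (simp add: w_def)
  define T where "T = A * real (clock \<sigma>)"
  have T: "0 \<le> T" using A_pos by (simp add: T_def)
  define S where "S x = (\<Sum>u\<in>V. ppr \<alpha> G x u * F u)" for x
  have S_nonneg: "0 \<le> S x" for x
    unfolding S_def by (intro sum_nonneg mult_nonneg_nonneg ppr_nonneg F)
  have S: "S w = stop_prob w * F w + (1 - \<alpha>) / card (out_nbs G w) * (\<Sum>x\<in>out_nbs G w. S x)"
  proof -
    have "S w = (\<Sum>u\<in>V. stop_prob w * of_bool (w = u) * F u) + (\<Sum>u\<in>V. (\<Sum>x\<in>V. step_prob w x * ppr \<alpha> G x u) * F u)"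
      unfolding S_def by (subst ppr_first_step) (simp add: distrib_right sum.distrib)
    also have "(\<Sum>u\<in>V. stop_prob w * of_bool (w = u) * F u) = stop_prob w * F w"
      using wV by (simp add: of_bool_def if_distrib if_distribR cong: if_cong)
    also have "(\<Sum>u\<in>V. (\<Sum>x\<in>V. step_prob w x * ppr \<alpha> G x u) * F u) = (\<Sum>x\<in>V. step_prob w x * S x)"
      by (simp add: S_def sum_distrib_left sum_distrib_right mult.assoc) (rule sum.swap)
    finally show ?thesis by (simp add: sum_step_prob)
  qed
  have clk: "A * real (clock \<sigma> + k) = T + A * real k" for k by (simp add: T_def algebra_simps)
  have stop: "A * 5 + T + F w \<ge> 0" using T A_pos F[OF wV] by simp
  show ?thesis
  proof (cases "out_nbs G w = {}")
    \<comment> \<open>At a node without out-neighbours both outcomes of the coin end the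
      walk.\<close>
    case True
    have "A * 5 \<le> A * (6 / \<alpha>)"
      using A_pos alpha_pos alpha_less by (intro mult_left_mono) (auto simp: field_simps)
    then show ?thesis
      unfolding walk_step_def ewp_Seq
      apply (rule_tac x = "A * 5 + T + F w" and y = "A * 5 + T + F w" in ewp_Coin)
      using \<sigma> wV True stop alpha_pos alpha_less S
      by (auto simp: ewp_simps state_simps out_list post_def I_def J_def agree_but_def T_def S_def stop_prob_def
          algebra_simps simp flip: w_def intro!: ennreal_leI)
  next
    case False
    define m where "m = (\<Sum>x\<in>out_nbs G w. S x) / card (out_nbs G w)"
    have card: "0 < card (out_nbs G w)" using False by (simp add: card_gt_0_iff)
    have nth: "out_list L w ! x \<in> V" if "x < card (out_nbs G w)" for x
      using that out_list[of w] out_nbs_subset[of w] nth_mem[of x "out_list L w"] by auto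
    have sum: "(\<Sum>x<card (out_nbs G w). S (out_list L w ! x)) = card (out_nbs G w) * m"
      using sum_nth_distinct[OF out_list(1), of S w] card by (simp add: out_list m_def)
    have m: "0 \<le> m" unfolding m_def by (intro divide_nonneg_nonneg sum_nonneg S_nonneg) auto
    show ?thesis
      unfolding walk_step_def ewp_Seq
    proof (rule ewp_Coin[where x = "A * 5 + T + F w" and y = "A * 6 + T + A * (6 / \<alpha>) + m"], goal_cases)
      case 4
      show ?case
        apply (simp add: ewp_simps state_simps out_list card False flip: w_def)
        apply (rule ewp_RandNat[where h = "\<lambda>x. A * 6 + T + A * (6 / \<alpha>) + S (out_list L w ! x)"])
        subgoal using card by simp
        subgoal for x
          using \<sigma> nth[of x]
          by (auto simp: ewp_simps state_simps post_def I_def J_def agree_but_def T_def S_def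
              distrib_left simp del: ennreal_plus simp flip: w_def intro!: ennreal_leI)
        subgoal using T S_nonneg A_pos alpha_pos by simp
        subgoal by (simp add: sum.distrib sum distrib_left)
        done
    next
      case 7
      \<comment> \<open>The credit \<open>6 / \<alpha>\<close> is the solution of
        \<open>6 + (1 - \<alpha>) * y = y\<close>.\<close>
      define c where "c = A * (6 / \<alpha>)"
      have c: "\<alpha> * c = 6 * A" using alpha_pos by (simp add: c_def)
      have "0 \<le> \<alpha> * A" using alpha_pos A_pos by simp
      have "J \<sigma> = T + c + S w" unfolding c_def using \<sigma> by (simp add: J_def T_def S_def w_def)
      also have "S w = \<alpha> * F w + (1 - \<alpha>) * m" using False by (simp add: S stop_prob_def m_def)
      finally have J: "J \<sigma> = T + c + (\<alpha> * F w + (1 - \<alpha>) * m)" .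
      have "\<alpha> * (A * 5 + T + F w) + (1 - \<alpha>) * (A * 6 + T + c + m) \<le> J \<sigma>"
        unfolding J using c \<open>0 \<le> \<alpha> * A\<close> by (simp add: algebra_simps)
      then show ?case using \<sigma> by (simp add: c_def)
    qed (use \<sigma> wV False stop alpha_pos alpha_less A_pos T m in
      \<open>auto simp: ewp_simps state_simps out_list post_def I_def J_def agree_but_def T_def
          algebra_simps simp flip: w_def intro!: ennreal_leI\<close>)
  qed
qed

text \<open>The 3 extra ticks are two assignments and the first guard. As \<open>F\<close> is
  arbitrary, the rule serves for mean costs as well as for second moments of functions of the
  endpoint.\<close>

lemma ewp_walk:
  assumes \<sigma>: "nmem \<sigma> 0 0 = s" "s \<in> V" "rmem \<sigma> 0 1 = \<alpha>"
    and F: "\<And>u. u \<in> V \<Longrightarrow> 0 \<le> F u"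
    and f: "\<And>\<tau>. agree_but {5,6,7,8,9} \<sigma> \<tau> \<Longrightarrow> nmem \<tau> 0 5 \<in> V \<Longrightarrow>
      f \<tau> \<le> ennreal (A * real (clock \<tau>) + F (nmem \<tau> 0 5))"
  shows "ewp (exec L walk \<sigma>) f \<le>
    ennreal (A * (real (clock \<sigma>) + 3 + 6 / \<alpha>) + (\<Sum>u\<in>V. ppr \<alpha> G s u * F u))"
proof -
  define I where "I = (\<lambda>\<tau>::state. agree_but {5,6,7,8,9} \<sigma> \<tau> \<and> nmem \<tau> 0 5 \<in> V)"
  define J where "J = (\<lambda>\<tau>::state. A * real (clock \<tau>) + (if 0 < nmem \<tau> 0 6
      then A * (6 / \<alpha>) + (\<Sum>u\<in>V. ppr \<alpha> G (nmem \<tau> 0 5) u * F u) else F (nmem \<tau> 0 5)))"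
  define \<sigma>1 where "\<sigma>1 = tick (nstore 0 6 1 (tick (nstore 0 5 s \<sigma>)))"
  have "ewp (exec L (While (NLess (NLit 0) (nreg 6)) walk_step) \<sigma>1) f \<le> ennreal (J (tick \<sigma>1))"
  proof (rule ewp_while[where I = I, OF A_pos])
    show "I (tick \<sigma>1)" using \<sigma> by (auto simp: I_def \<sigma>1_def agree_but_def state_simps)
  next
    fix \<tau> assume "I \<tau>" "bval (NLess (NLit 0) (nreg 6)) \<tau>"
    then show "ewp (exec L walk_step \<tau>) (\<lambda>\<tau>. post I J (tick \<tau>)) \<le> ennreal (J \<tau>)"
      using \<sigma> by (intro ewp_walk_step[OF _ _ _ _ F I_def J_def]) (auto simp: I_def agree_but_def)
  next
    fix \<tau> assume "I \<tau>"
    then show "A * real (clock \<tau>) \<le> J \<tau>"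
      using A_pos alpha_pos F by (auto simp: I_def J_def intro!: add_nonneg_nonneg sum_nonneg mult_nonneg_nonneg ppr_nonneg)
  next
    fix \<tau> assume "I \<tau>" "\<not> bval (NLess (NLit 0) (nreg 6)) \<tau>"
    then show "f \<tau> \<le> ennreal (J \<tau>)" using f by (simp add: I_def J_def)
  qed
  then show ?thesis
    using \<sigma> by (simp add: walk_def ewp_simps \<sigma>1_def J_def state_simps algebra_simps)
qed

end

section \<open>Pushing residues\<close>

lemma memory_simps [simp]:
  "nmem (tick \<sigma>) = nmem \<sigma>" "rmem (tick \<sigma>) = rmem \<sigma>" "clock (tick \<sigma>) = Suc (clock \<sigma>)"
  "nmem (nstore a i x \<sigma>) = (nmem \<sigma>)(a := (nmem \<sigma> a)(i := x))"
  "rmem (nstore a i x \<sigma>) = rmem \<sigma>" "clock (nstore a i x \<sigma>) = clock \<sigma>"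
  "nmem (rstore a i y \<sigma>) = nmem \<sigma>"
  "rmem (rstore a i y \<sigma>) = (rmem \<sigma>)(a := (rmem \<sigma> a)(i := y))" "clock (rstore a i y \<sigma>) = clock \<sigma>"
  by (simp_all add: state_simps)

text \<open>Every increase puts the node on the stack without testing the threshold; repeated
  entries and residues below the threshold are sorted out when an entry is popped.\<close>

definition add_res :: "rexp \<Rightarrow> com" where
  "add_res r = RSet 1 (nreg 17) (RAdd (RCell 1 (nreg 17)) r) ;; NSet 3 (nreg 11) (nreg 17) ;; incr 11"

definition heavy_step :: com where
  "heavy_step =
    set_nreg 17 (NCell 1 (nreg 4)) ;;
    ask 7 (Adj (nreg 17) (nreg 12)) ;;
    Cond (NLess (NLit 0) (nreg 7))
      (ask 8 (DegOut (nreg 17)) ;; add_res (RDiv (rreg 5) (RNat (nreg 8)))) Skip ;;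
    incr 4"

definition heavy_loop :: com where
  "heavy_loop = set_nreg 4 (NLit 0) ;; While (NLess (nreg 4) (nreg 10)) heavy_step"

text \<open>The machine cannot round, so the ceiling of real register 6 is found by counting, in
  time of the order of the number of draws that follow.\<close>

definition count_loop :: com where
  "count_loop = set_nreg 15 (NLit 0) ;; While (RLess (RNat (nreg 15)) (rreg 6)) (incr 15)"

text \<open>Registers 13 and 14 hold the bound \<open>b\<close> and the pivot \<open>p\<close>. A
  stored quantum is \<open>b / n\<close> times the share of the chosen in-neighbour, with
  \<open>n\<close> the number of draws; so all \<open>n\<close> draws together add its exact share
  in the mean.\<close>

definition draw_step :: com where
  "draw_step =
    RandNat 0 (NLit 9) (nreg 13) ;;
    Cond (NLess (nreg 9) (nreg 14)) Skip
      (ask 17 (InSorted (nreg 12) (nreg 9)) ;;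
       Cond (NLess (NLit 0) (NCell 2 (nreg 17))) Skip
         (ask 8 (DegOut (nreg 17)) ;;
          add_res (RDiv (RMul (RNat (nreg 13)) (RDiv (rreg 5) (RNat (nreg 8)))) (RNat (nreg 15))))) ;;
    incr 16"

definition draw_loop :: com where
  "draw_loop = set_nreg 16 (NLit 0) ;; While (NLess (nreg 16) (nreg 15)) draw_step"

text \<open>\<open>a\<close> is the value to be estimated, \<open>B\<close> the weight of the
  squared error, and \<open>c\<close> the price of a unit of residue at each node. The last
  assumption lets a unit at \<open>v\<close> pay for its push. A push moves at least
  \<open>1 / K\<close>, so its fixed costs carry a factor \<open>K\<close>. A share passed to
  \<open>u\<close> needs the price \<open>c u\<close>, time for about
  \<open>(real K)\<^sup>2\<close> draws per unit in each of \<open>harm (card V)\<close> pivot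
  rounds, and for \<open>u \<notin> H\<close> the variance of quanta of at most
  \<open>1 / (real K)\<^sup>2\<close>.\<close>

locale backward = ppr_algo +
  fixes s K nh :: nat and hl mk :: "nat \<Rightarrow> nat" and B a :: real and c :: "nat \<Rightarrow> real" and H :: "nat set"
  assumes s: "s \<in> V" and K: "0 < K"
    and H_def: "H = {u. mk u \<noteq> 0}"
    and hl: "inj_on hl {..<nh}" "hl ` {..<nh} = H" and H: "H \<subseteq> V"
    and B: "0 \<le> B" and c_nonneg: "\<And>u. u \<in> V \<Longrightarrow> 0 \<le> c u"
    and c_ge: "\<And>v. v \<in> V \<Longrightarrow> A * 30 * real K * (real nh + harm (card V) + 1)
      + (\<Sum>u\<in>V. step_prob u v * (c u + A * 30 * harm (card V) * (real K)\<^sup>2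
          + of_bool (u \<notin> H) * (B / (real K)\<^sup>2) * (visits s u)\<^sup>2)) \<le> c v"
begin

section \<open>Invariant and potential of the backward phase\<close>

abbreviation g :: "nat \<Rightarrow> real" where "g \<equiv> visits s"

text \<open>Once the stack is empty, the last clause puts every residue below \<open>1 / K\<close>,
  which the variance of the final estimate relies on.\<close>

definition wf :: "state \<Rightarrow> bool" where
  "wf \<sigma> \<longleftrightarrow> nmem \<sigma> 0 0 = s \<and> nmem \<sigma> 0 2 = K \<and> nmem \<sigma> 0 10 = nh \<and> nmem \<sigma> 1 = hl \<and> nmem \<sigma> 2 = mk
    \<and> rmem \<sigma> 0 1 = \<alpha> \<and> (\<forall>u. 0 \<le> rmem \<sigma> 1 u) \<and> (\<forall>j<nmem \<sigma> 0 11. nmem \<sigma> 3 j \<in> V)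
    \<and> (\<forall>u\<in>V. 1 \<le> rmem \<sigma> 1 u * real K \<longrightarrow> (\<exists>j<nmem \<sigma> 0 11. nmem \<sigma> 3 j = u))"

definition err :: "state \<Rightarrow> real" where
  "err \<sigma> = rmem \<sigma> 0 0 + (\<Sum>u\<in>V. g u * rmem \<sigma> 1 u) - a"

text \<open>
  The offset \<open>d\<close> is the mean of the mass that the running push still has to distribute.
\<close>

definition pot :: "real \<Rightarrow> state \<Rightarrow> real" where
  "pot d \<sigma> = A * real (clock \<sigma>) + A * 6 * real (nmem \<sigma> 0 11) + (\<Sum>u\<in>V. c u * rmem \<sigma> 1 u) + B * (err \<sigma> + d)\<^sup>2"

lemma wf_simps [simp]:
  "wf (tick \<sigma>) = wf \<sigma>"
  "k \<noteq> 0 \<Longrightarrow> k \<noteq> 2 \<Longrightarrow> k \<noteq> 10 \<Longrightarrow> k \<noteq> 11 \<Longrightarrow> wf (nstore 0 k x \<sigma>) = wf \<sigma>"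
  "k \<noteq> 1 \<Longrightarrow> wf (rstore 0 k y \<sigma>) = wf \<sigma>"
  by (simp_all add: wf_def)

lemma pot_simps [simp]:
  "pot d (tick \<sigma>) = pot d \<sigma> + A"
  "k \<noteq> 11 \<Longrightarrow> pot d (nstore 0 k x \<sigma>) = pot d \<sigma>"
  "k \<noteq> 0 \<Longrightarrow> pot d (rstore 0 k y \<sigma>) = pot d \<sigma>"
  by (simp_all add: pot_def err_def algebra_simps)

lemma pot_offset: "pot (d + z) \<sigma> = pot d \<sigma> + 2 * B * (err \<sigma> + d) * z + B * z\<^sup>2"
  by (simp add: pot_def power2_eq_square algebra_simps)

lemma pot_ge: "wf \<sigma> \<Longrightarrow> A * real (clock \<sigma>) \<le> pot d \<sigma>"
  unfolding pot_def wf_def using A_pos B c_nonneg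
  by (auto intro!: add_nonneg_nonneg sum_nonneg mult_nonneg_nonneg)

lemma pot_nonneg: "wf \<sigma> \<Longrightarrow> 0 \<le> pot d \<sigma>"
  using pot_ge[of \<sigma> d] A_pos by (meson less_imp_le mult_nonneg_nonneg of_nat_0_le_iff order_trans)

lemma sum_fun_upd_add:
  assumes "u \<in> V" shows "(\<Sum>x\<in>V. h x * (r(u := r u + y)) x) = (\<Sum>x\<in>V. h x * r x) + h u * (y::real)"
proof -
  have "(\<Sum>x\<in>V. h x * (r(u := r u + y)) x) = (\<Sum>x\<in>V. h x * r x + (if x = u then h u * y else 0))"
    by (intro sum.cong) (auto simp: algebra_simps)
  then show ?thesis using assms by (simp add: sum.distrib)
qed

text \<open>Adding \<open>y\<close> at \<open>u\<close> moves \<open>err\<close> by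
  \<open>g u * y\<close>, so the offset before the step is larger by that amount. The 9 units are
  three ticks and a credit of 6 for the new stack entry.\<close>

lemma ewp_add_res:
  assumes "wf \<sigma>" "nmem \<sigma> 0 17 = u" "u \<in> V" "rval r \<sigma> = y" "0 \<le> y"
    and f: "\<And>\<tau>. wf \<tau> \<Longrightarrow> (\<forall>k. k \<noteq> 11 \<longrightarrow> nmem \<tau> 0 k = nmem \<sigma> 0 k) \<Longrightarrow> rmem \<tau> 0 = rmem \<sigma> 0 \<Longrightarrow>
      (\<forall>d. pot d \<tau> = pot (d + g u * y) \<sigma> + A * 9 + c u * y) \<Longrightarrow> f \<tau> \<le> X"
  shows "ewp (exec L (add_res r) \<sigma>) f \<le> X"
proof -
  define \<tau> where "\<tau> = tick (nstore 0 11 (Suc (nmem \<sigma> 0 11)) (tick (nstore 3 (nmem \<sigma> 0 11) u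
    (tick (rstore 1 u (rmem \<sigma> 1 u + y) \<sigma>)))))"
  have "ewp (exec L (add_res r) \<sigma>) f = f \<tau>"
    using assms(2,4) by (simp add: add_res_def ewp_simps \<tau>_def)
  also have "\<dots> \<le> X"
  proof (rule f)
    show "wf \<tau>"
      unfolding wf_def
    proof (intro conjI)
      show "\<forall>w\<in>V. 1 \<le> rmem \<tau> 1 w * real K \<longrightarrow> (\<exists>j<nmem \<tau> 0 11. nmem \<tau> 3 j = w)"
      proof (intro ballI impI)
        fix w assume w: "w \<in> V" "1 \<le> rmem \<tau> 1 w * real K"
        show "\<exists>j<nmem \<tau> 0 11. nmem \<tau> 3 j = w"
        proof (cases "w = u")
          case True
          then show ?thesis by (intro exI[of _ "nmem \<sigma> 0 11"]) (simp add: \<tau>_def)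
        next
          case False
          then obtain j where "j < nmem \<sigma> 0 11" "nmem \<sigma> 3 j = w"
            using w assms(1) by (auto simp: \<tau>_def wf_def)
          then show ?thesis by (intro exI[of _ j]) (simp add: \<tau>_def)
        qed
      qed
    qed (use assms in \<open>auto simp: \<tau>_def wf_def less_Suc_eq\<close>)
    show "\<forall>d. pot d \<tau> = pot (d + g u * y) \<sigma> + A * 9 + c u * y"
      using sum_fun_upd_add[OF assms(3), of c "rmem \<sigma> 1" y] sum_fun_upd_add[OF assms(3), of g "rmem \<sigma> 1" y]
      by (simp add: \<tau>_def pot_def err_def algebra_simps)
  qed (auto simp: \<tau>_def)
  finally show ?thesis .
qed

section \<open>Shares of in-neighbours, the exact loop over heavy nodes, and the number of
  draws\<close>

definition w :: "nat \<Rightarrow> real \<Rightarrow> nat \<Rightarrow> real" where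
  "w v x u = step_prob u v * x"

lemma w_nonneg: "0 \<le> x \<Longrightarrow> 0 \<le> w v x u"
  by (simp add: w_def step_prob_nonneg)

lemma w_eq: "v \<in> out_nbs G u \<Longrightarrow> w v x u = (1 - \<alpha>) * x / card (out_nbs G u)"
  by (simp add: w_def step_prob_def)

definition wfp :: "nat \<Rightarrow> real \<Rightarrow> state \<Rightarrow> bool" where
  "wfp v x \<sigma> \<longleftrightarrow> wf \<sigma> \<and> nmem \<sigma> 0 12 = v \<and> rmem \<sigma> 0 5 = (1 - \<alpha>) * x"

lemma wfp_simps [simp]:
  "wfp v x (tick \<sigma>) = wfp v x \<sigma>"
  "k \<noteq> 0 \<Longrightarrow> k \<noteq> 2 \<Longrightarrow> k \<noteq> 10 \<Longrightarrow> k \<noteq> 11 \<Longrightarrow> k \<noteq> 12 \<Longrightarrow> wfp v x (nstore 0 k z \<sigma>) = wfp v x \<sigma>"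
  "k \<noteq> 1 \<Longrightarrow> k \<noteq> 5 \<Longrightarrow> wfp v x (rstore 0 k y \<sigma>) = wfp v x \<sigma>"
  by (simp_all add: wfp_def)

lemma wfp_wf: "wfp v x \<sigma> \<Longrightarrow> wf \<sigma>"
  by (simp add: wfp_def)

text \<open>Nothing is random here, so the offset changes by the exact sum and no variance arises.
  An iteration takes at most 9 ticks and adds at most one stack entry with its credit of 6; the 2
  covers the assignment and the first guard.\<close>

lemma ewp_heavy_loop:
  assumes \<sigma>: "wfp v x \<sigma>" and "0 \<le> x" "0 \<le> E"
    and f: "\<And>\<tau>. wfp v x \<tau> \<Longrightarrow> f \<tau> \<le> ennreal (pot d \<tau> + E)"
  shows "ewp (exec L heavy_loop \<sigma>) f \<le>
    ennreal (pot (d + (\<Sum>u\<in>H. w v x u * g u)) \<sigma> + (\<Sum>u\<in>H. w v x u * c u) + A * (15 * real nh + 2) + E)"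
proof -
  define Sg where "Sg i = (\<Sum>j\<in>{i..<nh}. w v x (hl j) * g (hl j))" for i
  define Sc where "Sc i = (\<Sum>j\<in>{i..<nh}. w v x (hl j) * c (hl j))" for i
  have hlV: "hl i \<in> V" if "i < nh" for i using that hl H by auto
  have S: "Sg i = w v x (hl i) * g (hl i) + Sg (Suc i)" "Sc i = w v x (hl i) * c (hl i) + Sc (Suc i)"
    if "i < nh" for i
    using that unfolding Sg_def Sc_def by (simp_all add: sum.atLeast_Suc_lessThan)
  have Sc_nonneg: "0 \<le> Sc i" for i
    unfolding Sc_def using hlV assms(2) by (auto intro!: sum_nonneg mult_nonneg_nonneg w_nonneg c_nonneg)
  have S0: "Sg 0 = (\<Sum>u\<in>H. w v x u * g u)" "Sc 0 = (\<Sum>u\<in>H. w v x u * c u)"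
    unfolding Sg_def Sc_def hl(2)[symmetric]
    using hl(1) by (simp_all add: sum.reindex lessThan_atLeast0)
  define I where "I = (\<lambda>\<tau>. wfp v x \<tau> \<and> nmem \<tau> 0 4 \<le> nh)"
  define J where "J = (\<lambda>\<tau>. pot (d + Sg (nmem \<tau> 0 4)) \<tau> + Sc (nmem \<tau> 0 4) + A * 15 * (real nh - real (nmem \<tau> 0 4)) + E)"
  define \<sigma>1 where "\<sigma>1 = tick (nstore 0 4 0 \<sigma>)"
  have "ewp (exec L (While (NLess (nreg 4) (nreg 10)) heavy_step) \<sigma>1) f \<le> ennreal (J (tick \<sigma>1))"
  proof (rule ewp_while[where I = I, OF A_pos])
    show "I (tick \<sigma>1)" using \<sigma> by (simp add: I_def \<sigma>1_def)
  next
    fix \<tau> assume "I \<tau>"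
    then show "A * real (clock \<tau>) \<le> J \<tau>"
      using pot_ge[of \<tau> "d + Sg (nmem \<tau> 0 4)"] Sc_nonneg[of "nmem \<tau> 0 4"] A_pos assms(3)
      by (auto simp: I_def J_def wfp_def intro!: add_increasing2)
  next
    fix \<tau> assume I: "I \<tau>" and "\<not> bval (NLess (nreg 4) (nreg 10)) \<tau>"
    then have "nmem \<tau> 0 4 = nh" by (simp add: I_def wfp_def wf_def)
    then show "f \<tau> \<le> ennreal (J \<tau>)" using f I by (simp add: I_def J_def Sg_def Sc_def)
  next
    fix \<tau> assume I: "I \<tau>" and "bval (NLess (nreg 4) (nreg 10)) \<tau>"
    then have lt: "nmem \<tau> 0 4 < nh" and wf: "wf \<tau>" and p: "wfp v x \<tau>" by (simp_all add: I_def wfp_def wf_def)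
    define i where "i = nmem \<tau> 0 4"
    define u where "u = hl i"
    have u: "u \<in> V" "nmem \<tau> 1 i = u" "nmem \<tau> 0 12 = v" "i < nh" "nmem \<tau> 0 4 = i" "rmem \<tau> 0 5 = (1 - \<alpha>) * x"
      using lt hlV wf p by (simp_all add: u_def i_def wf_def wfp_def)
    note S' = S[OF u(4), folded u_def]
    have le: "J \<tau> = pot (d + (w v x u * g u + Sg (Suc i))) \<tau> + (w v x u * c u + Sc (Suc i)) + A * 15 * (real nh - real i) + E"
      by (simp add: J_def u(5) S')
    show "ewp (exec L heavy_step \<tau>) (\<lambda>\<tau>. post I J (tick \<tau>)) \<le> ennreal (J \<tau>)"
    proof (cases "v \<in> out_nbs G u")
      case True
      define \<tau>1 where "\<tau>1 = tick (nstore 0 8 (card (out_nbs G u)) (tick (tick (nstore 0 7 1 (tick (nstore 0 17 u \<tau>))))))"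
      have "ewp (exec L (add_res (RDiv (rreg 5) (RNat (nreg 8)))) \<tau>1)
        (\<lambda>\<tau>. post I J (tick (tick (nstore 0 4 (Suc (nmem \<tau> 0 4)) \<tau>)))) \<le> ennreal (J \<tau>)"
      proof (rule ewp_add_res[of _ u _ "w v x u"], goal_cases)
        case (6 \<tau>2)
        then have t: "wfp v x \<tau>2" "nmem \<tau>2 0 4 = i" "\<And>d. pot d \<tau>2 = pot (d + g u * w v x u) \<tau> + A * 13 + c u * w v x u"
          using p u by (auto simp: \<tau>1_def wfp_def)
        show ?case using t u le by (auto simp: post_def I_def J_def algebra_simps intro!: ennreal_leI)
      qed (use wf u True assms(2) alpha_less in \<open>auto simp: \<tau>1_def w_eq w_nonneg\<close>)
      then show ?thesis
        using u True by (simp add: heavy_step_def ewp_simps out_list \<tau>1_def)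
    next
      case False
      have "w v x u = 0" using False by (simp add: w_def step_prob_def)
      then show ?thesis
        using u False p le A_pos by (auto simp: heavy_step_def ewp_simps out_list post_def I_def J_def algebra_simps intro!: ennreal_leI)
    qed
  qed
  then show ?thesis by (simp add: heavy_loop_def ewp_simps \<sigma>1_def J_def S0 algebra_simps)
qed

text \<open>The ceiling exceeds \<open>y\<close> by at most 1, which adds one iteration of 2 ticks
  to the two initial ticks.\<close>

lemma ewp_count_loop:
  assumes \<sigma>: "wfp v x \<sigma>" "nmem \<sigma> 0 13 = b" "nmem \<sigma> 0 14 = p" "rmem \<sigma> 0 6 = y" and "0 \<le> y" "0 \<le> E"
    and f: "\<And>\<tau>. wfp v x \<tau> \<Longrightarrow> nmem \<tau> 0 13 = b \<Longrightarrow> nmem \<tau> 0 14 = p \<Longrightarrow> nmem \<tau> 0 15 = nat \<lceil>y\<rceil> \<Longrightarrow>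
      f \<tau> \<le> ennreal (pot d \<tau> + E)"
  shows "ewp (exec L count_loop \<sigma>) f \<le> ennreal (pot d \<sigma> + A * (4 + 2 * y) + E)"
proof -
  define N where "N = nat \<lceil>y\<rceil>"
  have N: "y \<le> real N" "real N \<le> y + 1" using \<open>0 \<le> y\<close> by (simp_all add: N_def) linarith?
  have N_le: "Suc n \<le> N" if "real n < y" for n using that unfolding N_def by linarith
  define I where "I = (\<lambda>\<tau>. wfp v x \<tau> \<and> nmem \<tau> 0 13 = b \<and> nmem \<tau> 0 14 = p \<and> rmem \<tau> 0 6 = y \<and> nmem \<tau> 0 15 \<le> N)"
  define J where "J = (\<lambda>\<tau>. pot d \<tau> + A * 2 * (real N - real (nmem \<tau> 0 15)) + E)"
  define \<sigma>1 where "\<sigma>1 = tick (nstore 0 15 0 \<sigma>)"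
  have "ewp (exec L (While (RLess (RNat (nreg 15)) (rreg 6)) (incr 15)) \<sigma>1) f \<le> ennreal (J (tick \<sigma>1))"
  proof (rule ewp_while[where I = I, OF A_pos])
    show "I (tick \<sigma>1)" using \<sigma> by (simp add: I_def \<sigma>1_def)
  next
    fix \<tau> assume "I \<tau>"
    then show "A * real (clock \<tau>) \<le> J \<tau>"
      using pot_ge[of \<tau> d] A_pos assms(6) by (auto simp: I_def J_def wfp_def intro!: add_increasing2)
  next
    fix \<tau> assume I: "I \<tau>" and "\<not> bval (RLess (RNat (nreg 15)) (rreg 6)) \<tau>"
    then have "nmem \<tau> 0 15 = N" using \<open>0 \<le> y\<close> by (auto simp: I_def N_def) linarith
    then show "f \<tau> \<le> ennreal (J \<tau>)" using f I by (simp add: I_def J_def N_def)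
  next
    fix \<tau> assume "I \<tau>" "bval (RLess (RNat (nreg 15)) (rreg 6)) \<tau>"
    then show "ewp (exec L (incr 15) \<tau>) (\<lambda>\<tau>. post I J (tick \<tau>)) \<le> ennreal (J \<tau>)"
      using N_le by (auto simp: ewp_simps post_def I_def J_def algebra_simps intro!: ennreal_leI)
  qed
  also have "J (tick \<sigma>1) \<le> pot d \<sigma> + A * (4 + 2 * y) + E"
  proof -
    have "A * real N \<le> A * (y + 1)" using N A_pos by (intro mult_left_mono) auto
    then show ?thesis by (simp add: J_def \<sigma>1_def algebra_simps)
  qed
  finally show ?thesis by (simp add: count_loop_def ewp_simps \<sigma>1_def ennreal_leI)
qed

text \<open>The mean of a square is the square of the mean plus the variance, and the variance is at
  most the second moment, which \<open>q\<close> bounds.\<close>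

lemma sum_pot_offset_le:
  assumes "0 < (b::nat)" "(\<Sum>i<b. z i) = real b * m" "(\<Sum>i<b. (z i)\<^sup>2) \<le> real b * q"
  shows "(\<Sum>i<b. pot (d + z i) \<sigma>) \<le> real b * (pot (d + m) \<sigma> + B * q)"
proof -
  have "(\<Sum>i<b. pot (d + z i) \<sigma>) = real b * pot d \<sigma> + 2 * B * (err \<sigma> + d) * (\<Sum>i<b. z i) + B * (\<Sum>i<b. (z i)\<^sup>2)"
    by (simp add: pot_offset sum.distrib sum_distrib_left)
  also have "\<dots> \<le> real b * pot d \<sigma> + 2 * B * (err \<sigma> + d) * (real b * m) + B * (real b * q) + B * (real b * m\<^sup>2)"
  proof -
    have "B * (\<Sum>i<b. (z i)\<^sup>2) \<le> B * (real b * q)" using assms(3) B by (rule mult_left_mono)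
    moreover have "0 \<le> B * (real b * m\<^sup>2)" using B by simp
    ultimately show ?thesis using assms(2) by simp
  qed
  finally show ?thesis by (simp add: pot_offset algebra_simps)
qed

end

text \<open>After division by a positive \<open>n\<close> this reads: \<open>harm n\<close> is 1
  plus the mean of \<open>harm i\<close> over \<open>i < n\<close>, the recursion for the expected
  number of rounds when a uniform index below the bound becomes the next bound.\<close>

lemma sum_harm: "(\<Sum>i<n. harm i) = real n * harm n - real n"
proof (induction n)
  case (Suc n)
  have "real (Suc n) * harm (Suc n) = real (Suc n) * harm n + 1"
    by (simp add: harm_Suc distrib_left del: of_nat_Suc)
  with Suc show ?case by (simp add: algebra_simps)
qed simp

section \<open>Pivot rounds for the light in-neighbours, and complete pushes\<close>

definition pivot_step :: com where
  "pivot_step =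
    RandNat 0 (NLit 14) (nreg 13) ;;
    ask 17 (InSorted (nreg 12) (nreg 14)) ;;
    ask 8 (DegOut (nreg 17)) ;;
    set_rreg 6 (RMul (RMul (RNat (nreg 13)) (RDiv (rreg 5) (RNat (nreg 8)))) (RMul (RNat (nreg 2)) (RNat (nreg 2)))) ;;
    count_loop ;;
    draw_loop ;;
    set_nreg 13 (nreg 14)"

definition pivot_loop :: com where
  "pivot_loop = While (NLess (NLit 0) (nreg 13)) pivot_step"

text \<open>The residue is cleared before shares are added, because a node with a self-loop is its
  own in-neighbour. The two negated comparisons test equality with the source.\<close>

definition push_node :: com where
  "push_node =
    RSet 1 (nreg 12) (RNat (NLit 0)) ;;
    Cond (BAnd (BNot (NLess (nreg 12) (nreg 0))) (BNot (NLess (nreg 0) (nreg 12))))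
      (set_rreg 0 (RAdd (rreg 0) (rreg 5))) Skip ;;
    set_rreg 5 (RMul (RSub (RNat (NLit 1)) (rreg 1)) (rreg 5)) ;;
    heavy_loop ;;
    ask 13 (DegIn (nreg 12)) ;;
    pivot_loop"

definition backward_step :: com where
  "backward_step =
    set_nreg 11 (NPred (nreg 11)) ;;
    set_nreg 12 (NCell 3 (nreg 11)) ;;
    set_rreg 5 (RCell 1 (nreg 12)) ;;
    Cond (RLess (RMul (rreg 5) (RNat (nreg 2))) (RNat (NLit 1))) Skip push_node"

definition backward_loop :: com where
  "backward_loop = While (NLess (NLit 0) (nreg 11)) backward_step"

lemma (in ppr_graph) out_degree_eq: "out_degree (with_proj G) u = card (out_nbs G u)"
proof -
  have "out_arcs (with_proj G) u = Pair u ` out_nbs G u"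
    by (auto simp: out_arcs_def out_nbs_def)
  then show ?thesis by (simp add: out_degree_def card_image inj_on_def)
qed

context backward
begin

definition nb :: "nat \<Rightarrow> nat \<Rightarrow> nat" where
  "nb v i = in_sorted_list L v ! i"

lemma nb_mem:
  assumes "i < card (in_nbs G v)" shows "nb v i \<in> in_nbs G v" "nb v i \<in> V" "v \<in> out_nbs G (nb v i)"
proof -
  show "nb v i \<in> in_nbs G v"
    using assms nth_mem[of i "in_sorted_list L v"] in_sorted_list[of v] by (simp add: nb_def)
  then show "nb v i \<in> V" "v \<in> out_nbs G (nb v i)"
    using in_nbs_subset[of v] by (auto simp: in_nbs_iff)
qed

text \<open>A share is \<open>(1 - \<alpha>) * x\<close> divided by an out-degree, so sorting
  in-neighbours by out-degree sorts the shares. This is what the sorted lists are for.\<close>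

lemma w_nb_mono:
  assumes "0 \<le> x" "i \<le> j" "j < card (in_nbs G v)"
  shows "w v x (nb v j) \<le> w v x (nb v i)"
proof -
  have "sorted (map (out_degree (with_proj G)) (in_sorted_list L v))"
    using represents by (auto simp: represents_def)
  then have "card (out_nbs G (nb v i)) \<le> card (out_nbs G (nb v j))"
    using assms in_sorted_list[of v] sorted_nth_mono[of "map (out_degree (with_proj G)) (in_sorted_list L v)" i j]
    by (simp add: nb_def out_degree_eq)
  then show ?thesis
    using assms nb_mem[of i v] nb_mem[of j v] alpha_less card_out_nbs_pos[of v "nb v i"]
    by (simp add: w_eq frac_le)
qed

lemma sum_nb: "(\<Sum>i<card (in_nbs G v). h (nb v i)) = (\<Sum>u\<in>in_nbs G v. h u)"
  using sum_nth_distinct[OF in_sorted_list(1), of h v] by (simp add: in_sorted_list nb_def)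

text \<open>The price of a unit moved to \<open>u\<close> in quanta of at most
  \<open>1 / (real K)\<^sup>2\<close>, including the variance that they cause.\<close>

definition gain :: "nat \<Rightarrow> real" where
  "gain u = c u + B / (real K)\<^sup>2 * (g u)\<^sup>2"

lemma gain_nonneg: "u \<in> V \<Longrightarrow> 0 \<le> gain u"
  unfolding gain_def using B c_nonneg by simp

text \<open>\<open>Mg\<close> and \<open>Mc\<close> are totals over the light indices from
  \<open>p\<close> to \<open>b\<close>; with \<open>j\<close> draws left, the fraction
  \<open>j / n\<close> of both is outstanding. A draw takes at most 10 ticks and adds at most one
  stack entry with credit 6, hence 16.\<close>

lemma ewp_draw_step:
  assumes \<tau>: "wfp v x \<tau>" "nmem \<tau> 0 13 = b" "nmem \<tau> 0 14 = p" "nmem \<tau> 0 15 = n" "nmem \<tau> 0 16 < n"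
    and x: "0 \<le> x" and b: "p < b" "b \<le> card (in_nbs G v)" and n: "real b * w v x (nb v p) * (real K)\<^sup>2 \<le> real n"
    and E: "0 \<le> E"
    and D_def: "D = {i. p \<le> i \<and> i < b \<and> nb v i \<notin> H}"
    and M_def: "Mg = (\<Sum>i\<in>D. w v x (nb v i) * g (nb v i))" "Mc = (\<Sum>i\<in>D. w v x (nb v i) * gain (nb v i))"
    and I_def: "I = (\<lambda>\<tau>. wfp v x \<tau> \<and> nmem \<tau> 0 13 = b \<and> nmem \<tau> 0 14 = p \<and> nmem \<tau> 0 15 = n \<and> nmem \<tau> 0 16 \<le> n)"
    and J_def: "J = (\<lambda>\<tau>. pot (d + (real n - real (nmem \<tau> 0 16)) / n * Mg) \<tau>
        + (real n - real (nmem \<tau> 0 16)) / n * Mc + A * 16 * (real n - real (nmem \<tau> 0 16)) + E)"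
  shows "ewp (exec L draw_step \<tau>) (\<lambda>\<tau>. post I J (tick \<tau>)) \<le> ennreal (J \<tau>)"
proof -
  define r where "r = real n - real (nmem \<tau> 0 16) - 1"
  define d' where "d' = d + r / n * Mg"
  define E' where "E' = r / n * Mc + A * 16 * r + E"
  have n0: "0 < n" and r: "0 \<le> r" using \<tau>(5) by (auto simp: r_def)
  have D: "D \<subseteq> {..<b}" "finite D" by (auto simp: D_def intro: finite_subset[of _ "{..<b}"])
  have memD: "nb v i \<in> V" "v \<in> out_nbs G (nb v i)" if "i < b" for i using nb_mem[of i v] that b by auto
  have wD: "0 \<le> w v x u" for u using x by (rule w_nonneg)
  have Mc: "0 \<le> Mc" unfolding M_def using D memD by (auto intro!: sum_nonneg mult_nonneg_nonneg wD gain_nonneg)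
  have E': "0 \<le> E'" unfolding E'_def using r Mc E A_pos by simp
  have J_succ: "J (tick (tick (nstore 0 16 (Suc (nmem \<tau> 0 16)) \<tau>'))) = pot d' \<tau>' + 2 * A + E'" for \<tau>'
    by (simp add: J_def d'_def E'_def r_def algebra_simps)
  define y where "y i = (if i \<in> D then real b * w v x (nb v i) / n else 0)" for i
  define h where "h i = pot (d' + g (nb v i) * y i) \<tau> + c (nb v i) * y i + (16 * A + E')" for i
  have wf: "wf \<tau>" using \<tau>(1) by (rule wfp_wf)
  have sum_D: "(\<Sum>i<b. f i * y i) = real b * ((\<Sum>i\<in>D. w v x (nb v i) * f i) / n)" for f
  proof -
    have "(\<Sum>i<b. f i * y i) = (\<Sum>i\<in>D. f i * y i)"
      using D by (intro sum.mono_neutral_right) (auto simp: y_def)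
    also have "\<dots> = (\<Sum>i\<in>D. real b * (w v x (nb v i) * f i / n))"
      by (intro sum.cong) (auto simp: y_def)
    finally show ?thesis by (simp add: sum_distrib_left sum_divide_distrib)
  qed
  \<comment> \<open>Here the order of the list matters: from \<open>p\<close> on no share exceeds
    that of the pivot, and \<open>n\<close> is large enough for the pivot.\<close>
  have y_le: "y i \<le> 1 / (real K)\<^sup>2" if "i < b" for i
  proof (cases "i \<in> D")
    case True
    have "real b * w v x (nb v i) * (real K)\<^sup>2 \<le> real b * w v x (nb v p) * (real K)\<^sup>2"
      using True b x by (intro mult_right_mono mult_left_mono w_nb_mono) (auto simp: D_def)
    also note n
    finally show ?thesis using True n0 K by (simp add: y_def field_simps)
  qed (simp add: y_def)
  have y_nonneg: "0 \<le> y i" for i by (simp add: y_def wD)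
  \<comment> \<open>One factor \<open>y i\<close> of the square is bounded by the largest quantum;
    the other remains, so that the bound stays linear in the share.\<close>
  have sq: "(\<Sum>i<b. (g (nb v i) * y i)\<^sup>2) \<le> real b * ((\<Sum>i\<in>D. w v x (nb v i) * ((g (nb v i))\<^sup>2 / (real K)\<^sup>2)) / n)"
  proof -
    have "(\<Sum>i<b. (g (nb v i) * y i)\<^sup>2) \<le> (\<Sum>i<b. (g (nb v i))\<^sup>2 / (real K)\<^sup>2 * y i)"
    proof (rule sum_mono)
      fix i assume "i \<in> {..<b}"
      then have "(g (nb v i))\<^sup>2 * y i * y i \<le> (g (nb v i))\<^sup>2 * y i * (1 / (real K)\<^sup>2)"
        by (intro mult_left_mono y_le) (auto simp: y_nonneg)
      then show "(g (nb v i) * y i)\<^sup>2 \<le> (g (nb v i))\<^sup>2 / (real K)\<^sup>2 * y i"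
        by (simp add: power2_eq_square algebra_simps)
    qed
    then show ?thesis by (simp only: sum_D)
  qed
  have "(\<Sum>i<b. pot (d' + g (nb v i) * y i) \<tau>) \<le>
      real b * (pot (d' + Mg / n) \<tau> + B * ((\<Sum>i\<in>D. w v x (nb v i) * ((g (nb v i))\<^sup>2 / (real K)\<^sup>2)) / n))"
    using b sq by (intro sum_pot_offset_le) (auto simp: sum_D M_def)
  then have "(\<Sum>i<b. h i) \<le> real b * (pot (d' + Mg / n) \<tau> + B * ((\<Sum>i\<in>D. w v x (nb v i) * ((g (nb v i))\<^sup>2 / (real K)\<^sup>2)) / n)
      + (\<Sum>i\<in>D. w v x (nb v i) * c (nb v i)) / n + (16 * A + E'))"
    unfolding h_def sum.distrib sum_D by (simp add: distrib_left)
  also have "B * ((\<Sum>i\<in>D. w v x (nb v i) * ((g (nb v i))\<^sup>2 / (real K)\<^sup>2)) / n)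
      + (\<Sum>i\<in>D. w v x (nb v i) * c (nb v i)) / n = Mc / n"
    unfolding M_def gain_def by (simp add: distrib_left sum.distrib sum_distrib_left add_divide_distrib sum_divide_distrib mult_ac)
  then have "real b * (pot (d' + Mg / n) \<tau> + B * ((\<Sum>i\<in>D. w v x (nb v i) * ((g (nb v i))\<^sup>2 / (real K)\<^sup>2)) / n)
      + (\<Sum>i\<in>D. w v x (nb v i) * c (nb v i)) / n + (16 * A + E')) =
      real b * (pot (d' + Mg / n) \<tau> + Mc / n + (16 * A + E'))"
    by (simp only: add.assoc)
  also have "pot (d' + Mg / n) \<tau> + Mc / n + (16 * A + E') = J \<tau>"
  proof -
    have split: "(real n - real (nmem \<tau> 0 16)) / n * z = r / n * z + z / n" for z
      by (simp add: r_def diff_divide_distrib add_divide_distrib algebra_simps)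
    show ?thesis
      unfolding J_def split by (simp add: d'_def E'_def r_def algebra_simps)
  qed
  finally have sum_h: "(\<Sum>i<b. h i) \<le> real b * J \<tau>" .
  show ?thesis
    unfolding draw_step_def ewp_Seq
  proof (rule ewp_RandNat[where h = h], goal_cases)
    case 1
    show ?case using \<tau> b by simp
  next
    case (2 i)
    then have i: "i < b" using \<tau> by simp
    have skip: "16 * A + E' \<ge> A * k + E'" if "k \<le> 16" for k
      using that A_pos by (simp add: mult.commute)
    show ?case
    proof (cases "i \<in> D")
      case False
      have "pot d' \<tau> + A * k + E' \<le> h i" if "k \<le> 16" for k
        using False skip[OF that] by (simp add: h_def y_def)
      \<comment> \<open>5 ticks when the draw falls below the pivot, 7 when it hits a heavy
        in-neighbour.\<close>
      from this[of 5] this[of 7] have h: "pot d' \<tau> + A * 5 + E' \<le> h i" "pot d' \<tau> + A * 7 + E' \<le> h i"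
        by simp_all
      have mem: "nmem \<tau> 0 12 = v" "nmem \<tau> 2 = mk" using \<tau>(1) by (simp_all add: wfp_def wf_def)
      show ?thesis
      proof (cases "i < p")
        case True
        then show ?thesis
          using h \<tau> mem by (simp add: ewp_simps post_def I_def J_succ algebra_simps ennreal_leI)
      next
        case ge: False
        then have "0 < mk (in_sorted_list L v ! i)" using False i by (simp add: D_def H_def nb_def)
        then show ?thesis
          using h \<tau> mem ge by (simp add: ewp_simps post_def I_def J_succ algebra_simps ennreal_leI)
      qed
    next
      case True
      define u where "u = nb v i"
      have u: "u \<in> V" "u \<notin> H" "mk u = 0" "v \<in> out_nbs G u" "p \<le> i" "in_sorted_list L v ! i = u"
        using True i memD[OF i] by (auto simp: u_def D_def H_def nb_def)
      define \<tau>1 where "\<tau>1 = tick (nstore 0 8 (card (out_nbs G u)) (tick (tick (nstore 0 17 u (tick (tick (nstore 0 9 i \<tau>)))))))"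
      have "ewp (exec L (add_res (RDiv (RMul (RNat (nreg 13)) (RDiv (rreg 5) (RNat (nreg 8)))) (RNat (nreg 15)))) \<tau>1)
        (\<lambda>\<tau>. post I J (tick (tick (nstore 0 16 (Suc (nmem \<tau> 0 16)) \<tau>)))) \<le> ennreal (h i)"
      proof (rule ewp_add_res[of _ u _ "y i"], goal_cases)
        case (6 \<tau>2)
        then have t: "wfp v x \<tau>2" "nmem \<tau>2 0 13 = b" "nmem \<tau>2 0 14 = p" "nmem \<tau>2 0 15 = n" "nmem \<tau>2 0 16 = nmem \<tau> 0 16"
          "pot d' \<tau>2 = pot (d' + g u * y i) \<tau> + A * 14 + c u * y i"
          using \<tau> by (auto simp: \<tau>1_def wfp_def)
        then have "I (tick (tick (nstore 0 16 (Suc (nmem \<tau>2 0 16)) \<tau>2)))"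
          using \<tau> by (simp add: I_def)
        then show ?case
          using t(6) unfolding t(5) J_succ post_def by (simp add: h_def u_def algebra_simps)
      qed (use wf \<tau> u True y_nonneg alpha_less x in \<open>auto simp: \<tau>1_def w_eq y_def u_def wfp_def\<close>)
      then show ?thesis
        using u \<tau> wf by (auto simp: ewp_simps \<tau>1_def out_list wfp_def wf_def)
    qed
  next
    case (3 i)
    then show ?case
      using \<tau> E' A_pos pot_nonneg[OF wf] memD c_nonneg y_nonneg by (auto simp: h_def intro!: add_nonneg_nonneg)
  next
    case 4
    show ?case using \<tau> sum_h by simp
  qed
qed

lemma ewp_draw_loop:
  assumes \<sigma>: "wfp v x \<sigma>" "nmem \<sigma> 0 13 = b" "nmem \<sigma> 0 14 = p" "nmem \<sigma> 0 15 = n" "0 < n"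
    and x: "0 \<le> x" and b: "p < b" "b \<le> card (in_nbs G v)" and n: "real b * w v x (nb v p) * (real K)\<^sup>2 \<le> real n"
    and E: "0 \<le> E"
    and D_def: "D = {i. p \<le> i \<and> i < b \<and> nb v i \<notin> H}"
    and f: "\<And>\<tau>. wfp v x \<tau> \<Longrightarrow> nmem \<tau> 0 13 = b \<Longrightarrow> nmem \<tau> 0 14 = p \<Longrightarrow> f \<tau> \<le> ennreal (pot d \<tau> + E)"
  shows "ewp (exec L draw_loop \<sigma>) f \<le> ennreal (pot (d + (\<Sum>i\<in>D. w v x (nb v i) * g (nb v i))) \<sigma>
    + (\<Sum>i\<in>D. w v x (nb v i) * gain (nb v i)) + A * (2 + 16 * real n) + E)"
proof -
  define Mg where "Mg = (\<Sum>i\<in>D. w v x (nb v i) * g (nb v i))"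
  define Mc where "Mc = (\<Sum>i\<in>D. w v x (nb v i) * gain (nb v i))"
  have Mc: "0 \<le> Mc"
    unfolding Mc_def using nb_mem b x by (auto intro!: sum_nonneg mult_nonneg_nonneg w_nonneg gain_nonneg simp: D_def)
  define I where "I = (\<lambda>\<tau>. wfp v x \<tau> \<and> nmem \<tau> 0 13 = b \<and> nmem \<tau> 0 14 = p \<and> nmem \<tau> 0 15 = n \<and> nmem \<tau> 0 16 \<le> n)"
  define J where "J = (\<lambda>\<tau>. pot (d + (real n - real (nmem \<tau> 0 16)) / n * Mg) \<tau>
        + (real n - real (nmem \<tau> 0 16)) / n * Mc + A * 16 * (real n - real (nmem \<tau> 0 16)) + E)"
  define \<sigma>1 where "\<sigma>1 = tick (nstore 0 16 0 \<sigma>)"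
  have "ewp (exec L (While (NLess (nreg 16) (nreg 15)) draw_step) \<sigma>1) f \<le> ennreal (J (tick \<sigma>1))"
  proof (rule ewp_while[where I = I, OF A_pos])
    show "I (tick \<sigma>1)" using \<sigma> by (simp add: I_def \<sigma>1_def)
  next
    fix \<tau> assume "I \<tau>"
    then show "A * real (clock \<tau>) \<le> J \<tau>"
      using pot_ge[of \<tau>] Mc A_pos E by (auto simp: I_def J_def wfp_def intro!: add_increasing2)
  next
    fix \<tau> assume I: "I \<tau>" and "\<not> bval (NLess (nreg 16) (nreg 15)) \<tau>"
    then have "nmem \<tau> 0 16 = n" by (simp add: I_def)
    then show "f \<tau> \<le> ennreal (J \<tau>)" using f I by (simp add: I_def J_def)
  next
    fix \<tau> assume "I \<tau>" "bval (NLess (nreg 16) (nreg 15)) \<tau>"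
    then show "ewp (exec L draw_step \<tau>) (\<lambda>\<tau>. post I J (tick \<tau>)) \<le> ennreal (J \<tau>)"
      by (intro ewp_draw_step[OF _ _ _ _ _ x b n E D_def Mg_def Mc_def I_def J_def]) (auto simp: I_def)
  qed
  then show ?thesis
    using \<open>0 < n\<close> by (simp add: draw_loop_def ewp_simps \<sigma>1_def J_def Mg_def Mc_def algebra_simps)
qed

definition light :: "nat \<Rightarrow> nat \<Rightarrow> nat set" where
  "light v b = {i. i < b \<and> nb v i \<notin> H}"

lemma sum_light_split:
  assumes "p < b"
  shows "(\<Sum>i\<in>light v b. f i) = (\<Sum>i\<in>light v p. f i) + (\<Sum>i\<in>{i. p \<le> i \<and> i < b \<and> nb v i \<notin> H}. (f i :: real))"
proof -
  let ?D = "{i. p \<le> i \<and> i < b \<and> nb v i \<notin> H}"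
  have fin: "finite (light v p)" "finite ?D"
    by (auto simp: light_def intro: finite_subset[of _ "{..<p}"] finite_subset[of _ "{..<b}"])
  have disj: "light v p \<inter> ?D = {}" by (auto simp: light_def)
  have un: "light v b = light v p \<union> ?D" using assms by (auto simp: light_def)
  show ?thesis unfolding un by (rule sum.union_disjoint[OF fin disj])
qed

text \<open>A round with pivot \<open>p\<close> costs at most \<open>28 + 18 * y p\<close>. The
  factor \<open>b\<close> in \<open>y p\<close> cancels the uniform weight of the pivot, so
  \<open>y p\<close> has mean at most \<open>(real K)\<^sup>2 * W\<close> and the mean round is
  covered by \<open>30 * (1 + (real K)\<^sup>2 * W)\<close>. By \<open>sum_harm\<close>, the
  harmonic number drops by 1 in the mean, which pays for exactly one round.\<close>

lemma ewp_pivot_step: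
  assumes \<tau>: "wfp v x \<tau>" "nmem \<tau> 0 13 = b" "0 < b" "b \<le> card (in_nbs G v)"
    and x: "0 < x" and E: "0 \<le> E"
    and P_def: "Pg = (\<lambda>b. \<Sum>i\<in>light v b. w v x (nb v i) * g (nb v i))"
      "Pc = (\<lambda>b. \<Sum>i\<in>light v b. w v x (nb v i) * gain (nb v i))"
    and W: "W = (\<Sum>u\<in>in_nbs G v. w v x u)"
    and I_def: "I = (\<lambda>\<tau>. wfp v x \<tau> \<and> nmem \<tau> 0 13 \<le> card (in_nbs G v))"
    and J_def: "J = (\<lambda>\<tau>. pot (d + Pg (nmem \<tau> 0 13)) \<tau> + Pc (nmem \<tau> 0 13)
      + A * 30 * (1 + (real K)\<^sup>2 * W) * harm (nmem \<tau> 0 13) + E)"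
  shows "ewp (exec L pivot_step \<tau>) (\<lambda>\<tau>. post I J (tick \<tau>)) \<le> ennreal (J \<tau>)"
proof -
  define R where "R p = A * 30 * (1 + (real K)\<^sup>2 * W) * harm p" for p
  define y where "y p = real b * w v x (nb v p) * (real K)\<^sup>2" for p
  define h where "h p = (pot (d + Pg b) \<tau> + Pc b + E) + A * (28 + 18 * y p) + R p" for p
  have wf: "wf \<tau>" and mem: "nmem \<tau> 0 12 = v" "nmem \<tau> 0 2 = K" "rmem \<tau> 0 5 = (1 - \<alpha>) * x"
    using \<tau>(1) by (simp_all add: wfp_def wf_def)
  have x': "0 \<le> x" using x by simp
  note w_ge = w_nonneg[OF x']
  have W0: "0 \<le> W" unfolding W by (intro sum_nonneg w_ge)
  have R: "0 \<le> R p" for p unfolding R_def using A_pos W0 by (simp add: harm_nonneg)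
  have Pc: "0 \<le> Pc p" if "p \<le> b" for p
    unfolding P_def using nb_mem \<tau>(4) that by (auto intro!: sum_nonneg mult_nonneg_nonneg w_ge gain_nonneg simp: light_def)
  have y: "0 \<le> y p" for p unfolding y_def by (simp add: w_ge)
  have J: "J \<tau> = pot (d + Pg b) \<tau> + Pc b + E + R b" using \<tau> by (simp add: J_def R_def)
  show ?thesis
    unfolding pivot_step_def ewp_Seq[of L "RandNat _ _ _"]
  proof (rule ewp_RandNat[where h = h], goal_cases)
    case 1
    show ?case using \<tau> by simp
  next
    case (2 p)
    then have p: "p < b" using \<tau> by simp
    define u where "u = nb v p"
    have u: "in_sorted_list L v ! p = u" "u \<in> V" "v \<in> out_nbs G u"
      using nb_mem[of p v] p \<tau> by (auto simp: u_def nb_def)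
    have y_eq: "real b * ((1 - \<alpha>) * x / real (card (out_nbs G u))) * (real K * real K) = y p"
      using u by (simp add: y_def u_def w_eq power2_eq_square)
    \<comment> \<open>A positive residue gives at least one draw, so that dividing by the number of
      draws makes sense.\<close>
    have y_pos: "0 < y p"
      unfolding y_eq[symmetric] using p x alpha_less K card_out_nbs_pos[OF u(3)] by simp
    define n where "n = nat \<lceil>y p\<rceil>"
    have n: "0 < n" "y p \<le> real n" "real n \<le> y p + 1" using y_pos by (simp_all add: n_def)
    define D where "D = {i. p \<le> i \<and> i < b \<and> nb v i \<notin> H}"
    define E1 where "E1 = Pc p + R p + E + 2 * A"
    have E1: "0 \<le> E1" using Pc[of p] p R[of p] E A_pos by (simp add: E1_def)
    define Dg where "Dg = (\<Sum>i\<in>D. w v x (nb v i) * g (nb v i))"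
    define Dc where "Dc = (\<Sum>i\<in>D. w v x (nb v i) * gain (nb v i))"
    have Dc: "0 \<le> Dc"
      unfolding Dc_def using nb_mem \<tau>(4) by (auto intro!: sum_nonneg mult_nonneg_nonneg w_ge gain_nonneg simp: D_def)
    have split: "Pg b = Pg p + Dg" "Pc b = Pc p + Dc"
      unfolding P_def Dg_def Dc_def D_def using sum_light_split[OF p] by auto
    define \<tau>1 where "\<tau>1 = tick (rstore 0 6 (y p) (tick (nstore 0 8 (card (out_nbs G u))
      (tick (nstore 0 17 u (tick (nstore 0 14 p \<tau>)))))))"
    define F where "F = (\<lambda>\<tau>. post I J (tick (tick (nstore 0 13 (nmem \<tau> 0 14) \<tau>))))"
    have draws: "ewp (exec L draw_loop \<tau>2) F \<le> ennreal (pot (d + Pg p + Dg) \<tau>2 + (Dc + A * (2 + 16 * real n) + E1))"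
      if "wfp v x \<tau>2" "nmem \<tau>2 0 13 = b" "nmem \<tau>2 0 14 = p" "nmem \<tau>2 0 15 = n" for \<tau>2
    proof -
      have "ewp (exec L draw_loop \<tau>2) F \<le> ennreal (pot (d + Pg p + Dg) \<tau>2 + Dc + A * (2 + 16 * real n) + E1)"
        unfolding Dg_def Dc_def
      proof (rule ewp_draw_loop[OF that n(1) x' p \<tau>(4) _ E1 D_def])
        show "real b * w v x (nb v p) * (real K)\<^sup>2 \<le> real n" using n by (simp add: y_def)
      next
        fix \<tau>3 assume t: "wfp v x \<tau>3" "nmem \<tau>3 0 13 = b" "nmem \<tau>3 0 14 = p"
        have "I (tick (tick (nstore 0 13 p \<tau>3)))" using t p \<tau>(4) by (simp add: I_def)
        then have "F \<tau>3 = ennreal (J (tick (tick (nstore 0 13 p \<tau>3))))" using t by (simp add: F_def post_def)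
        also have "J (tick (tick (nstore 0 13 p \<tau>3))) = pot (d + Pg p) \<tau>3 + E1"
          by (simp add: J_def E1_def R_def)
        finally show "F \<tau>3 \<le> ennreal (pot (d + Pg p) \<tau>3 + E1)" by simp
      qed
      then show ?thesis by (simp add: add.assoc)
    qed
    have "ewp (exec L count_loop \<tau>1) (\<lambda>\<tau>2. ewp (exec L draw_loop \<tau>2) F) \<le>
      ennreal (pot (d + Pg p + Dg) \<tau>1 + A * (4 + 2 * y p) + (Dc + A * (2 + 16 * real n) + E1))"
    proof (rule ewp_count_loop[where v = v and x = x and b = b and p = p])
      show "0 \<le> Dc + A * (2 + 16 * real n) + E1" using Dc E1 A_pos by simp
    qed (use \<tau> y draws in \<open>auto simp: \<tau>1_def n_def\<close>)
    \<comment> \<open>28 is made of 4 ticks to set up the pivot, 4 for counting, 2 for the draw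
      loop, 2 to close the round, and 16 for rounding the number of draws up.\<close>
    also have "\<dots> \<le> ennreal (h p)"
    proof (rule ennreal_leI)
      have "A * (16 * real n) \<le> A * (16 * (y p + 1))" using n A_pos by (intro mult_left_mono) auto
      then show "pot (d + Pg p + Dg) \<tau>1 + A * (4 + 2 * y p) + (Dc + A * (2 + 16 * real n) + E1) \<le> h p"
        by (simp add: h_def \<tau>1_def split E1_def algebra_simps)
    qed
    finally have "ewp (exec L count_loop \<tau>1) (\<lambda>\<tau>2. ewp (exec L draw_loop \<tau>2) F) \<le> ennreal (h p)" .
    then show ?case
      using u mem \<tau> by (simp add: ewp_simps \<tau>1_def F_def out_list y_eq[symmetric])
  next
    case (3 p)
    then show ?case using pot_nonneg[OF wf] Pc[of b] E R y A_pos by (simp add: h_def)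
  next
    case 4
    define q where "q = pot (d + Pg b) \<tau> + Pc b + E"
    have "(\<Sum>p<b. w v x (nb v p)) \<le> (\<Sum>p<card (in_nbs G v). w v x (nb v p))"
      using \<tau>(4) by (intro sum_mono2) (auto simp: w_ge)
    then have "(\<Sum>p<b. y p) \<le> real b * ((real K)\<^sup>2 * W)"
      unfolding y_def W sum_nb by (simp add: sum_distrib_left[symmetric] sum_distrib_right[symmetric] mult.assoc)
        (simp add: mult.commute mult_left_mono)
    then have "A * 18 * (\<Sum>p<b. y p) \<le> A * 18 * (real b * ((real K)\<^sup>2 * W))"
      using A_pos by (intro mult_left_mono) auto
    also have "\<dots> + A * 28 * real b \<le> A * 30 * (1 + (real K)\<^sup>2 * W) * real b"
      using A_pos W0 by (simp add: algebra_simps)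
    finally have yb: "A * 18 * (\<Sum>p<b. y p) + A * 28 * real b \<le> A * 30 * (1 + (real K)\<^sup>2 * W) * real b"
      by simp
    have "(\<Sum>p<b. h p) = real b * q + (A * 28 * real b + A * 18 * (\<Sum>p<b. y p)) + (\<Sum>p<b. R p)"
      by (simp add: h_def q_def sum.distrib sum_distrib_left sum_distrib_right algebra_simps)
    also have "(\<Sum>p<b. R p) = A * 30 * (1 + (real K)\<^sup>2 * W) * (real b * harm b - real b)"
      by (simp add: R_def sum_distrib_left[symmetric] sum_harm)
    also have "real b * q + (A * 28 * real b + A * 18 * (\<Sum>p<b. y p)) + \<dots> \<le> real b * (q + R b)"
      using yb by (simp add: R_def algebra_simps)
    finally show ?case using \<tau> J by (simp add: q_def)
  qed
qed

lemma ewp_pivot_loop: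
  assumes \<sigma>: "wfp v x \<sigma>" "nmem \<sigma> 0 13 = card (in_nbs G v)" and x: "0 < x" and E: "0 \<le> E"
    and f: "\<And>\<tau>. wfp v x \<tau> \<Longrightarrow> f \<tau> \<le> ennreal (pot d \<tau> + E)"
  shows "ewp (exec L pivot_loop \<sigma>) f \<le> ennreal (pot (d + (\<Sum>u\<in>in_nbs G v - H. w v x u * g u)) \<sigma>
    + (\<Sum>u\<in>in_nbs G v - H. w v x u * gain u)
    + A * (1 + 30 * (1 + (real K)\<^sup>2 * (\<Sum>u\<in>in_nbs G v. w v x u)) * harm (card (in_nbs G v))) + E)"
proof -
  define Pg where "Pg b = (\<Sum>i\<in>light v b. w v x (nb v i) * g (nb v i))" for b
  define Pc where "Pc b = (\<Sum>i\<in>light v b. w v x (nb v i) * gain (nb v i))" for b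
  define W where "W = (\<Sum>u\<in>in_nbs G v. w v x u)"
  define N where "N = card (in_nbs G v)"
  have x': "0 \<le> x" using x by simp
  note w_ge = w_nonneg[OF x']
  have W0: "0 \<le> W" unfolding W_def by (intro sum_nonneg w_ge)
  have Pc: "0 \<le> Pc p" if "p \<le> N" for p
    unfolding Pc_def using nb_mem that by (auto intro!: sum_nonneg mult_nonneg_nonneg w_ge gain_nonneg simp: light_def N_def)
  have full: "(\<Sum>i\<in>light v N. h (nb v i)) = (\<Sum>u\<in>in_nbs G v - H. h u)" for h :: "nat \<Rightarrow> real"
  proof -
    have "(\<Sum>i\<in>light v N. h (nb v i)) = (\<Sum>i\<in>{..<N}. if nb v i \<notin> H then h (nb v i) else 0)"
      by (auto simp: light_def intro!: sum.mono_neutral_cong_left)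
    also have "\<dots> = (\<Sum>u\<in>in_nbs G v. if u \<notin> H then h u else 0)"
      unfolding N_def by (rule sum_nb)
    also have "\<dots> = (\<Sum>u\<in>in_nbs G v - H. h u)"
      by (auto intro!: sum.mono_neutral_cong_right)
    finally show ?thesis .
  qed
  define I where "I = (\<lambda>\<tau>. wfp v x \<tau> \<and> nmem \<tau> 0 13 \<le> card (in_nbs G v))"
  define J where "J = (\<lambda>\<tau>. pot (d + Pg (nmem \<tau> 0 13)) \<tau> + Pc (nmem \<tau> 0 13)
      + A * 30 * (1 + (real K)\<^sup>2 * W) * harm (nmem \<tau> 0 13) + E)"
  have "ewp (exec L (While (NLess (NLit 0) (nreg 13)) pivot_step) \<sigma>) f \<le> ennreal (J (tick \<sigma>))"
  proof (rule ewp_while[where I = I, OF A_pos])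
    show "I (tick \<sigma>)" using \<sigma> by (simp add: I_def)
  next
    fix \<tau> assume "I \<tau>"
    then have "A * real (clock \<tau>) \<le> pot (d + Pg (nmem \<tau> 0 13)) \<tau>" "0 \<le> Pc (nmem \<tau> 0 13)"
      "0 \<le> A * 30 * (1 + (real K)\<^sup>2 * W) * harm (nmem \<tau> 0 13)"
      using pot_ge Pc A_pos W0 by (auto simp: I_def wfp_def N_def intro!: mult_nonneg_nonneg add_nonneg_nonneg harm_nonneg)
    then show "A * real (clock \<tau>) \<le> J \<tau>" unfolding J_def using E by linarith
  next
    fix \<tau> assume I: "I \<tau>" and "\<not> bval (NLess (NLit 0) (nreg 13)) \<tau>"
    then have "nmem \<tau> 0 13 = 0" by simp
    then have "J \<tau> = pot d \<tau> + E" by (simp add: J_def Pg_def Pc_def light_def harm_expand)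
    then show "f \<tau> \<le> ennreal (J \<tau>)" using f I by (simp add: I_def)
  next
    fix \<tau> assume "I \<tau>" "bval (NLess (NLit 0) (nreg 13)) \<tau>"
    then show "ewp (exec L pivot_step \<tau>) (\<lambda>\<tau>. post I J (tick \<tau>)) \<le> ennreal (J \<tau>)"
      by (intro ewp_pivot_step[OF _ _ _ _ x E _ _ W_def I_def J_def]) (auto simp: I_def Pg_def Pc_def fun_eq_iff)
  qed
  also have "J (tick \<sigma>) = pot (d + Pg N) \<sigma> + Pc N + A * (1 + 30 * (1 + (real K)\<^sup>2 * W) * harm N) + E"
    using \<sigma> by (simp add: J_def N_def algebra_simps)
  finally show ?thesis
    unfolding pivot_loop_def
    using full[of "\<lambda>u. w v x u * g u"] full[of "\<lambda>u. w v x u * gain u"] by (simp add: Pg_def Pc_def W_def N_def)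
qed

text \<open>The heavy loop runs through all of \<open>H\<close>, but nodes that are no in-neighbours
  of \<open>v\<close> have share 0; so it and the pivot loop together cover each share once.\<close>

lemma sum_w_heavy:
  "(\<Sum>u\<in>H. w v x u * f u) + (\<Sum>u\<in>in_nbs G v - H. w v x u * f u) = (\<Sum>u\<in>V. w v x u * f u)"
proof -
  have "(\<Sum>u\<in>V. w v x u * f u) = (\<Sum>u\<in>H. w v x u * f u) + (\<Sum>u\<in>V - H. w v x u * f u)"
    using sum.subset_diff[OF H finite_V, of "\<lambda>u. w v x u * f u"] by simp
  also have "(\<Sum>u\<in>V - H. w v x u * f u) = (\<Sum>u\<in>in_nbs G v - H. w v x u * f u)"
    using in_nbs_subset[of v] by (intro sum.mono_neutral_right) (auto simp: w_def step_prob_def in_nbs_iff)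
  finally show ?thesis by simp
qed

text \<open>The entry of \<open>v\<close> has just been popped, so \<open>wf\<close> is assumed only
  for the state with the residue at \<open>v\<close> cleared. The error keeps its mean, because
  \<open>visits_last_step\<close> splits \<open>g v * x\<close> into the amount credited to the
  accumulator if \<open>v = s\<close> and the shares of the in-neighbours. Time and variance are
  paid by \<open>c v * x\<close>.\<close>

lemma ewp_push_node:
  assumes wf: "wf' \<sigma>" and wf'_def: "wf' = (\<lambda>\<sigma>. wf (rstore 1 v 0 \<sigma>))" and v: "v \<in> V" "nmem \<sigma> 0 12 = v"
    and x: "rmem \<sigma> 0 5 = x" "rmem \<sigma> 1 v = x" "1 \<le> x * real K"
    and E: "0 \<le> E"
    and f: "\<And>\<tau>. wf \<tau> \<Longrightarrow> f (tick \<tau>) \<le> ennreal (pot 0 (tick \<tau>) + E)"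
  shows "ewp (exec L push_node \<sigma>) (\<lambda>\<tau>. f (tick \<tau>)) \<le> ennreal (pot 0 \<sigma> - 15 * A + E)"
proof -
  have x_pos: "0 < x" using x(3) K by (metis less_eq_real_def mult_nonpos_nonneg not_le not_one_le_zero of_nat_0_le_iff order_trans)
  then have x0: "0 \<le> x" by simp
  define Hg where "Hg = (\<Sum>u\<in>H. w v x u * g u)"
  define Dg where "Dg = (\<Sum>u\<in>in_nbs G v - H. w v x u * g u)"
  define Hc where "Hc = (\<Sum>u\<in>H. w v x u * c u)"
  define Dc where "Dc = (\<Sum>u\<in>in_nbs G v - H. w v x u * gain u)"
  define W where "W = (\<Sum>u\<in>in_nbs G v. w v x u)"
  define R where "R = A * (1 + 30 * (1 + (real K)\<^sup>2 * W) * harm (card (in_nbs G v)))"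
  define \<sigma>1 where "\<sigma>1 = tick (rstore 1 v 0 \<sigma>)"
  define \<sigma>2 where "\<sigma>2 = (if v = s then tick (rstore 0 0 (rmem \<sigma>1 0 0 + x) (tick \<sigma>1)) else tick (tick \<sigma>1))"
  define \<sigma>3 where "\<sigma>3 = tick (rstore 0 5 ((1 - \<alpha>) * x) \<sigma>2)"
  have W0: "0 \<le> W" unfolding W_def by (intro sum_nonneg w_nonneg x0)
  have R0: "0 \<le> R" unfolding R_def using A_pos W0 by (auto intro!: mult_nonneg_nonneg add_nonneg_nonneg harm_nonneg)
  have Dc0: "0 \<le> Dc"
    unfolding Dc_def using in_nbs_subset by (auto intro!: sum_nonneg mult_nonneg_nonneg w_nonneg x0 gain_nonneg)
  have wf1: "wf \<sigma>1" using wf by (simp add: \<sigma>1_def wf'_def)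
  have wf3: "wfp v x \<sigma>3" using wf1 v(2) unfolding \<sigma>3_def \<sigma>2_def wfp_def by (simp add: \<sigma>1_def[symmetric]) (simp add: \<sigma>1_def)
  define F where "F = (\<lambda>\<tau>. f (tick \<tau>))"
  define Q where "Q = (\<lambda>\<tau>. ewp (exec L pivot_loop (tick (nstore 0 13 (length (in_list L (nmem \<tau> 0 12))) \<tau>))) F)"
  have pivot: "Q \<tau> \<le> ennreal (pot (0 + Dg) \<tau> + (Dc + R + 2 * A + E))" if "wfp v x \<tau>" for \<tau>
  proof -
    define \<tau>1 where "\<tau>1 = tick (nstore 0 13 (card (in_nbs G v)) \<tau>)"
    have "Q \<tau> = ewp (exec L pivot_loop \<tau>1) F"
      using that by (simp add: Q_def \<tau>1_def wfp_def in_sorted_list)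
    also have "\<dots> \<le> ennreal (pot (0 + Dg) \<tau>1 + Dc + R + (A + E))"
      unfolding Dg_def Dc_def R_def W_def
    proof (rule ewp_pivot_loop)
      fix \<tau>' assume "wfp v x \<tau>'"
      then show "F \<tau>' \<le> ennreal (pot 0 \<tau>' + (A + E))" using f[of \<tau>'] by (simp add: F_def wfp_def add.assoc)
    qed (use that x_pos A_pos E in \<open>simp_all add: \<tau>1_def\<close>)
    finally show ?thesis by (simp add: \<tau>1_def algebra_simps)
  qed
  have "ewp (exec L heavy_loop \<sigma>3) Q
    \<le> ennreal (pot (0 + Dg + Hg) \<sigma>3 + Hc + A * (15 * real nh + 2) + (Dc + R + 2 * A + E))"
    unfolding Hg_def Hc_def
    by (rule ewp_heavy_loop[OF wf3 x0]) (use pivot Dc0 R0 A_pos E in auto)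
  also have "\<dots> \<le> ennreal (pot 0 \<sigma> - 15 * A + E)"
  proof (rule ennreal_leI)
    have upd: "(rmem \<sigma> 1)(v := 0) = (rmem \<sigma> 1)(v := rmem \<sigma> 1 v + - x)" using x by simp
    have sums: "(\<Sum>u\<in>V. h u * ((rmem \<sigma> 1)(v := 0)) u) = (\<Sum>u\<in>V. h u * rmem \<sigma> 1 u) - h v * x" for h
      unfolding upd sum_fun_upd_add[OF v(1)] by simp
    have "(\<Sum>u\<in>V. w v x u * g u) = x * (g v - of_bool (s = v))"
      using visits_last_step[OF s v(1)] by (simp add: w_def sum_distrib_left mult_ac)
    then have HDg: "Hg + Dg = x * (g v - of_bool (s = v))"
      unfolding Hg_def Dg_def sum_w_heavy .
    have err: "err \<sigma>3 + (Dg + Hg) = err \<sigma>"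
      using HDg sums[of g] by (auto simp: err_def \<sigma>3_def \<sigma>2_def \<sigma>1_def algebra_simps)
    have pot3: "pot (0 + Dg + Hg) \<sigma>3 = pot 0 \<sigma> + A * 4 - c v * x"
    proof -
      have "pot (0 + Dg + Hg) \<sigma>3 = A * real (clock \<sigma>3) + A * 6 * real (nmem \<sigma>3 0 11) + (\<Sum>u\<in>V. c u * rmem \<sigma>3 1 u) + B * (err \<sigma>3 + (Dg + Hg))\<^sup>2"
        by (simp add: pot_def)
      also have "\<dots> = pot 0 \<sigma> + A * 4 - c v * x"
        unfolding err using sums[of c] by (auto simp: pot_def \<sigma>3_def \<sigma>2_def \<sigma>1_def algebra_simps)
      finally show ?thesis .
    qed
    define hn where "hn = (harm (card V) :: real)"
    have hn: "harm (card (in_nbs G v)) \<le> hn" "0 \<le> hn" unfolding hn_def by (auto intro!: harm_mono card_in_nbs_le harm_nonneg)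
    have Wsum: "W = x * (\<Sum>u\<in>V. step_prob u v)"
    proof -
      have "W = (\<Sum>u\<in>V. w v x u)"
        unfolding W_def using in_nbs_subset[of v]
        by (intro sum.mono_neutral_left) (auto simp: w_def step_prob_def in_nbs_iff)
      then show ?thesis by (simp add: w_def sum_distrib_left mult.commute)
    qed
    have HDc: "Hc + Dc = x * (\<Sum>u\<in>V. step_prob u v * (c u + of_bool (u \<notin> H) * (B / (real K)\<^sup>2) * (g u)\<^sup>2))"
    proof -
      have "Hc = (\<Sum>u\<in>H. w v x u * (c u + of_bool (u \<notin> H) * (B / (real K)\<^sup>2) * (g u)\<^sup>2))"
        unfolding Hc_def by (intro sum.cong) auto
      moreover have "Dc = (\<Sum>u\<in>in_nbs G v - H. w v x u * (c u + of_bool (u \<notin> H) * (B / (real K)\<^sup>2) * (g u)\<^sup>2))"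
        unfolding Dc_def gain_def by (intro sum.cong) auto
      ultimately have "Hc + Dc = (\<Sum>u\<in>V. w v x u * (c u + of_bool (u \<notin> H) * (B / (real K)\<^sup>2) * (g u)\<^sup>2))"
        by (simp only: sum_w_heavy)
      then show ?thesis
        unfolding w_def sum_distrib_left by (simp only: mult_ac)
    qed
    have "x * (A * 30 * real K * (real nh + hn + 1)
      + (\<Sum>u\<in>V. step_prob u v * (c u + A * 30 * hn * (real K)\<^sup>2
          + of_bool (u \<notin> H) * (B / (real K)\<^sup>2) * (g u)\<^sup>2))) \<le> x * c v"
      using c_ge[OF v(1)] x0 unfolding hn_def by (intro mult_left_mono)
    moreover have "x * (\<Sum>u\<in>V. step_prob u v * (c u + A * 30 * hn * (real K)\<^sup>2
          + of_bool (u \<notin> H) * (B / (real K)\<^sup>2) * (g u)\<^sup>2)) = Hc + Dc + A * 30 * hn * (real K)\<^sup>2 * W"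
      unfolding HDc Wsum by (simp add: distrib_left sum.distrib sum_distrib_left mult_ac)
    \<comment> \<open>The pushed residue is at least \<open>1 / K\<close>, which turns costs per
      push into costs per unit of residue.\<close>
    moreover have "A * (15 * real nh + 30 * hn + 30) * 1 \<le> A * (30 * (real nh + hn + 1)) * (x * real K)"
      using A_pos hn x(3) by (intro mult_mono) auto
    moreover have "R \<le> A * (1 + 30 * (1 + (real K)\<^sup>2 * W) * hn)"
      unfolding R_def using A_pos W0 hn by (intro mult_left_mono add_left_mono) auto
    ultimately have "Hc + A * (15 * real nh + 2) + (Dc + R + 2 * A) + A * 4 + 15 * A \<le> c v * x"
      using A_pos by (simp add: algebra_simps)
    then show "pot (0 + Dg + Hg) \<sigma>3 + Hc + A * (15 * real nh + 2) + (Dc + R + 2 * A + E) \<le> pot 0 \<sigma> - 15 * A + E"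
      unfolding pot3 by linarith
  qed
  finally have main: "ewp (exec L heavy_loop \<sigma>3) Q
    \<le> ennreal (pot 0 \<sigma> - 15 * A + E)" .
  have "ewp (exec L push_node \<sigma>) F = ewp (exec L heavy_loop \<sigma>3) Q"
    unfolding Q_def using v x wf
    by (simp add: push_node_def ewp_simps \<sigma>3_def \<sigma>2_def \<sigma>1_def wf'_def wf_def)
  with main show ?thesis by (simp add: F_def)
qed

text \<open>The credit of 6 of the popped entry pays for skipping it: three assignments, the test,
  the skip and the loop guard.\<close>

lemma ewp_backward_step:
  assumes wf: "wf \<sigma>" and sp: "0 < nmem \<sigma> 0 11" and E: "0 \<le> E"
  shows "ewp (exec L backward_step \<sigma>) (\<lambda>\<tau>. post wf (\<lambda>\<sigma>. pot 0 \<sigma> + E) (tick \<tau>)) \<le> ennreal (pot 0 \<sigma> + E)"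
proof -
  define j where "j = nmem \<sigma> 0 11 - 1"
  define v where "v = nmem \<sigma> 3 j"
  define x where "x = rmem \<sigma> 1 v"
  have j: "nmem \<sigma> 0 11 = Suc j" using sp by (simp add: j_def)
  have v: "v \<in> V" using wf j by (simp add: wf_def v_def)
  define \<sigma>1 where "\<sigma>1 = tick (tick (rstore 0 5 x (tick (nstore 0 12 v (tick (nstore 0 11 j \<sigma>))))))"
  have pot1: "pot 0 \<sigma>1 = pot 0 \<sigma> - 2 * A"
    by (simp add: \<sigma>1_def pot_def err_def j algebra_simps)
  have fields: "nmem \<sigma>1 0 0 = s" "nmem \<sigma>1 0 2 = K" "nmem \<sigma>1 0 10 = nh" "nmem \<sigma>1 1 = hl" "nmem \<sigma>1 2 = mk"
    "rmem \<sigma>1 0 1 = \<alpha>" "nmem \<sigma>1 0 11 = j" "nmem \<sigma>1 3 = nmem \<sigma> 3" "rmem \<sigma>1 1 = rmem \<sigma> 1"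
    "nmem \<sigma>1 0 12 = v" "rmem \<sigma>1 0 5 = x"
    using wf by (simp_all add: \<sigma>1_def wf_def)
  have res: "0 \<le> rmem \<sigma> 1 u" for u using wf by (simp add: wf_def)
  have stack: "nmem \<sigma> 3 i \<in> V" if "i < j" for i using wf j that by (simp add: wf_def)
  \<comment> \<open>Only other nodes need a remaining entry: \<open>v\<close> itself is either below
    the threshold or about to be cleared.\<close>
  have cover: "\<exists>i<j. nmem \<sigma> 3 i = u" if u: "u \<in> V" "u \<noteq> v" "1 \<le> rmem \<sigma> 1 u * real K" for u
  proof -
    obtain i where i: "i < Suc j" "nmem \<sigma> 3 i = u" using wf u j by (auto simp: wf_def)
    then have "i \<noteq> j" using u by (auto simp: v_def)
    with i show ?thesis by (intro exI[of _ i]) auto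
  qed
  have eq: "ewp (exec L backward_step \<sigma>) F = (if x * real K < 1 then F (tick \<sigma>1) else ewp (exec L push_node \<sigma>1) F)" for F
    using wf by (simp add: backward_step_def ewp_simps \<sigma>1_def j wf_def x_def v_def)
  show ?thesis
  proof (cases "x * real K < 1")
    case True
    have "wf \<sigma>1"
      unfolding wf_def fields
    proof (intro conjI ballI impI)
      fix u assume u: "u \<in> V" "1 \<le> rmem \<sigma> 1 u * real K"
      then show "\<exists>i<j. nmem \<sigma> 3 i = u" using cover[OF u(1) _ u(2)] True by (cases "u = v") (auto simp: x_def)
    qed (use res stack in auto)
    then show ?thesis using True pot1 by (simp add: eq post_def)
  next
    case False
    have wf': "wf (rstore 1 v 0 \<sigma>1)"
      unfolding wf_def
    proof (intro conjI ballI impI)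
      fix u assume u: "u \<in> V" "1 \<le> rmem (rstore 1 v 0 \<sigma>1) 1 u * real K"
      then have "u \<noteq> v" by auto
      with u cover[of u] show "\<exists>i<nmem (rstore 1 v 0 \<sigma>1) 0 11. nmem (rstore 1 v 0 \<sigma>1) 3 i = u" by (simp add: fields[unfolded One_nat_def])
    qed (use res stack in \<open>simp_all add: fields[unfolded One_nat_def]\<close>)
    have "ewp (exec L push_node \<sigma>1) (\<lambda>\<tau>. post wf (\<lambda>\<sigma>. pot 0 \<sigma> + E) (tick \<tau>)) \<le> ennreal (pot 0 \<sigma>1 - 15 * A + E)"
      by (rule ewp_push_node[OF _ refl v fields(10,11) _ _ E]) (use wf' False in \<open>auto simp: fields[unfolded One_nat_def] x_def post_def\<close>)
    also have "\<dots> \<le> ennreal (pot 0 \<sigma> + E)" using pot1 A_pos by (intro ennreal_leI) simp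
    finally show ?thesis using False by (simp add: eq)
  qed
qed

lemma ewp_backward_loop:
  assumes "wf \<sigma>" "0 \<le> E"
    and f: "\<And>\<tau>. wf \<tau> \<Longrightarrow> nmem \<tau> 0 11 = 0 \<Longrightarrow> f \<tau> \<le> ennreal (pot 0 \<tau> + E)"
  shows "ewp (exec L backward_loop \<sigma>) f \<le> ennreal (pot 0 \<sigma> + A + E)"
proof -
  have "ewp (exec L (While (NLess (NLit 0) (nreg 11)) backward_step) \<sigma>) f \<le> ennreal (pot 0 (tick \<sigma>) + E)"
  proof (rule ewp_while[where I = wf and J = "\<lambda>\<sigma>. pot 0 \<sigma> + E", OF A_pos])
    fix \<tau> assume wf: "wf \<tau>" and b: "bval (NLess (NLit 0) (nreg 11)) \<tau>"
    show "ewp (exec L backward_step \<tau>) (\<lambda>\<tau>. post wf (\<lambda>\<sigma>. pot 0 \<sigma> + E) (tick \<tau>)) \<le> ennreal (pot 0 \<tau> + E)"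
      by (rule ewp_backward_step[OF wf _ assms(2)]) (use b in simp)
  next
    fix \<tau> assume "wf \<tau>"
    then show "A * real (clock \<tau>) \<le> pot 0 \<tau> + E" using pot_ge[of \<tau> 0] assms(2) by simp
  qed (use assms in auto)
  then show ?thesis by (simp add: backward_loop_def)
qed

end

section \<open>The phases of the algorithm\<close>

text \<open>Dividing by the stopping probability of the endpoint turns endpoint probabilities into
  expected visits; the average over all walks is built into each increment.\<close>

definition estimate_step :: "nat \<Rightarrow> com" where
  "estimate_step C =
    walk ;;
    ask 8 (DegOut (nreg 5)) ;;
    Cond (NLess (NLit 0) (nreg 8)) (set_rreg 6 (rreg 1)) (set_rreg 6 (RNat (NLit 1))) ;;
    set_rreg 0 (RAdd (rreg 0) (RDiv (RCell 1 (nreg 5))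
      (RMul (rreg 6) (RMul (RNat (NLit C)) (RMul (RNat (nreg 2)) (RNat (nreg 2))))))) ;;
    incr 4"

definition estimate_loop :: "nat \<Rightarrow> com" where
  "estimate_loop C = set_nreg 4 (NLit 0) ;;
    While (RLess (RNat (nreg 4)) (RMul (RNat (NLit C)) (RMul (RNat (nreg 2)) (RNat (nreg 2))))) (estimate_step C)"

definition forward_step :: com where
  "forward_step =
    walk ;;
    Cond (NLess (NLit 0) (NCell 2 (nreg 5))) Skip
      (NSet 2 (nreg 5) (NLit 1) ;; NSet 1 (nreg 10) (nreg 5) ;; incr 10) ;;
    incr 4"

definition forward_loop :: "nat \<Rightarrow> com" where
  "forward_loop C = set_nreg 4 (NLit 0) ;;
    While (RLess (RNat (nreg 4)) (RMul (RNat (NLit C)) (RMul (RNat (nreg 2)) (RNat (nreg 3))))) forward_step"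

definition backward_init :: com where
  "backward_init =
    ask 8 (DegOut (nreg 1)) ;;
    Cond (NLess (NLit 0) (nreg 8)) (RSet 1 (nreg 1) (rreg 1)) (RSet 1 (nreg 1) (RNat (NLit 1))) ;;
    NSet 3 (NLit 0) (nreg 1) ;;
    set_nreg 11 (NLit 1) ;;
    set_rreg 0 (RNat (NLit 0))"

section \<open>Cost and variance of the final estimate\<close>

context ppr_algo
begin

text \<open>With \<open>N = C * (K * K)\<close> walks and residues of at most \<open>1 / K\<close>,
  an increment is at most \<open>1 / (\<alpha> * real K * N)\<close>, and its second moment is at
  most this times its mean \<open>\<mu> / N\<close>. Summing over the walks gives the last term. A
  walk costs 6 ticks beyond \<open>ewp_walk\<close>.\<close>

lemma ewp_estimate_loop:
  assumes \<sigma>: "nmem \<sigma> 0 0 = s" "nmem \<sigma> 0 2 = K" "rmem \<sigma> 0 1 = \<alpha>" "rmem \<sigma> 1 = r"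
    and s: "s \<in> V" and K: "0 < K" and C: "0 < C" and B: "0 \<le> B"
    and r: "\<And>u. u \<in> V \<Longrightarrow> 0 \<le> r u" "\<And>u. u \<in> V \<Longrightarrow> r u * real K \<le> 1"
    and \<mu>_def: "\<mu> = (\<Sum>u\<in>V. visits s u * r u)"
    and f: "\<And>\<tau>. f \<tau> \<le> ennreal (A * real (clock \<tau>) + B * (rmem \<tau> 0 0 - a)\<^sup>2)"
  shows "ewp (exec L (estimate_loop C) \<sigma>) f \<le>
    ennreal (A * (real (clock \<sigma>) + 2 + (9 + 6 / \<alpha>) * (real C * (real K)\<^sup>2))
      + B * ((rmem \<sigma> 0 0 + \<mu> - a)\<^sup>2 + \<mu> / (\<alpha> * real C * real K ^ 3)))"
proof -
  define N where "N = C * (K * K)"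
  have N0: "0 < N" using C K by (simp add: N_def)
  define \<kappa> where "\<kappa> = 9 + 6 / \<alpha>"
  have \<kappa>: "0 \<le> \<kappa>" using alpha_pos by (simp add: \<kappa>_def)
  define Y where "Y u = r u / (stop_prob u * real N)" for u
  define m where "m = \<mu> / real N"
  have m: "real N * m = \<mu>" using N0 by (simp add: m_def)
  define var where "var = \<mu> / (\<alpha> * real K * (real N)\<^sup>2)"
  have \<mu>: "0 \<le> \<mu>" unfolding \<mu>_def using s r by (auto intro!: sum_nonneg mult_nonneg_nonneg visits_nonneg)
  have var: "0 \<le> var" unfolding var_def using \<mu> alpha_pos by simp
  have Y_mean: "(\<Sum>u\<in>V. ppr \<alpha> G s u * Y u) = m"
    unfolding m_def \<mu>_def sum_divide_distrib
  proof (intro sum.cong refl)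
    fix u assume "u \<in> V"
    then show "ppr \<alpha> G s u * Y u = visits s u * r u / N"
      using s stop_prob_bounds(1)[of u] by (simp add: ppr_eq_visits Y_def)
  qed
  have Y: "0 \<le> Y u" "Y u \<le> 1 / (\<alpha> * real K * N)" if "u \<in> V" for u
  proof -
    show "0 \<le> Y u" unfolding Y_def using r(1)[OF that] stop_prob_bounds(1)[of u] by simp
    have "r u \<le> 1 / real K" using r(2)[OF that] K by (simp add: field_simps)
    then have "Y u \<le> (1 / real K) / (\<alpha> * N)"
      unfolding Y_def using r(1)[OF that] stop_prob_bounds(3)[of u] alpha_pos N0
      by (intro frac_le mult_right_mono) auto
    then show "Y u \<le> 1 / (\<alpha> * real K * N)" by (simp add: mult_ac)
  qed
  have Y_sq: "(\<Sum>u\<in>V. ppr \<alpha> G s u * (Y u)\<^sup>2) \<le> var"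
  proof -
    have "(\<Sum>u\<in>V. ppr \<alpha> G s u * (Y u)\<^sup>2) \<le> (\<Sum>u\<in>V. ppr \<alpha> G s u * Y u * (1 / (\<alpha> * real K * N)))"
    proof (rule sum_mono)
      fix u assume u: "u \<in> V"
      have "ppr \<alpha> G s u * Y u * Y u \<le> ppr \<alpha> G s u * Y u * (1 / (\<alpha> * real K * N))"
        using Y[OF u] ppr_nonneg by (intro mult_left_mono) auto
      then show "ppr \<alpha> G s u * (Y u)\<^sup>2 \<le> ppr \<alpha> G s u * Y u * (1 / (\<alpha> * real K * N))"
        by (simp add: power2_eq_square mult.assoc)
    qed
    also have "\<dots> = var"
      unfolding sum_distrib_right[symmetric] Y_mean by (simp add: var_def m_def power2_eq_square mult_ac)
    finally show ?thesis .
  qed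
  \<comment> \<open>The endpoint probabilities are only known to sum to at most 1. This suffices,
    since the part free of \<open>Y\<close> is nonnegative and the part linear in \<open>Y\<close>
    has an exactly known mean.\<close>
  have quad: "(\<Sum>u\<in>V. ppr \<alpha> G s u * (k + B * ((z + Y u)\<^sup>2 + l * var))) \<le> k + B * ((z + m)\<^sup>2 + (l + 1) * var)"
    if "0 \<le> k" "0 \<le> l" for k l z
  proof -
    have "(\<Sum>u\<in>V. ppr \<alpha> G s u * (k + B * ((z + Y u)\<^sup>2 + l * var))) =
      (k + B * (z\<^sup>2 + l * var)) * (\<Sum>u\<in>V. ppr \<alpha> G s u) + B * (2 * z * (\<Sum>u\<in>V. ppr \<alpha> G s u * Y u) + (\<Sum>u\<in>V. ppr \<alpha> G s u * (Y u)\<^sup>2))"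
      by (simp add: sum_distrib_left sum.distrib[symmetric] power2_eq_square algebra_simps)
    also have "\<dots> \<le> (k + B * (z\<^sup>2 + l * var)) * 1 + B * (2 * z * m + var)"
      unfolding Y_mean
    proof (intro add_mono)
      show "(k + B * (z\<^sup>2 + l * var)) * (\<Sum>u\<in>V. ppr \<alpha> G s u) \<le> (k + B * (z\<^sup>2 + l * var)) * 1"
        using that B var by (intro mult_left_mono sum_ppr_le_1) auto
      show "B * (2 * z * m + (\<Sum>u\<in>V. ppr \<alpha> G s u * (Y u)\<^sup>2)) \<le> B * (2 * z * m + var)"
        using B Y_sq by (intro mult_left_mono add_left_mono) auto
    qed
    also have "\<dots> \<le> k + B * ((z + m)\<^sup>2 + (l + 1) * var)"
      using B by (simp add: power2_eq_square algebra_simps)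
    finally show ?thesis .
  qed
  define I where "I = (\<lambda>\<tau>::state. nmem \<tau> 0 0 = s \<and> nmem \<tau> 0 2 = K \<and> rmem \<tau> 0 1 = \<alpha> \<and> rmem \<tau> 1 = r \<and> nmem \<tau> 0 4 \<le> N)"
  define J where "J = (\<lambda>\<tau>::state. A * real (clock \<tau>) + (A * \<kappa> * (real N - real (nmem \<tau> 0 4))
    + B * ((rmem \<tau> 0 0 + (real N - real (nmem \<tau> 0 4)) * m - a)\<^sup>2 + (real N - real (nmem \<tau> 0 4)) * var)))"
  define b where "b = RLess (RNat (nreg 4)) (RMul (RNat (NLit C)) (RMul (RNat (nreg 2)) (RNat (nreg 2))))"
  have b: "bval b \<tau> \<longleftrightarrow> nmem \<tau> 0 4 < N" if "I \<tau>" for \<tau>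
    using that by (simp add: b_def I_def N_def flip: of_nat_mult)
  define \<sigma>1 where "\<sigma>1 = tick (nstore 0 4 0 \<sigma>)"
  have "ewp (exec L (While b (estimate_step C)) \<sigma>1) f \<le> ennreal (J (tick \<sigma>1))"
  proof (rule ewp_while[where I = I, OF A_pos])
    show "I (tick \<sigma>1)" using \<sigma> by (simp add: I_def \<sigma>1_def)
  next
    fix \<tau> assume "I \<tau>"
    then show "A * real (clock \<tau>) \<le> J \<tau>"
      unfolding J_def using A_pos \<kappa> B var by (intro add_increasing2) (auto simp: I_def intro!: add_nonneg_nonneg mult_nonneg_nonneg)
  next
    fix \<tau> assume I: "I \<tau>" and "\<not> bval b \<tau>"
    then have "nmem \<tau> 0 4 = N" using b[OF I] by (simp add: I_def)
    then show "f \<tau> \<le> ennreal (J \<tau>)" using f[of \<tau>] by (simp add: J_def)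
  next
    fix \<tau> assume I: "I \<tau>" and "bval b \<tau>"
    then have lt: "nmem \<tau> 0 4 < N" using b by simp
    define l where "l = real N - real (nmem \<tau> 0 4) - 1"
    have l: "0 \<le> l" using lt by (simp add: l_def)
    define z where "z = rmem \<tau> 0 0 + l * m - a"
    define F where "F u = A * (6 + \<kappa> * l) + B * ((z + Y u)\<^sup>2 + l * var)" for u
    have "ewp (exec L (estimate_step C) \<tau>) (\<lambda>\<tau>. post I J (tick \<tau>)) \<le>
      ennreal (A * (real (clock \<tau>) + 3 + 6 / \<alpha>) + (\<Sum>u\<in>V. ppr \<alpha> G s u * F u))"
      unfolding estimate_step_def ewp_Seq[of L walk]
    proof (rule ewp_walk[where s = s])
      fix u assume "u \<in> V"
      show "0 \<le> F u" unfolding F_def using A_pos B \<kappa> l var by simp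
    next
      fix \<tau>1 assume t: "agree_but {5,6,7,8,9} \<tau> \<tau>1" "nmem \<tau>1 0 5 \<in> V"
      define u where "u = nmem \<tau>1 0 5"
      define \<tau>2 where "\<tau>2 = tick (rstore 0 6 (stop_prob u) (tick (tick (nstore 0 8 (card (out_nbs G u)) \<tau>1))))"
      define \<tau>3 where "\<tau>3 = tick (tick (nstore 0 4 (Suc (nmem \<tau> 0 4)) (tick (rstore 0 0 (rmem \<tau> 0 0 + Y u) \<tau>2))))"
      have t1: "nmem \<tau>1 0 0 = s" "nmem \<tau>1 0 2 = K" "rmem \<tau>1 0 1 = \<alpha>" "rmem \<tau>1 1 = r" "nmem \<tau>1 0 4 = nmem \<tau> 0 4"
        "rmem \<tau>1 0 0 = rmem \<tau> 0 0"
        using t I by (auto simp: agree_but_def I_def)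
      have "I \<tau>3" using t1 lt by (simp add: I_def \<tau>3_def \<tau>2_def)
      moreover have "J \<tau>3 = A * real (clock \<tau>1) + F u"
        by (simp add: J_def \<tau>3_def \<tau>2_def F_def z_def l_def algebra_simps)
      moreover have "ewp (exec L (ask 8 (DegOut (nreg 5)) ;;
        Cond (NLess (NLit 0) (nreg 8)) (set_rreg 6 (rreg 1)) (set_rreg 6 (RNat (NLit 1))) ;;
        set_rreg 0 (RAdd (rreg 0) (RDiv (RCell 1 (nreg 5))
        (RMul (rreg 6) (RMul (RNat (NLit C)) (RMul (RNat (nreg 2)) (RNat (nreg 2))))))) ;;
        incr 4) \<tau>1) (\<lambda>\<tau>. post I J (tick \<tau>)) = post I J \<tau>3"
        using t1[unfolded One_nat_def]
        by (simp add: ewp_simps out_list \<tau>3_def \<tau>2_def Y_def N_def stop_prob_def card_gt_0_iff u_def[symmetric] mult_ac)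
      ultimately show "ewp (exec L (ask 8 (DegOut (nreg 5)) ;;
        Cond (NLess (NLit 0) (nreg 8)) (set_rreg 6 (rreg 1)) (set_rreg 6 (RNat (NLit 1))) ;;
        set_rreg 0 (RAdd (rreg 0) (RDiv (RCell 1 (nreg 5))
        (RMul (rreg 6) (RMul (RNat (NLit C)) (RMul (RNat (nreg 2)) (RNat (nreg 2))))))) ;;
        incr 4) \<tau>1) (\<lambda>\<tau>. post I J (tick \<tau>)) \<le> ennreal (A * real (clock \<tau>1) + F (nmem \<tau>1 0 5))"
        by (simp add: post_def u_def)
    qed (use I s in \<open>auto simp: I_def\<close>)
    also have "\<dots> \<le> ennreal (J \<tau>)"
    proof (rule ennreal_leI)
      have "(\<Sum>u\<in>V. ppr \<alpha> G s u * F u) \<le> A * (6 + \<kappa> * l) + B * ((z + m)\<^sup>2 + (l + 1) * var)"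
        unfolding F_def using A_pos \<kappa> l by (intro quad) auto
      also have "z + m = rmem \<tau> 0 0 + (l + 1) * m - a" by (simp add: z_def algebra_simps)
      also have "l + 1 = real N - real (nmem \<tau> 0 4)" by (simp add: l_def)
      finally show "A * (real (clock \<tau>) + 3 + 6 / \<alpha>) + (\<Sum>u\<in>V. ppr \<alpha> G s u * F u) \<le> J \<tau>"
        by (simp add: J_def l_def \<kappa>_def algebra_simps)
    qed
    finally show "ewp (exec L (estimate_step C) \<tau>) (\<lambda>\<tau>. post I J (tick \<tau>)) \<le> ennreal (J \<tau>)" .
  qed
  also have "J (tick \<sigma>1) = A * (real (clock \<sigma>) + 2 + \<kappa> * real N) + B * ((rmem \<sigma> 0 0 + \<mu> - a)\<^sup>2 + N * var)"
    using m by (simp add: J_def \<sigma>1_def algebra_simps)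
  also have "N * var = \<mu> / (\<alpha> * real C * real K ^ 3)"
    using N0 by (simp add: var_def power2_eq_square power3_eq_cube N_def field_simps)
  finally show ?thesis
    by (simp add: estimate_loop_def ewp_simps \<sigma>1_def b_def N_def \<kappa>_def power2_eq_square)
qed

end

section \<open>Discovery of heavy nodes, and the backward phase as a whole\<close>

context ppr_algo
begin

definition heavy_list :: "state \<Rightarrow> bool" where
  "heavy_list \<sigma> \<longleftrightarrow> inj_on (nmem \<sigma> 1) {..<nmem \<sigma> 0 10}
    \<and> nmem \<sigma> 1 ` {..<nmem \<sigma> 0 10} = {u. nmem \<sigma> 2 u \<noteq> 0} \<and> {u. nmem \<sigma> 2 u \<noteq> 0} \<subseteq> V"

text \<open>With \<open>j\<close> walks left, an unmarked \<open>w\<close> still costs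
  \<open>\<kappa> w\<close> with probability at most \<open>(1 - ppr \<alpha> G s w) ^ j\<close>,
  whatever else is marked. \<open>f\<close> stands for the cost of the later phases, whose bound
  depends on the marks only through the weighted sum over unmarked nodes.\<close>

lemma ewp_forward_loop:
  assumes \<sigma>: "nmem \<sigma> 0 0 = s" "nmem \<sigma> 0 1 = t" "nmem \<sigma> 0 2 = K" "nmem \<sigma> 0 3 = l" "rmem \<sigma> 0 1 = \<alpha>" "rmem \<sigma> 1 = (\<lambda>_. 0)"
      "nmem \<sigma> 0 10 = 0" "nmem \<sigma> 2 = (\<lambda>_. 0)"
    and s: "s \<in> V" and \<kappa>: "\<And>w. w \<in> V \<Longrightarrow> 0 \<le> \<kappa> w" and E: "0 \<le> E"
    and f: "\<And>\<tau>. nmem \<tau> 0 0 = s \<Longrightarrow> nmem \<tau> 0 1 = t \<Longrightarrow> nmem \<tau> 0 2 = K \<Longrightarrow> rmem \<tau> 0 1 = \<alpha> \<Longrightarrow>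
      rmem \<tau> 1 = (\<lambda>_. 0) \<Longrightarrow> heavy_list \<tau> \<Longrightarrow> nmem \<tau> 0 10 \<le> C * (K * l) \<Longrightarrow>
      f \<tau> \<le> ennreal (A * real (clock \<tau>) + E + (\<Sum>w\<in>V. of_bool (nmem \<tau> 2 w = 0) * \<kappa> w))"
  shows "ewp (exec L (forward_loop C) \<sigma>) f \<le>
    ennreal (A * (real (clock \<sigma>) + 2 + (9 + 6 / \<alpha>) * real (C * (K * l))) + E
      + (\<Sum>w\<in>V. \<kappa> w * (1 - ppr \<alpha> G s w) ^ (C * (K * l))))"
proof -
  define M where "M = C * (K * l)"
  define k where "k = 9 + 6 / \<alpha>"
  have k: "0 \<le> k" using alpha_pos by (simp add: k_def)
  define q where "q w = 1 - ppr \<alpha> G s w" for w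
  have q: "0 \<le> q w" for w using ppr_le_1 by (simp add: q_def)
  define S where "S mk i = (\<Sum>w\<in>V. of_bool (mk w = (0::nat)) * (\<kappa> w * q w ^ (M - i)))" for mk i
  have S: "0 \<le> S mk i" for mk i
    unfolding S_def using \<kappa> q by (intro sum_nonneg mult_nonneg_nonneg) auto
  define I where "I = (\<lambda>\<tau>::state. nmem \<tau> 0 0 = s \<and> nmem \<tau> 0 1 = t \<and> nmem \<tau> 0 2 = K \<and> nmem \<tau> 0 3 = l \<and> rmem \<tau> 0 1 = \<alpha>
    \<and> rmem \<tau> 1 = (\<lambda>_. 0) \<and> heavy_list \<tau> \<and> nmem \<tau> 0 10 \<le> nmem \<tau> 0 4 \<and> nmem \<tau> 0 4 \<le> M)"
  define J where "J = (\<lambda>\<tau>::state. A * real (clock \<tau>) + (A * k * (real M - real (nmem \<tau> 0 4)) + E + S (nmem \<tau> 2) (nmem \<tau> 0 4)))"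
  define b where "b = RLess (RNat (nreg 4)) (RMul (RNat (NLit C)) (RMul (RNat (nreg 2)) (RNat (nreg 3))))"
  have b: "bval b \<tau> \<longleftrightarrow> nmem \<tau> 0 4 < M" if "I \<tau>" for \<tau>
    using that by (simp add: b_def I_def M_def flip: of_nat_mult)
  define \<sigma>1 where "\<sigma>1 = tick (nstore 0 4 0 \<sigma>)"
  have "ewp (exec L (While b forward_step) \<sigma>1) f \<le> ennreal (J (tick \<sigma>1))"
  proof (rule ewp_while[where I = I, OF A_pos])
    show "I (tick \<sigma>1)" using \<sigma> by (simp add: I_def \<sigma>1_def heavy_list_def)
  next
    fix \<tau> assume "I \<tau>"
    then show "A * real (clock \<tau>) \<le> J \<tau>"
      unfolding J_def using A_pos k E S by (intro add_increasing2) (auto simp: I_def intro!: add_nonneg_nonneg mult_nonneg_nonneg)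
  next
    fix \<tau> assume I: "I \<tau>" and "\<not> bval b \<tau>"
    then have "nmem \<tau> 0 4 = M" using b[OF I] by (simp add: I_def)
    then show "f \<tau> \<le> ennreal (J \<tau>)" using f[of \<tau>] I by (simp add: J_def I_def S_def M_def add.assoc)
  next
    fix \<tau> assume I: "I \<tau>" and "bval b \<tau>"
    define i where "i = nmem \<tau> 0 4"
    have i: "nmem \<tau> 0 4 = i" "i < M" using b[OF I] \<open>bval b \<tau>\<close> by (simp_all add: i_def)
    define mk where "mk = nmem \<tau> 2"
    define F where "F u = A * (6 + k * (real M - real i - 1)) + E + S (mk(u := 1)) (Suc i)" for u
    have F0: "0 \<le> A * (6 + k * (real M - real i - 1))" using A_pos k i by simp
    have "ewp (exec L forward_step \<tau>) (\<lambda>\<tau>. post I J (tick \<tau>)) \<le>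
      ennreal (A * (real (clock \<tau>) + 3 + 6 / \<alpha>) + (\<Sum>u\<in>V. ppr \<alpha> G s u * F u))"
      unfolding forward_step_def ewp_Seq[of L walk]
    proof (rule ewp_walk[where s = s])
      fix u assume "u \<in> V"
      show "0 \<le> F u" unfolding F_def using F0 E S by simp
    next
      fix \<tau>1 assume t: "agree_but {5,6,7,8,9} \<tau> \<tau>1" and uV: "nmem \<tau>1 0 5 \<in> V"
      define u where "u = nmem \<tau>1 0 5"
      have t1: "nmem \<tau>1 0 0 = s" "nmem \<tau>1 0 1 = t" "nmem \<tau>1 0 2 = K" "nmem \<tau>1 0 3 = l" "rmem \<tau>1 0 1 = \<alpha>" "rmem \<tau>1 1 = (\<lambda>_. 0)"
        "nmem \<tau>1 0 4 = i" "nmem \<tau>1 2 = mk" "nmem \<tau>1 0 10 \<le> i" "heavy_list \<tau>1" "nmem \<tau>1 0 5 = u"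
        using t I by (auto simp: agree_but_def I_def i_def mk_def heavy_list_def u_def)
      define \<tau>2 where "\<tau>2 = (if 0 < mk u then tick (tick \<tau>1) else
        tick (nstore 0 10 (Suc (nmem \<tau>1 0 10)) (tick (nstore 1 (nmem \<tau>1 0 10) u (tick (nstore 2 u 1 (tick \<tau>1)))))))"
      define \<tau>3 where "\<tau>3 = tick (tick (nstore 0 4 (Suc i) \<tau>2))"
      have "heavy_list \<tau>3"
      proof (cases "0 < mk u")
        case True
        then show ?thesis using t1 by (simp add: heavy_list_def \<tau>3_def \<tau>2_def)
      next
        case False
        define nh where "nh = nmem \<tau>1 0 10"
        define hl where "hl = nmem \<tau>1 1"
        have h: "inj_on hl {..<nh}" "hl ` {..<nh} = {u. mk u \<noteq> 0}" "{u. mk u \<noteq> 0} \<subseteq> V"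
          using t1 by (auto simp: heavy_list_def nh_def hl_def)
        have img: "(hl(nh := u)) ` {..<nh} = hl ` {..<nh}" by (intro image_cong) auto
        have "u \<notin> hl ` {..<nh}" using h False by simp
        then have "inj_on (hl(nh := u)) {..<Suc nh}"
          using h img by (simp add: lessThan_Suc inj_on_fun_updI)
        moreover have "(hl(nh := u)) ` {..<Suc nh} = {w. (mk(u := 1)) w \<noteq> 0}"
          using h img by (auto simp: lessThan_Suc)
        moreover have "{w. (mk(u := 1)) w \<noteq> 0} \<subseteq> V" using h uV u_def by auto
        ultimately show ?thesis
          using False t1(8) by (simp add: heavy_list_def \<tau>3_def \<tau>2_def nh_def hl_def)
      qed
      then have "I \<tau>3" using t1 i by (simp add: I_def \<tau>3_def \<tau>2_def)
      moreover have "J \<tau>3 \<le> A * real (clock \<tau>1) + F u"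
      proof -
        have "S (nmem \<tau>3 2) (Suc i) = S (mk(u := 1)) (Suc i)"
          unfolding S_def using t1 by (intro sum.cong) (auto simp: \<tau>3_def \<tau>2_def)
        moreover have "A * real (clock \<tau>3) \<le> A * (real (clock \<tau>1) + 6)"
          using A_pos by (intro mult_left_mono) (auto simp: \<tau>3_def \<tau>2_def)
        moreover have "nmem \<tau>3 0 4 = Suc i" by (simp add: \<tau>3_def)
        ultimately show ?thesis by (simp add: J_def F_def algebra_simps)
      qed
      moreover have "ewp (exec L (Cond (NLess (NLit 0) (NCell 2 (nreg 5))) Skip
          (NSet 2 (nreg 5) (NLit 1) ;; NSet 1 (nreg 10) (nreg 5) ;; incr 10) ;; incr 4) \<tau>1)
          (\<lambda>\<tau>. post I J (tick \<tau>)) = post I J \<tau>3"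
        using t1 by (simp add: ewp_simps \<tau>3_def \<tau>2_def)
      ultimately show "ewp (exec L (Cond (NLess (NLit 0) (NCell 2 (nreg 5))) Skip
          (NSet 2 (nreg 5) (NLit 1) ;; NSet 1 (nreg 10) (nreg 5) ;; incr 10) ;; incr 4) \<tau>1)
          (\<lambda>\<tau>. post I J (tick \<tau>)) \<le> ennreal (A * real (clock \<tau>1) + F (nmem \<tau>1 0 5))"
        by (simp add: post_def u_def ennreal_leI)
    qed (use I s in \<open>auto simp: I_def\<close>)
    also have "\<dots> \<le> ennreal (J \<tau>)"
    proof (rule ennreal_leI)
      define e where "e = A * (6 + k * (real M - real i - 1)) + E"
      have e: "0 \<le> e" using F0 E by (simp add: e_def)
      have "(\<Sum>u\<in>V. ppr \<alpha> G s u * F u) = e * (\<Sum>u\<in>V. ppr \<alpha> G s u) + (\<Sum>u\<in>V. ppr \<alpha> G s u * S (mk(u := 1)) (Suc i))"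
      proof -
        have "F u = e + S (mk(u := 1)) (Suc i)" for u by (simp add: F_def e_def)
        then show ?thesis by (simp add: distrib_left sum.distrib sum_distrib_left mult.commute)
      qed
      also have "(\<Sum>u\<in>V. ppr \<alpha> G s u * S (mk(u := 1)) (Suc i)) =
        (\<Sum>w\<in>V. of_bool (mk w = 0) * (\<kappa> w * q w ^ (M - Suc i)) * (\<Sum>u\<in>V. ppr \<alpha> G s u * of_bool (u \<noteq> w)))"
        unfolding S_def sum_distrib_left
        by (subst sum.swap) (auto intro!: sum.cong)
      also have "\<dots> \<le> (\<Sum>w\<in>V. of_bool (mk w = 0) * (\<kappa> w * q w ^ (M - Suc i)) * q w)"
      proof (intro sum_mono mult_left_mono)
        fix w assume w: "w \<in> V"
        have "(\<Sum>u\<in>V. ppr \<alpha> G s u * of_bool (u \<noteq> w)) = (\<Sum>u\<in>V. ppr \<alpha> G s u) - ppr \<alpha> G s w"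
        proof -
          have "(\<Sum>u\<in>V. ppr \<alpha> G s u * of_bool (u \<noteq> w)) = (\<Sum>u\<in>V - {w}. ppr \<alpha> G s u)"
            by (auto intro!: sum.mono_neutral_cong_right)
          then show ?thesis using sum.remove[OF finite_V w, of "ppr \<alpha> G s"] by simp
        qed
        then show "(\<Sum>u\<in>V. ppr \<alpha> G s u * of_bool (u \<noteq> w)) \<le> q w"
          using sum_ppr_le_1[of s] by (simp add: q_def)
        show "0 \<le> of_bool (mk w = 0) * (\<kappa> w * q w ^ (M - Suc i))" using \<kappa>[OF w] q by simp
      qed
      also have "\<dots> = S mk i"
      proof -
        have "M - i = Suc (M - Suc i)" using i by simp
        then show ?thesis by (simp add: S_def mult_ac)
      qed
      also have "e * (\<Sum>u\<in>V. ppr \<alpha> G s u) \<le> e * 1" by (intro mult_left_mono sum_ppr_le_1 e)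
      finally show "A * (real (clock \<tau>) + 3 + 6 / \<alpha>) + (\<Sum>u\<in>V. ppr \<alpha> G s u * F u) \<le> J \<tau>"
        by (simp add: J_def e_def k_def i mk_def algebra_simps add_divide_distrib)
    qed
    finally show "ewp (exec L forward_step \<tau>) (\<lambda>\<tau>. post I J (tick \<tau>)) \<le> ennreal (J \<tau>)" .
  qed
  also have "J (tick \<sigma>1) = A * (real (clock \<sigma>) + 2 + k * real M) + E + (\<Sum>w\<in>V. \<kappa> w * q w ^ M)"
    using \<sigma> by (simp add: J_def \<sigma>1_def S_def algebra_simps)
  finally show ?thesis
    by (simp add: forward_loop_def ewp_simps \<sigma>1_def b_def M_def k_def q_def)
qed

lemma ewp_backward_phase:
  assumes \<sigma>: "nmem \<sigma> 0 0 = s" "nmem \<sigma> 0 1 = t" "nmem \<sigma> 0 2 = K" "rmem \<sigma> 0 1 = \<alpha>" "rmem \<sigma> 1 = (\<lambda>_. 0)"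
      "heavy_list \<sigma>" "nmem \<sigma> 0 10 \<le> M"
    and V: "s \<in> V" "t \<in> V" and K: "0 < K" and C: "0 < C" and B: "0 \<le> B"
    and f: "\<And>\<tau>. f \<tau> \<le> ennreal (A * real (clock \<tau>) + B * (rmem \<tau> 0 0 - ppr \<alpha> G s t)\<^sup>2)"
    and hn_def: "hn = harm (card V)"
  shows "ewp (exec L (backward_init ;; backward_loop ;; estimate_loop C) \<sigma>) f \<le>
    ennreal (A * real (clock \<sigma>) + (A * (15 + (9 + 6 / \<alpha>) * (real C * (real K)\<^sup>2)
        + (30 * real K * (real M + hn + 1) + 30 * hn * (real K)\<^sup>2) * (\<Sum>w\<in>V. ppr \<alpha> G w t))
      + B * ppr \<alpha> G s t / (\<alpha> * real C * real K ^ 3))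
      + (\<Sum>w\<in>V. of_bool (nmem \<sigma> 2 w = 0) * (B / (real K)\<^sup>2 * (visits s w)\<^sup>2 * ppr \<alpha> G w t)))"
proof -
  define mk where "mk = nmem \<sigma> 2"
  define hl where "hl = nmem \<sigma> 1"
  define nh where "nh = nmem \<sigma> 0 10"
  define H where "H = {u. mk u \<noteq> 0}"
  define a where "a = ppr \<alpha> G s t"
  define \<nu> where "\<nu> = B / (\<alpha> * real C * real K ^ 3)"
  have \<nu>: "0 \<le> \<nu>" using B alpha_pos by (simp add: \<nu>_def)
  have hn: "0 \<le> hn" by (simp add: hn_def harm_nonneg)
  define e where "e = A * 30 * real K * (real nh + hn + 1)"
  define e' where "e' w = A * 30 * hn * (real K)\<^sup>2 + of_bool (w \<notin> H) * (B / (real K)\<^sup>2) * (visits s w)\<^sup>2" for w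
  define q where "q w = e + e' w" for w
  \<comment> \<open>This solves the recursion for prices. \<open>q w\<close> charges a unit of
    residue at \<open>w\<close> with \<open>e\<close> for its push and \<open>e' w\<close> for its
    transfer to \<open>w\<close>, and a unit at \<open>v\<close> sends \<open>visits w v\<close>
    units through \<open>w\<close> in total; the unit at \<open>v\<close> itself was not
    transferred, hence the subtraction. The multiple of \<open>visits s\<close> reserves the
    variance that remaining residues cause in the final estimate.\<close>
  define c where "c v = (\<Sum>w\<in>V. visits w v * q w) - e' v + \<nu> * visits s v" for v
  have e: "0 \<le> e" "0 \<le> e' w" for w using A_pos hn B by (simp_all add: e_def e'_def)
  have q: "0 \<le> q w" for w using e by (simp add: q_def)
  have h: "inj_on hl {..<nh}" "hl ` {..<nh} = H" "H \<subseteq> V"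
    using \<sigma>(6) by (simp_all add: heavy_list_def hl_def nh_def H_def mk_def)
  have c_ge_visits: "\<nu> * visits s v \<le> c v" if v: "v \<in> V" for v
  proof -
    have "e' v \<le> 1 * q v" using e by (simp add: q_def)
    also have "\<dots> \<le> visits v v * q v" using v q by (intro mult_right_mono visits_diag_ge)
    also have "\<dots> \<le> (\<Sum>w\<in>V. visits w v * q w)"
      using v q by (intro member_le_sum) (auto intro!: mult_nonneg_nonneg visits_nonneg)
    finally show ?thesis by (simp add: c_def)
  qed
  have c_rec: "e + (\<Sum>u\<in>V. step_prob u v * (c u + e' u)) \<le> c v" if v: "v \<in> V" for v
  proof -
    have last: "(\<Sum>u\<in>V. step_prob u v * visits w u) = visits w v - of_bool (w = v)" if "w \<in> V" for w
      using visits_last_step[OF that v] by (simp add: mult.commute)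
    have "(\<Sum>u\<in>V. step_prob u v * (c u + e' u)) =
      (\<Sum>u\<in>V. step_prob u v * (\<Sum>w\<in>V. visits w u * q w)) + \<nu> * (\<Sum>u\<in>V. step_prob u v * visits s u)"
      by (simp add: c_def distrib_left sum.distrib sum_distrib_left mult_ac)
    also have "(\<Sum>u\<in>V. step_prob u v * (\<Sum>w\<in>V. visits w u * q w)) = (\<Sum>w\<in>V. q w * (\<Sum>u\<in>V. step_prob u v * visits w u))"
      unfolding sum_distrib_left by (subst sum.swap) (simp add: mult_ac)
    also have "\<dots> = (\<Sum>w\<in>V. q w * (visits w v - of_bool (w = v)))"
      by (intro sum.cong) (simp_all add: last)
    also have "\<dots> = (\<Sum>w\<in>V. visits w v * q w) - q v"
    proof -
      have "(\<Sum>w\<in>V. q w * of_bool (w = v)) = q v"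
        using v by (simp add: of_bool_def if_distrib cong: if_cong)
      then show ?thesis by (simp add: right_diff_distrib sum_subtractf mult.commute)
    qed
    also have "\<nu> * (\<Sum>u\<in>V. step_prob u v * visits s u) \<le> \<nu> * visits s v"
      using \<nu> V by (intro mult_left_mono) (simp_all add: last)
    finally show ?thesis by (simp add: c_def q_def)
  qed
  interpret backward G \<alpha> L A s K nh hl mk B a c H
  proof
    fix v assume v: "v \<in> V"
    show "0 \<le> c v" using c_ge_visits[OF v] \<nu> visits_nonneg[OF V(1) v] by (meson mult_nonneg_nonneg order_trans)
    show "A * 30 * real K * (real nh + harm (card V) + 1) + (\<Sum>u\<in>V. step_prob u v * (c u + A * 30 * harm (card V) * (real K)\<^sup>2
          + of_bool (u \<notin> H) * (B / (real K)\<^sup>2) * (visits s u)\<^sup>2)) \<le> c v"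
      using c_rec[OF v] by (simp add: e_def e'_def hn_def add.assoc)
  qed (use V K B h H_def in auto)
  define \<sigma>1 where "\<sigma>1 = tick (rstore 0 0 0 (tick (nstore 0 11 1 (tick (nstore 3 0 t
    (tick (rstore 1 t (stop_prob t) (tick (tick (nstore 0 8 (card (out_nbs G t)) \<sigma>))))))))))"
  have init: "ewp (exec L backward_init \<sigma>) F = F \<sigma>1" for F
    using \<sigma> by (simp add: backward_init_def ewp_simps \<sigma>1_def out_list stop_prob_def card_gt_0_iff)
  have wf1: "wf \<sigma>1"
    unfolding wf_def
  proof (intro conjI ballI impI)
    fix u assume "u \<in> V" "1 \<le> rmem \<sigma>1 1 u * real K"
    then have "u = t" using \<sigma>(5) by (auto simp: \<sigma>1_def split: if_splits)
    then show "\<exists>j<nmem \<sigma>1 0 11. nmem \<sigma>1 3 j = u" by (intro exI[of _ 0]) (simp add: \<sigma>1_def)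
  qed (use \<sigma> V stop_prob_bounds(1)[of t] in \<open>simp_all add: \<sigma>1_def hl_def mk_def nh_def less_imp_le\<close>)
  have res1: "(\<Sum>u\<in>V. k u * rmem \<sigma>1 1 u) = k t * stop_prob t" for k
  proof -
    have "(\<Sum>u\<in>V. k u * rmem \<sigma>1 1 u) = (\<Sum>u\<in>V. if u = t then k t * stop_prob t else 0)"
      using \<sigma>(5) by (intro sum.cong) (auto simp: \<sigma>1_def)
    then show ?thesis using V by simp
  qed
  \<comment> \<open>The initial residue is \<open>stop_prob t\<close> at \<open>t\<close> alone;
    weighted with \<open>visits s\<close> it equals \<open>ppr \<alpha> G s t\<close>.\<close>
  have err1: "err \<sigma>1 = 0"
  proof -
    have "rmem \<sigma>1 0 0 = 0" by (simp add: \<sigma>1_def)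
    then show ?thesis unfolding err_def res1 using V by (simp add: a_def ppr_eq_visits mult.commute)
  qed
  \<comment> \<open>The factor \<open>stop_prob t\<close> turns \<open>visits w t\<close> into
    \<open>ppr \<alpha> G w t\<close>; thus the sum over all starting nodes enters the time
    bound.\<close>
  have ct: "c t * stop_prob t \<le> (\<Sum>w\<in>V. q w * ppr \<alpha> G w t) + \<nu> * a"
  proof -
    have "c t * stop_prob t = (\<Sum>w\<in>V. q w * ppr \<alpha> G w t) - e' t * stop_prob t + \<nu> * a"
    proof -
      have "(\<Sum>w\<in>V. q w * ppr \<alpha> G w t) = (\<Sum>w\<in>V. visits w t * q w) * stop_prob t"
        unfolding sum_distrib_right using V by (intro sum.cong) (simp_all add: ppr_eq_visits)
      then show ?thesis using V by (simp add: c_def a_def ppr_eq_visits[of s] algebra_simps)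
    qed
    then show ?thesis using e stop_prob_bounds(1)[of t] by (simp add: less_imp_le)
  qed
  have pot1: "pot 0 \<sigma>1 \<le> A * real (clock \<sigma>) + A * 12 + (\<Sum>w\<in>V. q w * ppr \<alpha> G w t) + \<nu> * a"
    using ct err1 unfolding pot_def res1 by (simp add: \<sigma>1_def algebra_simps)
  define m where "m = (9 + 6 / \<alpha>) * (real C * (real K)\<^sup>2)"
  have m0: "0 \<le> m" using alpha_pos by (simp add: m_def)
  have final: "ewp (exec L (estimate_loop C) \<tau>) f \<le> ennreal (pot 0 \<tau> + A * (2 + m))" if wf: "wf \<tau>" and sp: "nmem \<tau> 0 11 = 0" for \<tau>
  proof -
    define \<mu> where "\<mu> = (\<Sum>u\<in>V. g u * rmem \<tau> 1 u)"
    have "ewp (exec L (estimate_loop C) \<tau>) f \<le> ennreal (A * (real (clock \<tau>) + 2 + (9 + 6 / \<alpha>) * (real C * (real K)\<^sup>2))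
        + B * ((rmem \<tau> 0 0 + \<mu> - a)\<^sup>2 + \<mu> / (\<alpha> * real C * real K ^ 3)))"
    proof (rule ewp_estimate_loop[OF _ _ _ refl V(1) K C B])
      fix u assume "u \<in> V"
      then show "rmem \<tau> 1 u * real K \<le> 1" using wf sp by (auto simp: wf_def not_le intro: less_imp_le)
    qed (use wf f in \<open>auto simp: wf_def \<mu>_def a_def\<close>)
    also have "\<dots> \<le> ennreal (pot 0 \<tau> + A * (2 + m))"
    proof (rule ennreal_leI)
      have "\<nu> * \<mu> = (\<Sum>u\<in>V. \<nu> * g u * rmem \<tau> 1 u)" by (simp add: \<mu>_def sum_distrib_left mult.assoc)
      also have "\<dots> \<le> (\<Sum>u\<in>V. c u * rmem \<tau> 1 u)"
        using wf by (intro sum_mono mult_right_mono c_ge_visits) (auto simp: wf_def)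
      finally have "B * (\<mu> / (\<alpha> * real C * real K ^ 3)) \<le> (\<Sum>u\<in>V. c u * rmem \<tau> 1 u)" by (simp add: \<nu>_def)
      moreover have "err \<tau> = rmem \<tau> 0 0 + \<mu> - a" by (simp add: err_def \<mu>_def)
      ultimately show "A * (real (clock \<tau>) + 2 + (9 + 6 / \<alpha>) * (real C * (real K)\<^sup>2))
        + B * ((rmem \<tau> 0 0 + \<mu> - a)\<^sup>2 + \<mu> / (\<alpha> * real C * real K ^ 3)) \<le> pot 0 \<tau> + A * (2 + m)"
        unfolding pot_def m_def using sp by (simp add: distrib_left)
    qed
    finally show ?thesis .
  qed
  have "ewp (exec L backward_loop \<sigma>1) (\<lambda>\<tau>. ewp (exec L (estimate_loop C) \<tau>) f) \<le> ennreal (pot 0 \<sigma>1 + A + A * (2 + m))"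
    by (rule ewp_backward_loop[OF wf1]) (use final A_pos m0 in auto)
  also have "\<dots> \<le> ennreal (A * real (clock \<sigma>) + (A * (15 + m
        + (30 * real K * (real M + hn + 1) + 30 * hn * (real K)\<^sup>2) * (\<Sum>w\<in>V. ppr \<alpha> G w t))
      + B * ppr \<alpha> G s t / (\<alpha> * real C * real K ^ 3))
      + (\<Sum>w\<in>V. of_bool (nmem \<sigma> 2 w = 0) * (B / (real K)\<^sup>2 * (visits s w)\<^sup>2 * ppr \<alpha> G w t)))"
  proof (rule ennreal_leI)
    define P where "P = (\<Sum>w\<in>V. ppr \<alpha> G w t)"
    have split: "A * (15 + m + X * P) = A * 15 + A * m + A * X * P" "A * (2 + m) = A * 2 + A * m" for X
      by (simp_all add: distrib_left mult.assoc)
    have P: "0 \<le> P" unfolding P_def by (intro sum_nonneg ppr_nonneg)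
    have "(\<Sum>w\<in>V. q w * ppr \<alpha> G w t) = A * (30 * real K * (real nh + hn + 1) + 30 * hn * (real K)\<^sup>2) * P
      + (\<Sum>w\<in>V. of_bool (nmem \<sigma> 2 w = 0) * (B / (real K)\<^sup>2 * (visits s w)\<^sup>2 * ppr \<alpha> G w t))"
    proof -
      have "q w * ppr \<alpha> G w t = A * (30 * real K * (real nh + hn + 1) + 30 * hn * (real K)\<^sup>2) * ppr \<alpha> G w t
        + of_bool (nmem \<sigma> 2 w = 0) * (B / (real K)\<^sup>2 * (visits s w)\<^sup>2 * ppr \<alpha> G w t)" for w
        by (simp add: q_def e_def e'_def H_def mk_def algebra_simps)
      then show ?thesis by (simp add: P_def sum.distrib sum_distrib_left)
    qed
    moreover have "A * (30 * real K * (real nh + hn + 1) + 30 * hn * (real K)\<^sup>2) * P \<le>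
      A * (30 * real K * (real M + hn + 1) + 30 * hn * (real K)\<^sup>2) * P"
      using A_pos P \<sigma>(7) by (intro mult_right_mono mult_left_mono add_right_mono) (auto simp: nh_def)
    moreover have "\<nu> * a = B * ppr \<alpha> G s t / (\<alpha> * real C * real K ^ 3)" by (simp add: \<nu>_def a_def)
    moreover note pot1
    ultimately show "pot 0 \<sigma>1 + A + A * (2 + m) \<le> A * real (clock \<sigma>) + (A * (15 + m
        + (30 * real K * (real M + hn + 1) + 30 * hn * (real K)\<^sup>2) * (\<Sum>w\<in>V. ppr \<alpha> G w t))
      + B * ppr \<alpha> G s t / (\<alpha> * real C * real K ^ 3))
      + (\<Sum>w\<in>V. of_bool (nmem \<sigma> 2 w = 0) * (B / (real K)\<^sup>2 * (visits s w)\<^sup>2 * ppr \<alpha> G w t))"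
      unfolding P_def[symmetric] split by linarith
  qed
  finally show ?thesis by (simp add: ewp_Seq init m_def)
qed

end

section \<open>The algorithm\<close>

text \<open>Lacking roots and logarithms, the machine counts up to the least \<open>K\<close> with
  \<open>K ^ 3 * \<delta> \<ge> 1\<close> here, and to the least \<open>l \<ge> 1\<close> with
  \<open>(1 - \<alpha>) ^ l \<le> \<delta>\<close> in \<open>length_loop\<close>.\<close>

definition scale_loop :: com where
  "scale_loop = While (RLess (RMul (RMul (RNat (nreg 2)) (RMul (RNat (nreg 2)) (RNat (nreg 2)))) (rreg 0)) (RNat (NLit 1)))
    (incr 2)"

definition length_loop :: com where
  "length_loop =
    set_nreg 3 (NLit 1) ;;
    set_rreg 4 (RSub (RNat (NLit 1)) (rreg 1)) ;;
    While (RLess (rreg 0) (rreg 4)) (set_rreg 4 (RMul (rreg 4) (RSub (RNat (NLit 1)) (rreg 1))) ;; incr 3)"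

definition algorithm :: "nat \<Rightarrow> com" where
  "algorithm C = scale_loop ;; length_loop ;; forward_loop C ;; backward_init ;; backward_loop ;; estimate_loop C"

section \<open>Closed bounds on scale and length\<close>

definition max_scale :: "real \<Rightarrow> nat" where
  "max_scale \<delta> = nat \<lceil>(1 / \<delta>) powr (1 / 3)\<rceil>"

definition max_length :: "real \<Rightarrow> real \<Rightarrow> nat" where
  "max_length \<alpha> \<delta> = Suc (nat \<lceil>ln (1 / \<delta>) / ln (1 / (1 - \<alpha>))\<rceil>)"

lemma Suc_le_max_scale:
  assumes "0 < \<delta>" "real k ^ 3 * \<delta> < 1" shows "Suc k \<le> max_scale \<delta>"
proof -
  have "real k ^ 3 < 1 / \<delta>" using assms by (simp add: field_simps)
  then have "(real k ^ 3) powr (1 / 3) < (1 / \<delta>) powr (1 / 3)"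
    by (intro powr_less_mono2) auto
  moreover have "(real k ^ 3) powr (1 / 3) = real k"
  proof (cases "k = 0")
    case False
    then have "real k ^ 3 = real k powr 3" by simp
    then show ?thesis using False by (simp only: powr_powr) simp
  qed simp
  ultimately show ?thesis unfolding max_scale_def by linarith
qed

lemma Suc_le_max_length:
  assumes "0 < \<alpha>" "\<alpha> < 1" "0 < \<delta>" "\<delta> < (1 - \<alpha>) ^ k" shows "Suc k \<le> max_length \<alpha> \<delta>"
proof -
  have "ln \<delta> < real k * ln (1 - \<alpha>)"
    using assms ln_less_cancel_iff[of \<delta> "(1 - \<alpha>) ^ k"] by (simp add: ln_realpow)
  moreover have "ln (1 - \<alpha>) < 0" using assms by simp
  ultimately have "real k < ln (1 / \<delta>) / ln (1 / (1 - \<alpha>))"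
    using assms by (simp add: ln_div field_simps)
  then show ?thesis unfolding max_length_def by linarith
qed

text \<open>Bernoulli's inequality gives \<open>M * x \<le> (1 + x) ^ M\<close>, and
  \<open>(1 + x) * (1 - x) \<le> 1\<close>. Applied to a node of endpoint probability
  \<open>x\<close>, it limits the weight that \<open>M\<close> walks miss.\<close>

lemma mult_power_complement_le:
  assumes "0 \<le> x" "x \<le> 1" "0 < M" shows "x * (1 - x) ^ M \<le> 1 / real M"
proof -
  have "real M * x * (1 - x) ^ M \<le> (1 + x) ^ M * (1 - x) ^ M"
    using Bernoulli_inequality[of x M] assms by (intro mult_right_mono) auto
  also have "\<dots> = ((1 + x) * (1 - x)) ^ M" by (simp add: power_mult_distrib)
  also have "\<dots> \<le> 1"
    using assms by (intro power_le_one) (auto simp: algebra_simps mult_le_one)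
  finally show ?thesis using assms by (simp add: field_simps)
qed

lemma harm_le_ln: "0 < n \<Longrightarrow> harm n \<le> 1 + ln (real n)"
  using decseqD[OF decseq_harm_diff_ln, of 0 "n - 1"] by (simp add: harm_expand)

text \<open>The time bound is split by its dependence on the target: \<open>push_cost\<close> is
  multiplied by the sum of \<open>ppr \<alpha> G w t\<close> over all \<open>w\<close>, whose
  average over \<open>t\<close> is at most 1.\<close>

definition (in ppr_graph) base_cost :: "nat \<Rightarrow> real \<Rightarrow> real" where
  "base_cost C \<delta> = 21 + 2 * real (max_scale \<delta>) + 3 * real (max_length \<alpha> \<delta>)
    + (9 + 6 / \<alpha>) * (real C * real (max_scale \<delta>) * real (max_length \<alpha> \<delta>) + real C * (real (max_scale \<delta>))\<^sup>2)"

definition (in ppr_graph) push_cost :: "nat \<Rightarrow> real \<Rightarrow> real" where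
  "push_cost C \<delta> = 30 * real (max_scale \<delta>) * (real C * real (max_scale \<delta>) * real (max_length \<alpha> \<delta>) + harm (card V) + 1)
    + 30 * harm (card V) * (real (max_scale \<delta>))\<^sup>2"

context ppr_algo
begin

lemma ewp_scale_loop:
  assumes \<sigma>: "nmem \<sigma> 0 2 = 0" "rmem \<sigma> 0 0 = \<delta>" and \<delta>: "0 < \<delta>" "\<delta> \<le> 1" and X: "0 \<le> X"
    and f: "\<And>\<tau>. agree_but {2} \<sigma> \<tau> \<Longrightarrow> 1 \<le> real (nmem \<tau> 0 2) ^ 3 * \<delta> \<Longrightarrow> nmem \<tau> 0 2 \<le> max_scale \<delta> \<Longrightarrow>
      f \<tau> \<le> ennreal (A * real (clock \<tau>) + X)"
  shows "ewp (exec L scale_loop \<sigma>) f \<le> ennreal (A * (real (clock \<sigma>) + 1 + 2 * real (max_scale \<delta>)) + X)"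
proof -
  define I where "I = (\<lambda>\<tau>. agree_but {2} \<sigma> \<tau> \<and> nmem \<tau> 0 2 \<le> max_scale \<delta>)"
  define J where "J = (\<lambda>\<tau>::state. A * real (clock \<tau>) + (A * 2 * (real (max_scale \<delta>) - real (nmem \<tau> 0 2)) + X))"
  define b where "b = RLess (RMul (RMul (RNat (nreg 2)) (RMul (RNat (nreg 2)) (RNat (nreg 2)))) (rreg 0)) (RNat (NLit 1))"
  have b: "bval b \<tau> \<longleftrightarrow> real (nmem \<tau> 0 2) ^ 3 * \<delta> < 1" if "I \<tau>" for \<tau>
    using that \<sigma> by (simp add: b_def I_def agree_but_def power3_eq_cube mult.assoc)
  have "ewp (exec L (While b (incr 2)) \<sigma>) f \<le> ennreal (J (tick \<sigma>))"
  proof (rule ewp_while[where I = I, OF A_pos])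
    show "I (tick \<sigma>)" using \<sigma> by (simp add: I_def agree_but_def)
  next
    fix \<tau> assume "I \<tau>"
    then show "A * real (clock \<tau>) \<le> J \<tau>"
      unfolding J_def using A_pos X by (intro add_increasing2) (auto simp: I_def)
  next
    fix \<tau> assume I: "I \<tau>" and "\<not> bval b \<tau>"
    then have "f \<tau> \<le> ennreal (A * real (clock \<tau>) + X)" using f b[OF I] by (auto simp: I_def not_less)
    also have "\<dots> \<le> ennreal (J \<tau>)" unfolding J_def using I A_pos by (intro ennreal_leI) (simp add: I_def)
    finally show "f \<tau> \<le> ennreal (J \<tau>)" .
  next
    fix \<tau> assume I: "I \<tau>" and "bval b \<tau>"
    then have "Suc (nmem \<tau> 0 2) \<le> max_scale \<delta>" using b[OF I] \<delta> by (intro Suc_le_max_scale) auto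
    then show "ewp (exec L (incr 2) \<tau>) (\<lambda>\<tau>. post I J (tick \<tau>)) \<le> ennreal (J \<tau>)"
      using I by (simp add: ewp_simps post_def I_def J_def agree_but_def algebra_simps)
  qed
  then show ?thesis using \<sigma> by (simp add: scale_loop_def b_def J_def algebra_simps)
qed

lemma ewp_length_loop:
  assumes \<sigma>: "rmem \<sigma> 0 0 = \<delta>" "rmem \<sigma> 0 1 = \<alpha>" and \<delta>: "0 < \<delta>" "\<delta> \<le> 1" and X: "0 \<le> X"
    and f: "\<And>\<tau>. (\<forall>a. a \<noteq> 0 \<longrightarrow> nmem \<tau> a = nmem \<sigma> a) \<Longrightarrow> (\<forall>k. k \<noteq> 3 \<longrightarrow> nmem \<tau> 0 k = nmem \<sigma> 0 k) \<Longrightarrow>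
      rmem \<tau> 1 = rmem \<sigma> 1 \<Longrightarrow> rmem \<tau> 0 1 = \<alpha> \<Longrightarrow> 1 \<le> nmem \<tau> 0 3 \<Longrightarrow>
      (1 - \<alpha>) ^ nmem \<tau> 0 3 \<le> \<delta> \<Longrightarrow> nmem \<tau> 0 3 \<le> max_length \<alpha> \<delta> \<Longrightarrow> f \<tau> \<le> ennreal (A * real (clock \<tau>) + X)"
  shows "ewp (exec L length_loop \<sigma>) f \<le> ennreal (A * (real (clock \<sigma>) + 3 + 3 * real (max_length \<alpha> \<delta>)) + X)"
proof -
  define I where "I = (\<lambda>\<tau>::state. (\<forall>a. a \<noteq> 0 \<longrightarrow> nmem \<tau> a = nmem \<sigma> a) \<and> (\<forall>k. k \<noteq> 3 \<longrightarrow> nmem \<tau> 0 k = nmem \<sigma> 0 k)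
    \<and> rmem \<tau> 1 = rmem \<sigma> 1 \<and> rmem \<tau> 0 1 = \<alpha> \<and> rmem \<tau> 0 0 = \<delta> \<and> rmem \<tau> 0 4 = (1 - \<alpha>) ^ nmem \<tau> 0 3
    \<and> 1 \<le> nmem \<tau> 0 3 \<and> nmem \<tau> 0 3 \<le> max_length \<alpha> \<delta>)"
  define J where "J = (\<lambda>\<tau>::state. A * real (clock \<tau>) + (A * 3 * (real (max_length \<alpha> \<delta>) - real (nmem \<tau> 0 3)) + X))"
  define \<sigma>1 where "\<sigma>1 = tick (rstore 0 4 (1 - \<alpha>) (tick (nstore 0 3 1 \<sigma>)))"
  have "ewp (exec L (While (RLess (rreg 0) (rreg 4))
      (set_rreg 4 (RMul (rreg 4) (RSub (RNat (NLit 1)) (rreg 1))) ;; incr 3)) \<sigma>1) f \<le> ennreal (J (tick \<sigma>1))"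
  proof (rule ewp_while[where I = I, OF A_pos])
    show "I (tick \<sigma>1)" using \<sigma> by (simp add: I_def \<sigma>1_def max_length_def)
  next
    fix \<tau> assume "I \<tau>"
    then show "A * real (clock \<tau>) \<le> J \<tau>"
      unfolding J_def using A_pos X by (intro add_increasing2) (auto simp: I_def)
  next
    fix \<tau> assume I: "I \<tau>" and "\<not> bval (RLess (rreg 0) (rreg 4)) \<tau>"
    then have "f \<tau> \<le> ennreal (A * real (clock \<tau>) + X)" using f by (auto simp: I_def)
    also have "\<dots> \<le> ennreal (J \<tau>)" unfolding J_def using I A_pos by (intro ennreal_leI) (simp add: I_def)
    finally show "f \<tau> \<le> ennreal (J \<tau>)" .
  next
    fix \<tau> assume I: "I \<tau>" and "bval (RLess (rreg 0) (rreg 4)) \<tau>"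
    then have "Suc (nmem \<tau> 0 3) \<le> max_length \<alpha> \<delta>"
      using \<delta> alpha_pos alpha_less by (intro Suc_le_max_length) (auto simp: I_def)
    then show "ewp (exec L (set_rreg 4 (RMul (rreg 4) (RSub (RNat (NLit 1)) (rreg 1))) ;; incr 3) \<tau>)
        (\<lambda>\<tau>. post I J (tick \<tau>)) \<le> ennreal (J \<tau>)"
      using I by (simp add: ewp_simps post_def I_def J_def algebra_simps)
  qed
  also have "J (tick \<sigma>1) \<le> A * (real (clock \<sigma>) + 3 + 3 * real (max_length \<alpha> \<delta>)) + X"
    using A_pos by (simp add: J_def \<sigma>1_def algebra_simps)
  finally show ?thesis using \<sigma> by (simp add: length_loop_def ewp_simps \<sigma>1_def ennreal_leI)
qed

text \<open>The summands are the variances of the sampled pushes and of the final estimate. Missing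
  \<open>w\<close> in all \<open>C * (K * l)\<close> walks replaces one factor
  \<open>visits s w\<close> by \<open>1 / (\<alpha> * real (C * (K * l)))\<close>;
  \<open>sum_visits_ppr_le\<close> bounds the rest, and its factor \<open>l\<close> cancels. What
  remains is of order \<open>1 / K ^ 3\<close>, which is at most \<open>\<delta>\<close>, times
  \<open>max \<delta> (ppr \<alpha> G s t)\<close>.\<close>

lemma sum_missed_le:
  assumes V: "s \<in> V" "t \<in> V" and K: "0 < K" "1 \<le> real K ^ 3 * \<delta>" and l: "1 \<le> l" "(1 - \<alpha>) ^ l \<le> \<delta>" and C: "0 < C" and \<delta>: "0 < \<delta>"
  shows "(\<Sum>w\<in>V. (visits s w)\<^sup>2 * ppr \<alpha> G w t * (1 - ppr \<alpha> G s w) ^ (C * (K * l))) / (real K)\<^sup>2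
    + ppr \<alpha> G s t / (\<alpha> * real C * real K ^ 3) \<le> 3 * (max \<delta> (ppr \<alpha> G s t))\<^sup>2 / (\<alpha>\<^sup>2 * real C)"
proof -
  define M where "M = C * (K * l)"
  have M: "0 < M" using K l C by (simp add: M_def)
  define f where "f = ppr \<alpha> G s t"
  define m where "m = max \<delta> f"
  have m: "\<delta> \<le> m" "f \<le> m" "0 \<le> f" "0 < m" using \<delta> by (auto simp: m_def f_def ppr_nonneg)
  have "(\<Sum>w\<in>V. (visits s w)\<^sup>2 * ppr \<alpha> G w t * (1 - ppr \<alpha> G s w) ^ M) \<le>
    (\<Sum>w\<in>V. visits s w * ppr \<alpha> G w t * (1 / (\<alpha> * real M)))"
  proof (rule sum_mono)
    fix w assume w: "w \<in> V"
    have "visits s w * (1 - ppr \<alpha> G s w) ^ M \<le> ppr \<alpha> G s w / \<alpha> * (1 - ppr \<alpha> G s w) ^ M"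
      using V w ppr_le_1 by (intro mult_right_mono visits_le) auto
    also have "\<dots> \<le> 1 / real M / \<alpha>"
      using mult_power_complement_le[OF ppr_nonneg ppr_le_1 M, of s w] alpha_pos
      unfolding times_divide_eq_left by (intro divide_right_mono) auto
    finally have "visits s w * ppr \<alpha> G w t * (visits s w * (1 - ppr \<alpha> G s w) ^ M) \<le> visits s w * ppr \<alpha> G w t * (1 / (\<alpha> * real M))"
      using V w by (intro mult_left_mono) (auto simp: visits_nonneg ppr_nonneg mult.commute)
    then show "(visits s w)\<^sup>2 * ppr \<alpha> G w t * (1 - ppr \<alpha> G s w) ^ M \<le> visits s w * ppr \<alpha> G w t * (1 / (\<alpha> * real M))"
      by (simp add: power2_eq_square mult_ac)
  qed
  also have "\<dots> \<le> (real l * f + \<delta> / \<alpha>) * (1 / (\<alpha> * real M))"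
    unfolding sum_distrib_right[symmetric] f_def using V l alpha_pos
    by (intro mult_right_mono sum_visits_ppr_le) auto
  also have "\<dots> \<le> (real l * (f + \<delta> / \<alpha>)) * (1 / (\<alpha> * real M))"
  proof (intro mult_right_mono)
    have "1 * (\<delta> / \<alpha>) \<le> real l * (\<delta> / \<alpha>)" using l \<delta> alpha_pos by (intro mult_right_mono) auto
    then show "real l * f + \<delta> / \<alpha> \<le> real l * (f + \<delta> / \<alpha>)" by (simp add: distrib_left)
  qed (use alpha_pos in auto)
  also have "\<dots> = (f + \<delta> / \<alpha>) / (\<alpha> * real C * real K)"
    using l K C alpha_pos by (simp add: M_def field_simps)
  finally have "(\<Sum>w\<in>V. (visits s w)\<^sup>2 * ppr \<alpha> G w t * (1 - ppr \<alpha> G s w) ^ M) / (real K)\<^sup>2 + f / (\<alpha> * real C * real K ^ 3)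
    \<le> (f + \<delta> / \<alpha>) / (\<alpha> * real C * real K) / (real K)\<^sup>2 + f / (\<alpha> * real C * real K ^ 3)"
    by (intro add_right_mono divide_right_mono) auto
  also have "\<dots> = (2 * f + \<delta> / \<alpha>) / (\<alpha> * real C) * (1 / real K ^ 3)"
    using K C alpha_pos by (simp add: field_simps power2_eq_square power3_eq_cube)
  also have "\<dots> \<le> (3 * m / \<alpha>) / (\<alpha> * real C) * m"
  proof (intro mult_mono divide_right_mono)
    have "f * \<alpha> \<le> m * 1" using m alpha_pos alpha_less by (intro mult_mono) auto
    then have "f \<le> m / \<alpha>" using alpha_pos by (simp add: pos_le_divide_eq)
    moreover have "\<delta> / \<alpha> \<le> m / \<alpha>" using m alpha_pos by (simp add: divide_right_mono)
    ultimately show "2 * f + \<delta> / \<alpha> \<le> 3 * m / \<alpha>" by simp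
    have "1 / real K ^ 3 \<le> \<delta>" using K by (simp add: field_simps)
    then show "1 / real K ^ 3 \<le> m" using m by simp
  qed (use m alpha_pos C in auto)
  also have "\<dots> = 3 * m\<^sup>2 / (\<alpha>\<^sup>2 * real C)" by (simp add: power2_eq_square)
  finally show ?thesis by (simp add: M_def f_def m_def)
qed

lemma ewp_algorithm:
  assumes V: "s \<in> V" "t \<in> V" and \<delta>: "0 < \<delta>" "\<delta> \<le> 1" and C: "0 < C" and B: "0 \<le> B"
  shows "ewp (exec L (algorithm C) (init_state \<alpha> \<epsilon> p s t \<delta>))
      (\<lambda>\<tau>. ennreal (A * real (clock \<tau>) + B * (estimate \<tau> - ppr \<alpha> G s t)\<^sup>2)) \<le>
    ennreal (A * (base_cost C \<delta> + push_cost C \<delta> * (\<Sum>w\<in>V. ppr \<alpha> G w t))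
      + B * (3 * (max \<delta> (ppr \<alpha> G s t))\<^sup>2 / (\<alpha>\<^sup>2 * real C)))"
proof -
  define f where "f = (\<lambda>\<tau>. ennreal (A * real (clock \<tau>) + B * (estimate \<tau> - ppr \<alpha> G s t)\<^sup>2))"
  define \<sigma> where "\<sigma> = init_state \<alpha> \<epsilon> p s t \<delta>"
  have \<sigma>: "nmem \<sigma> 0 0 = s" "nmem \<sigma> 0 1 = t" "nmem \<sigma> 0 2 = 0" "nmem \<sigma> 0 10 = 0" "nmem \<sigma> 2 = (\<lambda>_. 0)" "rmem \<sigma> 1 = (\<lambda>_. 0)"
    "rmem \<sigma> 0 0 = \<delta>" "rmem \<sigma> 0 1 = \<alpha>" "clock \<sigma> = 0"
    by (simp_all add: \<sigma>_def init_state_def)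
  define hn where "hn = (harm (card V) :: real)"
  have hn: "0 \<le> hn" by (simp add: hn_def harm_nonneg)
  define P where "P = (\<Sum>w\<in>V. ppr \<alpha> G w t)"
  have P: "0 \<le> P" unfolding P_def by (intro sum_nonneg ppr_nonneg)
  define \<kappa> where "\<kappa> = 9 + 6 / \<alpha>"
  have \<kappa>: "0 \<le> \<kappa>" using alpha_pos by (simp add: \<kappa>_def)
  define Z where "Z = B * (3 * (max \<delta> (ppr \<alpha> G s t))\<^sup>2 / (\<alpha>\<^sup>2 * real C))"
  have Z: "0 \<le> Z" using B by (simp add: Z_def)
  define Km where "Km = max_scale \<delta>"
  define lm where "lm = max_length \<alpha> \<delta>"
  define cost where "cost = (\<lambda>K l. 17 + \<kappa> * real (C * (K * l)) + \<kappa> * (real C * (real K)\<^sup>2)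
    + (30 * real K * (real (C * (K * l)) + hn + 1) + 30 * hn * (real K)\<^sup>2) * P)"
  \<comment> \<open>This replaces the scale and length found at run time by their closed
    bounds.\<close>
  have cost_mono: "cost K l \<le> cost Km lm" if "K \<le> Km" "l \<le> lm" for K l
  proof -
    have M: "real (C * (K * l)) \<le> real (C * (Km * lm))" using that by (intro of_nat_mono mult_le_mono) auto
    show ?thesis unfolding cost_def
      using that \<kappa> hn P M by (intro add_mono mult_mono order_refl add_nonneg_nonneg mult_nonneg_nonneg power_mono) auto
  qed
  have cost0: "0 \<le> cost K l" for K l
    unfolding cost_def using \<kappa> hn P by (intro add_nonneg_nonneg mult_nonneg_nonneg) auto
  define X where "X = A * cost Km lm + Z"
  have X: "0 \<le> X" using cost0 Z A_pos by (simp add: X_def)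
  define F where "F = (\<lambda>\<tau>. ewp (exec L (forward_loop C) \<tau>) (\<lambda>\<tau>. ewp (exec L (backward_init ;; backward_loop ;; estimate_loop C) \<tau>) f))"
  have F: "F \<tau> \<le> ennreal (A * real (clock \<tau>) + X)"
    if \<tau>: "nmem \<tau> 0 0 = s" "nmem \<tau> 0 1 = t" "nmem \<tau> 0 2 = K" "nmem \<tau> 0 3 = l" "rmem \<tau> 0 1 = \<alpha>" "rmem \<tau> 1 = (\<lambda>_. 0)"
      "nmem \<tau> 0 10 = 0" "nmem \<tau> 2 = (\<lambda>_. 0)"
      and K: "1 \<le> real K ^ 3 * \<delta>" "K \<le> Km" and l: "1 \<le> l" "(1 - \<alpha>) ^ l \<le> \<delta>" "l \<le> lm" for \<tau> K l
  proof -
    have K0: "0 < K" using K(1) by (cases K) auto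
    define M where "M = C * (K * l)"
    define k where "k w = B / (real K)\<^sup>2 * (visits s w)\<^sup>2 * ppr \<alpha> G w t" for w
    have k: "0 \<le> k w" for w using B by (simp add: k_def ppr_nonneg)
    define E where "E = A * (15 + \<kappa> * (real C * (real K)\<^sup>2)
        + (30 * real K * (real M + hn + 1) + 30 * hn * (real K)\<^sup>2) * P) + B * ppr \<alpha> G s t / (\<alpha> * real C * real K ^ 3)"
    have "F \<tau> \<le> ennreal (A * (real (clock \<tau>) + 2 + (9 + 6 / \<alpha>) * real (C * (K * l))) + E
      + (\<Sum>w\<in>V. k w * (1 - ppr \<alpha> G s w) ^ (C * (K * l))))"
      unfolding F_def
    proof (rule ewp_forward_loop[OF \<tau> V(1) k])
      show "0 \<le> E" unfolding E_def using A_pos \<kappa> hn P B alpha_pos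
        by (intro add_nonneg_nonneg mult_nonneg_nonneg divide_nonneg_nonneg) (auto simp: ppr_nonneg)
    next
      fix \<tau>1 :: state
      assume t1: "nmem \<tau>1 0 0 = s" "nmem \<tau>1 0 1 = t" "nmem \<tau>1 0 2 = K" "rmem \<tau>1 0 1 = \<alpha>" "rmem \<tau>1 1 = (\<lambda>_. 0)"
        "heavy_list \<tau>1" "nmem \<tau>1 0 10 \<le> C * (K * l)"
      show "ewp (exec L (backward_init ;; backward_loop ;; estimate_loop C) \<tau>1) f
        \<le> ennreal (A * real (clock \<tau>1) + E + (\<Sum>w\<in>V. of_bool (nmem \<tau>1 2 w = 0) * k w))"
        unfolding E_def k_def \<kappa>_def P_def M_def
        by (rule ewp_backward_phase[OF t1 V K0 C B _ hn_def]) (simp add: f_def estimate_def)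
    qed
    also have "\<dots> \<le> ennreal (A * real (clock \<tau>) + X)"
    proof (rule ennreal_leI)
      have "(\<Sum>w\<in>V. k w * (1 - ppr \<alpha> G s w) ^ M) = B * ((\<Sum>w\<in>V. (visits s w)\<^sup>2 * ppr \<alpha> G w t * (1 - ppr \<alpha> G s w) ^ M) / (real K)\<^sup>2)"
        by (simp add: k_def sum_distrib_left sum_divide_distrib mult_ac)
      then have "(\<Sum>w\<in>V. k w * (1 - ppr \<alpha> G s w) ^ M) + B * ppr \<alpha> G s t / (\<alpha> * real C * real K ^ 3) =
        B * ((\<Sum>w\<in>V. (visits s w)\<^sup>2 * ppr \<alpha> G w t * (1 - ppr \<alpha> G s w) ^ M) / (real K)\<^sup>2 + ppr \<alpha> G s t / (\<alpha> * real C * real K ^ 3))"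
        by (simp add: distrib_left)
      also have "\<dots> \<le> Z"
        unfolding Z_def M_def using V K0 K l C \<delta> B by (intro mult_left_mono sum_missed_le) auto
      finally have err: "(\<Sum>w\<in>V. k w * (1 - ppr \<alpha> G s w) ^ M) + B * ppr \<alpha> G s t / (\<alpha> * real C * real K ^ 3) \<le> Z" .
      have "A * (2 + \<kappa> * real M) + A * (15 + \<kappa> * (real C * (real K)\<^sup>2)
        + (30 * real K * (real M + hn + 1) + 30 * hn * (real K)\<^sup>2) * P) = A * cost K l"
        by (simp add: cost_def M_def distrib_left)
      also have "\<dots> \<le> A * cost Km lm" using cost_mono[OF K(2) l(3)] A_pos by simp
      finally have "A * (2 + \<kappa> * real M) + E + (\<Sum>w\<in>V. k w * (1 - ppr \<alpha> G s w) ^ M) \<le> X"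
        using err unfolding E_def X_def by linarith
      moreover have "A * (real (clock \<tau>) + 2 + \<kappa> * real M) = A * real (clock \<tau>) + A * (2 + \<kappa> * real M)"
        by (simp add: distrib_left)
      ultimately show "A * (real (clock \<tau>) + 2 + (9 + 6 / \<alpha>) * real (C * (K * l))) + E
        + (\<Sum>w\<in>V. k w * (1 - ppr \<alpha> G s w) ^ (C * (K * l))) \<le> A * real (clock \<tau>) + X"
        unfolding M_def \<kappa>_def by linarith
    qed
    finally show ?thesis .
  qed
  have "ewp (exec L scale_loop \<sigma>) (\<lambda>\<tau>. ewp (exec L length_loop \<tau>) F) \<le>
    ennreal (A * (real (clock \<sigma>) + 1 + 2 * real (max_scale \<delta>)) + (A * (3 + 3 * real lm) + X))"
  proof (rule ewp_scale_loop[OF \<sigma>(3,7) \<delta>])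
    show "0 \<le> A * (3 + 3 * real lm) + X" using X A_pos by simp
  next
    fix \<tau> assume \<tau>: "agree_but {2} \<sigma> \<tau>" and K: "1 \<le> real (nmem \<tau> 0 2) ^ 3 * \<delta>" "nmem \<tau> 0 2 \<le> max_scale \<delta>"
    have "ewp (exec L length_loop \<tau>) F \<le> ennreal (A * (real (clock \<tau>) + 3 + 3 * real (max_length \<alpha> \<delta>)) + X)"
    proof (rule ewp_length_loop[OF _ _ \<delta> X])
      fix \<tau>1 :: state
      assume t1: "\<forall>a. a \<noteq> 0 \<longrightarrow> nmem \<tau>1 a = nmem \<tau> a" "\<forall>k. k \<noteq> 3 \<longrightarrow> nmem \<tau>1 0 k = nmem \<tau> 0 k"
        "rmem \<tau>1 1 = rmem \<tau> 1" "rmem \<tau>1 0 1 = \<alpha>" and l: "1 \<le> nmem \<tau>1 0 3" "(1 - \<alpha>) ^ nmem \<tau>1 0 3 \<le> \<delta>" "nmem \<tau>1 0 3 \<le> max_length \<alpha> \<delta>"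
      show "F \<tau>1 \<le> ennreal (A * real (clock \<tau>1) + X)"
        by (rule F[OF _ _ refl refl t1(4) _ _ _ _ _ l(1,2)])
          (use t1 \<tau> \<sigma> K l in \<open>simp_all add: agree_but_def Km_def lm_def\<close>)
    qed (use \<tau> \<sigma> in \<open>simp_all add: agree_but_def\<close>)
    then show "ewp (exec L length_loop \<tau>) F \<le> ennreal (A * real (clock \<tau>) + (A * (3 + 3 * real lm) + X))"
      by (simp add: lm_def algebra_simps)
  qed
  also have "\<dots> = ennreal (A * (base_cost C \<delta> + push_cost C \<delta> * P) + Z)"
    by (simp add: \<sigma> X_def cost_def base_cost_def push_cost_def Km_def lm_def hn_def \<kappa>_def algebra_simps)
  finally show ?thesis
    by (simp add: algorithm_def ewp_Seq F_def \<sigma>_def P_def Z_def f_def)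
qed

end

section \<open>Asymptotic form of the costs\<close>

lemma max_scale_le:
  assumes "0 < \<delta>" "\<delta> \<le> 1"
  shows "real (max_scale \<delta>) \<le> 2 * (1 / \<delta>) powr (1 / 3)"
proof -
  have "1 \<le> (1 / \<delta>) powr (1 / 3)" using assms by (intro ge_one_powr_ge_zero) auto
  then show ?thesis unfolding max_scale_def by linarith
qed

lemma ln_two_plus_ge_1: "1 \<le> x \<Longrightarrow> 1 \<le> ln (2 + x :: real)"
  using exp_le by (subst ln_ge_iff) auto

lemma max_length_le:
  assumes "0 < \<alpha>" "\<alpha> < 1" "0 < \<delta>" "\<delta> \<le> 1"
  shows "real (max_length \<alpha> \<delta>) \<le> (1 / ln (1 / (1 - \<alpha>)) + 2) * ln (2 + 1 / \<delta>)"
proof -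
  define \<beta> where "\<beta> = ln (1 / (1 - \<alpha>))"
  have \<beta>: "0 < \<beta>" using assms by (simp add: \<beta>_def)
  define D where "D = ln (2 + 1 / \<delta>)"
  have "1 \<le> 1 / \<delta>" using assms by simp
  then have D: "1 \<le> D" unfolding D_def by (rule ln_two_plus_ge_1)
  have ln: "0 \<le> ln (1 / \<delta>)" "ln (1 / \<delta>) \<le> D"
    unfolding D_def using assms \<open>1 \<le> 1 / \<delta>\<close> by (intro ln_ge_zero ln_mono; simp)+
  have "0 \<le> ln (1 / \<delta>) / \<beta>" using ln \<beta> by simp
  then have "real (max_length \<alpha> \<delta>) \<le> ln (1 / \<delta>) / \<beta> + 2"
    unfolding max_length_def \<beta>_def[symmetric] by linarith
  also have "\<dots> \<le> D / \<beta> + 2 * D" using ln \<beta> D by (intro add_mono divide_right_mono) auto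
  finally show ?thesis by (simp add: \<beta>_def D_def distrib_right)
qed

text \<open>The scale is at most \<open>2 * x\<close> with
  \<open>x = (1 / \<delta>) powr (1 / 3)\<close>. No term has more than two factors of the scale or
  more than one of length and harmonic number, so all fit under a multiple of
  \<open>x\<^sup>2\<close> times both logarithms, which are at least 1. In 445, 25 comes from
  \<open>base_cost\<close> and 420 from \<open>push_cost\<close>.\<close>

lemma (in ppr_algo) cost_le:
  assumes \<delta>: "0 < \<delta>" "\<delta> \<le> 1" and n: "0 < card V"
    and c_def: "c = 1 / ln (1 / (1 - \<alpha>)) + 2" and \<kappa>_def: "\<kappa> = 9 + 6 / \<alpha>"
  shows "base_cost C \<delta> + push_cost C \<delta> \<le>
    (445 + 3 * c + (2 * c + 4) * \<kappa> * real C + 120 * real C * c) * (1 / \<delta>) powr (2 / 3)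
      * (ln (2 + real (card V)) * ln (2 + 1 / \<delta>)) ^ 1"
proof -
  define x where "x = (1 / \<delta>) powr (1 / 3)"
  define N where "N = ln (2 + real (card V))"
  define D where "D = ln (2 + 1 / \<delta>)"
  define K where "K = real (max_scale \<delta>)"
  define l where "l = real (max_length \<alpha> \<delta>)"
  define h where "h = (harm (card V) :: real)"
  have x: "1 \<le> x" unfolding x_def using \<delta> by (intro ge_one_powr_ge_zero) auto
  have x2: "(1 / \<delta>) powr (2 / 3) = x\<^sup>2"
    unfolding x_def power2_eq_square by (simp flip: powr_add)
  have N: "1 \<le> N" unfolding N_def using n by (intro ln_two_plus_ge_1) auto
  have D: "1 \<le> D" unfolding D_def using \<delta> by (intro ln_two_plus_ge_1) auto
  have c: "0 \<le> c" using alpha_pos alpha_less by (simp add: c_def)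
  have \<kappa>: "0 \<le> \<kappa>" using alpha_pos by (simp add: \<kappa>_def)
  have K: "0 \<le> K" "K \<le> 2 * x" unfolding K_def x_def using max_scale_le[OF \<delta>] by auto
  have l: "0 \<le> l" "l \<le> c * D"
    unfolding l_def c_def D_def using max_length_le[OF alpha_pos alpha_less \<delta>] by auto
  have "ln (real (card V)) \<le> N" unfolding N_def using n by (intro ln_mono) auto
  then have h: "0 \<le> h" "h \<le> 2 * N"
    using harm_le_ln[OF n] N by (auto simp: h_def harm_nonneg)
  define Y where "Y = x\<^sup>2 * (N * D)"
  have xx: "x \<le> x\<^sup>2" "1 \<le> x\<^sup>2" using x by (simp_all add: power2_eq_square mult_le_cancel_left1 one_le_power[of x 2, unfolded power2_eq_square])
  have Y: "1 \<le> Y" "x \<le> Y" "x\<^sup>2 * D \<le> Y" "x\<^sup>2 * N \<le> Y" "x\<^sup>2 \<le> Y" "D \<le> Y" "x * D \<le> Y" "x * N \<le> Y"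
  proof -
    have ND: "1 \<le> N * D" "D \<le> N * D" "N \<le> N * D" using mult_mono[OF N D] N D by (auto simp: mult_le_cancel_right1 mult_le_cancel_left1)
    have "x\<^sup>2 * 1 \<le> Y" "x\<^sup>2 * D \<le> Y" "x\<^sup>2 * N \<le> Y" unfolding Y_def using ND by (intro mult_left_mono; simp)+
    then show "x\<^sup>2 \<le> Y" "x\<^sup>2 * D \<le> Y" "x\<^sup>2 * N \<le> Y" by simp_all
    then show "1 \<le> Y" "x \<le> Y" using xx by linarith+
    have "x * D \<le> x\<^sup>2 * D" "x * N \<le> x\<^sup>2 * N" using xx N D by (auto intro!: mult_right_mono)
    then show "x * D \<le> Y" "x * N \<le> Y" using \<open>x\<^sup>2 * D \<le> Y\<close> \<open>x\<^sup>2 * N \<le> Y\<close> by linarith+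
    have "1 * D \<le> x\<^sup>2 * D" using xx D by (intro mult_right_mono) auto
    then show "D \<le> Y" using \<open>x\<^sup>2 * D \<le> Y\<close> by simp
  qed
  have Kl: "K * l \<le> 2 * c * Y"
  proof -
    have "K * l \<le> (2 * x) * (c * D)" using K l x by (intro mult_mono) auto
    also have "\<dots> = 2 * c * (x * D)" by simp
    also have "\<dots> \<le> 2 * c * Y" using Y c by (intro mult_left_mono) auto
    finally show ?thesis .
  qed
  have K2': "K\<^sup>2 \<le> (2 * x)\<^sup>2" using K by (intro power_mono) auto
  have K2: "K\<^sup>2 \<le> 4 * Y" using K2' Y by simp
  have KKl: "K * (K * l) \<le> 4 * c * Y"
  proof -
    have "K * (K * l) \<le> (2 * x) * ((2 * x) * (c * D))" using K l x by (intro mult_mono) auto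
    also have "\<dots> = 4 * c * (x\<^sup>2 * D)" by (simp add: power2_eq_square)
    also have "\<dots> \<le> 4 * c * Y" using Y c by (intro mult_left_mono) auto
    finally show ?thesis .
  qed
  have Kh: "K * h \<le> 4 * Y"
  proof -
    have "K * h \<le> (2 * x) * (2 * N)" using K h x by (intro mult_mono) auto
    then show ?thesis using Y by simp
  qed
  have hK2: "h * K\<^sup>2 \<le> 8 * Y"
  proof -
    have "h * K\<^sup>2 \<le> (2 * N) * (2 * x)\<^sup>2" using K2' h N by (intro mult_mono) auto
    then show ?thesis using Y by (simp add: power_mult_distrib mult_ac)
  qed
  have l': "l \<le> c * Y"
  proof -
    have "c * D \<le> c * Y" using Y c by (intro mult_left_mono) auto
    then show ?thesis using l by simp
  qed
  have base: "base_cost C \<delta> \<le> 21 * Y + 4 * Y + 3 * (c * Y) + \<kappa> * (real C * (2 * c * Y) + real C * (4 * Y))"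
  proof -
    have "\<kappa> * (real C * (K * l) + real C * K\<^sup>2) \<le> \<kappa> * (real C * (2 * c * Y) + real C * (4 * Y))"
      using \<kappa> Kl K2 by (intro mult_left_mono add_mono) auto
    moreover have "K \<le> 2 * Y" using K Y by simp
    moreover have "21 \<le> 21 * Y" using Y by simp
    ultimately show ?thesis
      unfolding base_cost_def K_def[symmetric] l_def[symmetric] \<kappa>_def[symmetric] mult.assoc using l' by linarith
  qed
  have push: "push_cost C \<delta> \<le> 30 * (real C * (4 * c * Y)) + 30 * (4 * Y) + 30 * (2 * Y) + 30 * (8 * Y)"
  proof -
    have "push_cost C \<delta> = 30 * (real C * (K * (K * l))) + 30 * (K * h) + 30 * K + 30 * (h * K\<^sup>2)"
      by (simp add: push_cost_def K_def l_def h_def algebra_simps)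
    moreover have "real C * (K * (K * l)) \<le> real C * (4 * c * Y)" using KKl by (intro mult_left_mono) auto
    moreover have "K \<le> 2 * Y" using K Y by simp
    ultimately show ?thesis using Kh hK2 by linarith
  qed
  have "base_cost C \<delta> + push_cost C \<delta> \<le> (445 + 3 * c + (2 * c + 4) * \<kappa> * real C + 120 * real C * c) * Y"
    using base push by (simp add: algebra_simps)
  then show ?thesis by (simp add: Y_def x2 N_def D_def mult.assoc)
qed

lemma expected_time_eq_ewp: "expected_time p = ewp p (\<lambda>\<sigma>. ennreal (real (clock \<sigma>)))"
  by (simp add: expected_time_def ewp_def ennreal_of_nat_eq_real_of_nat cong: option.case_cong)

theorem theorem2p16:
  fixes \<alpha> p\<^sub>f \<epsilon> :: real
  assumes "0 < \<alpha>" "\<alpha> < 1" and "0 < p\<^sub>f" "p\<^sub>f < 1" and "0 < \<epsilon>" "\<epsilon> < 1"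
  shows "\<exists>P :: com.
    (\<forall>(G :: nat pair_pre_digraph) L s t \<delta>.
       pair_fin_digraph G \<and> represents L G \<and> s \<in> pverts G \<and> t \<in> pverts G \<and> 0 < \<delta> \<and> \<delta> \<le> 1 \<longrightarrow>
       measure (measure_spmf (exec L P (init_state \<alpha> \<epsilon> p\<^sub>f s t \<delta>)))
         {\<sigma>. \<bar>estimate \<sigma> - ppr \<alpha> G s t\<bar> \<le> \<epsilon> * max \<delta> (ppr \<alpha> G s t)} \<ge> 1 - p\<^sub>f) \<and>
    (\<exists>(C :: real) (k :: nat). \<forall>(G :: nat pair_pre_digraph) L s \<delta>.
       pair_fin_digraph G \<and> represents L G \<and> s \<in> pverts G \<and> 0 < \<delta> \<and> \<delta> \<le> 1 \<longrightarrow>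
       (\<Sum>t\<in>pverts G. expected_time (exec L P (init_state \<alpha> \<epsilon> p\<^sub>f s t \<delta>))) / of_nat (card (pverts G))
       \<le> ennreal (C * (1 / \<delta>) powr (2 / 3)
                   * (ln (2 + real (card (pverts G))) * ln (2 + 1 / \<delta>)) ^ k))"
proof -
  \<comment> \<open>Chebyshev's inequality for mean squared error
    \<open>3 * m\<^sup>2 / (\<alpha>\<^sup>2 * C)\<close> and deviation
    \<open>\<epsilon> * m\<close> leads to this constant.\<close>
  define C where "C = nat \<lceil>3 / (\<alpha>\<^sup>2 * \<epsilon>\<^sup>2 * p\<^sub>f)\<rceil>"
  have C_ge: "3 / (\<alpha>\<^sup>2 * \<epsilon>\<^sup>2 * p\<^sub>f) \<le> real C" and C: "0 < C"
    using assms by (auto simp: C_def intro!: real_nat_ceiling_ge)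
  have C_bound: "3 / (\<alpha>\<^sup>2 * real C) \<le> p\<^sub>f * \<epsilon>\<^sup>2"
    using C_ge C assms by (simp add: field_simps)
  define c where "c = 1 / ln (1 / (1 - \<alpha>)) + 2"
  define \<kappa> where "\<kappa> = 9 + 6 / \<alpha>"
  show ?thesis
  proof (intro exI[of _ "algorithm C"] conjI allI impI
      exI[of _ "445 + 3 * c + (2 * c + 4) * \<kappa> * real C + 120 * real C * c"] exI[of _ 1])
    fix G L s t \<delta>
    assume asm: "pair_fin_digraph G \<and> represents L G \<and> s \<in> pverts G \<and> t \<in> pverts G \<and> 0 < \<delta> \<and> \<delta> \<le> (1::real)"
    define p where "p = exec L (algorithm C) (init_state \<alpha> \<epsilon> p\<^sub>f s t \<delta>)"
    define f where "f = ppr \<alpha> G s t"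
    define m where "m = max \<delta> f"
    define d where "d = \<epsilon> * m"
    have m: "0 < m" using asm by (auto simp: m_def less_max_iff_disj)
    have d: "0 < d" using m assms by (simp add: d_def)
    define good where "good = {\<sigma>. \<bar>estimate \<sigma> - f\<bar> \<le> d}"
    \<comment> \<open>The complement is taken among optional states, so \<open>q\<close> counts
      divergence as failure.\<close>
    define q where "q = measure (measure_pmf p) (- Some ` good)"
    interpret ppr_graph G \<alpha> using asm assms by (intro ppr_graph.intro) auto
    define T where "T = base_cost C \<delta> + push_cost C \<delta> * (\<Sum>w\<in>V. ppr \<alpha> G w t)"
    \<comment> \<open>Markov's inequality for the potential with \<open>B = 1\<close>. As
      \<open>T\<close> does not depend on \<open>A\<close>, the limit \<open>A\<close> to 0 removes
      the time and leaves Chebyshev's bound.\<close>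
    have markov: "d\<^sup>2 * q \<le> A * T + p\<^sub>f * d\<^sup>2" if A: "0 < A" for A
    proof -
      interpret ppr_algo G \<alpha> L A using asm assms A by (intro ppr_algo.intro ppr_graph.intro ppr_algo_axioms.intro) auto
      have "ennreal (d\<^sup>2) * ennreal q = (\<integral>\<^sup>+ r. ennreal (d\<^sup>2) * indicator (- Some ` good) r \<partial>measure_pmf p)"
        by (simp add: q_def nn_integral_cmult measure_pmf.emeasure_eq_measure)
      also have "\<dots> \<le> ewp p (\<lambda>\<tau>. ennreal (A * real (clock \<tau>) + 1 * (estimate \<tau> - f)\<^sup>2))"
        unfolding ewp_def
      proof (intro nn_integral_mono)
        fix r
        show "ennreal (d\<^sup>2) * indicator (- Some ` good) r \<le>
          (case r of None \<Rightarrow> \<infinity> | Some \<tau> \<Rightarrow> ennreal (A * real (clock \<tau>) + 1 * (estimate \<tau> - f)\<^sup>2))"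
        proof (cases r)
          case (Some \<tau>)
          show ?thesis
          proof (cases "\<tau> \<in> good")
            case False
            then have "d\<^sup>2 \<le> \<bar>estimate \<tau> - f\<bar>\<^sup>2" using d by (intro power_mono) (auto simp: good_def)
            then have "d\<^sup>2 \<le> A * real (clock \<tau>) + 1 * (estimate \<tau> - f)\<^sup>2" using A by (simp add: add_increasing)
            then show ?thesis using False Some by (auto simp: indicator_def intro!: ennreal_leI)
          qed (simp add: Some)
        qed simp
      qed
      also have "\<dots> \<le> ennreal (A * T + 1 * (3 * m\<^sup>2 / (\<alpha>\<^sup>2 * real C)))"
        unfolding p_def f_def m_def T_def using asm C by (intro ewp_algorithm) auto
      also have "\<dots> \<le> ennreal (A * T + p\<^sub>f * d\<^sup>2)"
      proof (intro ennreal_leI add_left_mono)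
        have "3 / (\<alpha>\<^sup>2 * real C) * m\<^sup>2 \<le> p\<^sub>f * \<epsilon>\<^sup>2 * m\<^sup>2" using C_bound by (intro mult_right_mono) auto
        then show "1 * (3 * m\<^sup>2 / (\<alpha>\<^sup>2 * real C)) \<le> p\<^sub>f * d\<^sup>2" by (simp add: d_def power_mult_distrib mult_ac)
      qed
      finally have le: "ennreal (d\<^sup>2 * q) \<le> ennreal (A * T + p\<^sub>f * d\<^sup>2)" by (simp add: ennreal_mult q_def)
      have "0 \<le> T"
        unfolding T_def base_cost_def push_cost_def using alpha_pos
        by (intro add_nonneg_nonneg mult_nonneg_nonneg sum_nonneg ppr_nonneg harm_nonneg) auto
      then have "0 \<le> A * T + p\<^sub>f * d\<^sup>2" using A assms by simp
      with le show ?thesis by (simp add: ennreal_le_iff)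
    qed
    have "(\<lambda>n. inverse (real (Suc n)) * T + p\<^sub>f * d\<^sup>2) \<longlonglongrightarrow> 0 * T + p\<^sub>f * d\<^sup>2"
      by (intro tendsto_intros LIMSEQ_inverse_real_of_nat)
    then have "d\<^sup>2 * q \<le> 0 * T + p\<^sub>f * d\<^sup>2"
      by (rule LIMSEQ_le_const) (use markov in auto)
    then have "q \<le> p\<^sub>f" using d by (simp add: mult.commute)
    moreover have "measure (measure_spmf p) good = 1 - q"
      using measure_pmf.prob_compl[of "Some ` good" p]
    by (simp add: q_def measure_measure_spmf_conv_measure_pmf Compl_eq_Diff_UNIV)
    ultimately show "measure (measure_spmf (exec L (algorithm C) (init_state \<alpha> \<epsilon> p\<^sub>f s t \<delta>)))
         {\<sigma>. \<bar>estimate \<sigma> - ppr \<alpha> G s t\<bar> \<le> \<epsilon> * max \<delta> (ppr \<alpha> G s t)} \<ge> 1 - p\<^sub>f"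
      by (simp add: p_def good_def f_def d_def m_def)
  next
    fix G L s \<delta>
    assume asm: "pair_fin_digraph G \<and> represents L G \<and> s \<in> pverts G \<and> 0 < \<delta> \<and> \<delta> \<le> (1::real)"
    \<comment> \<open>With \<open>A = 1\<close> here and \<open>B = 0\<close> below, the potential
      bounds the clock alone.\<close>
    interpret ppr_algo G \<alpha> L 1 using asm assms by (intro ppr_algo.intro ppr_graph.intro ppr_algo_axioms.intro) auto
    define T0 where "T0 = base_cost C \<delta>"
    define T1 where "T1 = push_cost C \<delta>"
    have T: "0 \<le> T0" "0 \<le> T1"
      unfolding T0_def T1_def base_cost_def push_cost_def using alpha_pos
      by (intro add_nonneg_nonneg mult_nonneg_nonneg harm_nonneg; simp)+
    have n: "0 < card V" using asm by (auto simp: card_gt_0_iff)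
    have "(\<Sum>t\<in>V. expected_time (exec L (algorithm C) (init_state \<alpha> \<epsilon> p\<^sub>f s t \<delta>))) \<le>
      (\<Sum>t\<in>V. ennreal (T0 + T1 * (\<Sum>w\<in>V. ppr \<alpha> G w t)))"
    proof (rule sum_mono)
      fix t assume "t \<in> V"
      then have "ewp (exec L (algorithm C) (init_state \<alpha> \<epsilon> p\<^sub>f s t \<delta>))
        (\<lambda>\<tau>. ennreal (1 * real (clock \<tau>) + 0 * (estimate \<tau> - ppr \<alpha> G s t)\<^sup>2)) \<le>
        ennreal (1 * (base_cost C \<delta> + push_cost C \<delta> * (\<Sum>w\<in>V. ppr \<alpha> G w t)) + 0 * (3 * (max \<delta> (ppr \<alpha> G s t))\<^sup>2 / (\<alpha>\<^sup>2 * real C)))"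
        using asm C by (intro ewp_algorithm) auto
      then show "expected_time (exec L (algorithm C) (init_state \<alpha> \<epsilon> p\<^sub>f s t \<delta>)) \<le> ennreal (T0 + T1 * (\<Sum>w\<in>V. ppr \<alpha> G w t))"
        by (simp add: expected_time_eq_ewp T0_def T1_def)
    qed
    also have "\<dots> = ennreal (\<Sum>t\<in>V. T0 + T1 * (\<Sum>w\<in>V. ppr \<alpha> G w t))"
      using T by (intro sum_ennreal add_nonneg_nonneg mult_nonneg_nonneg sum_nonneg ppr_nonneg)
    also have "\<dots> \<le> ennreal (real (card V) * (T0 + T1))"
    proof (rule ennreal_leI)
      \<comment> \<open>Averaging over targets: for each start \<open>w\<close> the endpoint
        probabilities sum to at most 1, so the double sum is at most the number of nodes.\<close>
      have "(\<Sum>t\<in>V. \<Sum>w\<in>V. ppr \<alpha> G w t) = (\<Sum>w\<in>V. \<Sum>t\<in>V. ppr \<alpha> G w t)" by (rule sum.swap)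
      also have "\<dots> \<le> (\<Sum>w\<in>V. 1)" by (intro sum_mono sum_ppr_le_1)
      finally have "T1 * (\<Sum>t\<in>V. \<Sum>w\<in>V. ppr \<alpha> G w t) \<le> T1 * real (card V)"
        using T by (intro mult_left_mono) auto
      then show "(\<Sum>t\<in>V. T0 + T1 * (\<Sum>w\<in>V. ppr \<alpha> G w t)) \<le> real (card V) * (T0 + T1)"
        by (simp add: sum.distrib sum_distrib_left[symmetric] algebra_simps)
    qed
    finally have "(\<Sum>t\<in>V. expected_time (exec L (algorithm C) (init_state \<alpha> \<epsilon> p\<^sub>f s t \<delta>))) / of_nat (card V) \<le>
      ennreal (real (card V) * (T0 + T1)) / of_nat (card V)"
      by (rule divide_right_mono_ennreal)
    also have "\<dots> = ennreal (T0 + T1)"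
      unfolding ennreal_of_nat_eq_real_of_nat using n T by (subst divide_ennreal) auto
    also have "\<dots> \<le> ennreal ((445 + 3 * c + (2 * c + 4) * \<kappa> * real C + 120 * real C * c) * (1 / \<delta>) powr (2 / 3)
      * (ln (2 + real (card V)) * ln (2 + 1 / \<delta>)) ^ 1)"
      unfolding T0_def T1_def using asm n by (intro ennreal_leI cost_le c_def \<kappa>_def) auto
    finally show "(\<Sum>t\<in>pverts G. expected_time (exec L (algorithm C) (init_state \<alpha> \<epsilon> p\<^sub>f s t \<delta>))) / of_nat (card (pverts G))
       \<le> ennreal ((445 + 3 * c + (2 * c + 4) * \<kappa> * real C + 120 * real C * c) * (1 / \<delta>) powr (2 / 3)
                   * (ln (2 + real (card (pverts G))) * ln (2 + 1 / \<delta>)) ^ 1)" .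
  qed
qed

end
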